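(* Let $d \geq 3$, let $T_d$ be the $d$-regular tree, and let $G \leq \mathrm{Aut}(T_d)$ be a closed non-compact subgroup which acts transitively on the set of vertices of $T_d$, acts transitively on the boundary $\partial T_d$, and has Tits' independence property. Then $G$ is a locally compact group of type $\mathrm{I}$; that is, for every unitary representation $\pi$ of $G$, the von Neumann algebra $\pi(G)''$ generated by $\pi(G)$ is of type $\mathrm{I}$.
   Context: $T_d$ denotes the $d$-regular tree, $d\ge 3$ (every vertex has exactly $d$ neighbours). $\mathrm{Aut}(T_d)$ is its automorphism group with the topology of pointwise convergence (on vertices); it is a totally disconnected locally compact group, and closed subgroups carry the induced topology. Boundary: after fixing a vertex $x_0$, the boundary $\partial T_d$ is the set of infinite geodesic rays starting at $x_0$ (equivalently, the set of ends of $T_d$; it does not depend on $x_0$), on which $\mathrm{Aut}(T_d)$ acts naturally. For a set $S$ of vertices (or a subtree $S$, identified with its set of vertices), $G_S := \{g \in G : g(s)=s \text{ for all } s\in S\}$ is the pointwise stabilizer. Tits' independence property: $G \leq \mathrm{Aut}(T_d)$ has Tits' independence property if for every edge $e$ of $T_d$ one has $G_e = G_{h_1} G_{h_2}$, where $h_1,h_2$ are the two half-trees emanating from $e$ (the two connected components obtained by deleting the interior of $e$), and $G_e$ is the pointwise stabilizer of $e$ (both endpoints fixed). Unitary representations are strongly continuous unitary representations on complex Hilbert spaces. A locally compact group $G$ is of type $\mathrm{I}$ if for every unitary representation $\pi$ of $G$ the von Neumann algebra $\pi(G)''$ (double commutant) is of type $\mathrm{I}$. *)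

theory Defs
  imports "HOL-Analysis.Analysis" "HOL-Algebra.Coset"
begin

section \<open>Complex Hilbert spaces and bounded operators\<close>

text \<open>
  The real structure inherited from \<^class>\<open>real_inner\<close> is the one underlying the complex
  structure. The inner product is linear in its first argument. Positive definiteness and
  the relation between norm and \<open>cinner\<close> follow from \<open>inner_eq_Re_cinner\<close> and
  \<open>cinner_commute\<close>.
\<close>

class chilbert_space = real_inner + complete_space +
  fixes scaleC :: "complex \<Rightarrow> 'a \<Rightarrow> 'a"
    and cinner :: "'a \<Rightarrow> 'a \<Rightarrow> complex"
  assumes scaleC_add_right: "scaleC a (x + y) = scaleC a x + scaleC a y"
    and scaleC_add_left: "scaleC (a + b) x = scaleC a x + scaleC b x"
    and scaleC_scaleC: "scaleC a (scaleC b x) = scaleC (a * b) x"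
    and scaleR_eq_scaleC: "scaleR r x = scaleC (complex_of_real r) x"
    and cinner_commute: "cinner x y = cnj (cinner y x)"
    and cinner_add_left: "cinner (x + y) z = cinner x z + cinner y z"
    and cinner_scaleC_left: "cinner (scaleC a x) y = a * cinner x y"
    and inner_eq_Re_cinner: "inner x y = Re (cinner x y)"

instantiation complex :: chilbert_space
begin

definition scaleC_complex :: "complex \<Rightarrow> complex \<Rightarrow> complex"
  where "scaleC_complex a x = a * x"

definition cinner_complex :: "complex \<Rightarrow> complex \<Rightarrow> complex"
  where "cinner_complex x y = x * cnj y"

instance
  by standard
    (auto simp: scaleC_complex_def cinner_complex_def algebra_simps scaleR_conv_of_real
      inner_complex_def)

end

definition bounded_clinear :: "('h::chilbert_space \<Rightarrow> 'h) \<Rightarrow> bool" where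
  "bounded_clinear A \<longleftrightarrow> bounded_linear A \<and> (\<forall>c x. A (scaleC c x) = scaleC c (A x))"

definition is_adjoint :: "('h::chilbert_space \<Rightarrow> 'h) \<Rightarrow> ('h \<Rightarrow> 'h) \<Rightarrow> bool" where
  "is_adjoint A B \<longleftrightarrow> (\<forall>x y. cinner (A x) y = cinner x (B y))"

definition unitary_operator :: "('h::chilbert_space \<Rightarrow> 'h) \<Rightarrow> bool" where
  "unitary_operator A \<longleftrightarrow>
     bounded_clinear A \<and> surj A \<and> (\<forall>x y. cinner (A x) (A y) = cinner x y)"

definition orthogonal_projection :: "('h::chilbert_space \<Rightarrow> 'h) \<Rightarrow> bool" where
  "orthogonal_projection P \<longleftrightarrow> bounded_clinear P \<and> P \<circ> P = P \<and> is_adjoint P P"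

section \<open>Von Neumann algebras\<close>

definition commutant :: "('h::chilbert_space \<Rightarrow> 'h) set \<Rightarrow> ('h \<Rightarrow> 'h) set" where
  "commutant S = {A. bounded_clinear A \<and> (\<forall>B\<in>S. A \<circ> B = B \<circ> A)}"

definition von_neumann_algebra :: "('h::chilbert_space \<Rightarrow> 'h) set \<Rightarrow> bool" where
  "von_neumann_algebra M \<longleftrightarrow>
     commutant (commutant M) = M \<and> (\<forall>A\<in>M. \<exists>B\<in>M. is_adjoint A B)"

definition central_projection :: "('h::chilbert_space \<Rightarrow> 'h) set \<Rightarrow> ('h \<Rightarrow> 'h) \<Rightarrow> bool" where
  "central_projection M Z \<longleftrightarrow> orthogonal_projection Z \<and> Z \<in> M \<and> Z \<in> commutant M"

text \<open>A projection \<open>P\<close> in \<open>M\<close> is abelian if the corner \<open>P M P\<close> is commutative.\<close>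

definition abelian_projection :: "('h::chilbert_space \<Rightarrow> 'h) set \<Rightarrow> ('h \<Rightarrow> 'h) \<Rightarrow> bool" where
  "abelian_projection M P \<longleftrightarrow> orthogonal_projection P \<and> P \<in> M \<and>
     (\<forall>A\<in>M. \<forall>B\<in>M. (P \<circ> A \<circ> P) \<circ> (P \<circ> B \<circ> P) = (P \<circ> B \<circ> P) \<circ> (P \<circ> A \<circ> P))"

text \<open>
  Type I in the sense of Takesaki: every nonzero central projection \<open>Z\<close> majorizes a nonzero
  abelian projection \<open>P\<close>. The condition \<open>Z \<circ> P = P\<close> says \<open>P \<le> Z\<close>.
\<close>

definition type_I_von_neumann_algebra :: "('h::chilbert_space \<Rightarrow> 'h) set \<Rightarrow> bool" where
  "type_I_von_neumann_algebra M \<longleftrightarrow> von_neumann_algebra M \<and>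
     (\<forall>Z. central_projection M Z \<and> Z \<noteq> (\<lambda>x. 0) \<longrightarrow>
        (\<exists>P. abelian_projection M P \<and> P \<noteq> (\<lambda>x. 0) \<and> Z \<circ> P = P))"

section \<open>Topological groups and unitary representations\<close>

definition topological_group :: "('g, 'b) monoid_scheme \<Rightarrow> 'g topology \<Rightarrow> bool" where
  "topological_group \<G> T \<longleftrightarrow> group \<G> \<and> topspace T = carrier \<G> \<and>
     continuous_map (prod_topology T T) T (\<lambda>(g, h). g \<otimes>\<^bsub>\<G>\<^esub> h) \<and>
     continuous_map T T (\<lambda>g. inv\<^bsub>\<G>\<^esub> g)"

definition locally_compact_group :: "('g, 'b) monoid_scheme \<Rightarrow> 'g topology \<Rightarrow> bool" where
  "locally_compact_group \<G> T \<longleftrightarrow>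
     topological_group \<G> T \<and> Hausdorff_space T \<and> locally_compact_space T"

definition unitary_representation ::
  "('g, 'b) monoid_scheme \<Rightarrow> 'g topology \<Rightarrow> ('g \<Rightarrow> 'h::chilbert_space \<Rightarrow> 'h) \<Rightarrow> bool" where
  "unitary_representation \<G> T \<pi> \<longleftrightarrow>
     (\<forall>g\<in>carrier \<G>. unitary_operator (\<pi> g)) \<and>
     (\<forall>g\<in>carrier \<G>. \<forall>h\<in>carrier \<G>. \<pi> (g \<otimes>\<^bsub>\<G>\<^esub> h) = \<pi> g \<circ> \<pi> h) \<and>
     (\<forall>\<xi>. continuous_map T euclidean (\<lambda>g. \<pi> g \<xi>))"

section \<open>Regular trees\<close>

text \<open>
  A simple graph is given by its adjacency relation; the vertex set is the whole type.
  Cycles are lists of at least three distinct vertices.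
\<close>

definition tree :: "('v \<Rightarrow> 'v \<Rightarrow> bool) \<Rightarrow> bool" where
  "tree E \<longleftrightarrow> symp E \<and> irreflp E \<and> (\<forall>x y. E\<^sup>*\<^sup>* x y) \<and>
     \<not> (\<exists>xs. length xs \<ge> 3 \<and> distinct xs \<and> successively E xs \<and> E (last xs) (hd xs))"

definition regular_tree :: "nat \<Rightarrow> ('v \<Rightarrow> 'v \<Rightarrow> bool) \<Rightarrow> bool" where
  "regular_tree d E \<longleftrightarrow> tree E \<and> (\<forall>x. finite {y. E x y} \<and> card {y. E x y} = d)"

definition graph_dist :: "('v \<Rightarrow> 'v \<Rightarrow> bool) \<Rightarrow> 'v \<Rightarrow> 'v \<Rightarrow> nat" where
  "graph_dist E x y = (LEAST n. (E ^^ n) x y)"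

definition geodesic_rays :: "('v \<Rightarrow> 'v \<Rightarrow> bool) \<Rightarrow> (nat \<Rightarrow> 'v) set" where
  "geodesic_rays E = {r. \<forall>m n. m \<le> n \<longrightarrow> graph_dist E (r m) (r n) = n - m}"

text \<open>
  The boundary is the set of ends, i.e. of geodesic rays from arbitrary base points modulo
  eventual coincidence up to a shift of the parameter. Every end has exactly one
  representative starting at a given vertex, and on ends the action of the automorphism
  group needs no base point.
\<close>

definition cofinal_rays :: "('v \<Rightarrow> 'v \<Rightarrow> bool) \<Rightarrow> ((nat \<Rightarrow> 'v) \<times> (nat \<Rightarrow> 'v)) set" where
  "cofinal_rays E = {(r, s). r \<in> geodesic_rays E \<and> s \<in> geodesic_rays E \<and>
     (\<exists>m n. \<forall>k. r (m + k) = s (n + k))}"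

definition boundary :: "('v \<Rightarrow> 'v \<Rightarrow> bool) \<Rightarrow> (nat \<Rightarrow> 'v) set set" where
  "boundary E = geodesic_rays E // cofinal_rays E"

definition boundary_action :: "('v \<Rightarrow> 'v) \<Rightarrow> (nat \<Rightarrow> 'v) set \<Rightarrow> (nat \<Rightarrow> 'v) set" where
  "boundary_action g \<xi> = (\<lambda>r. g \<circ> r) ` \<xi>"

text \<open>The half-tree emanating from the edge \<open>{x, y}\<close> that contains \<open>x\<close>.\<close>

definition half_tree :: "('v \<Rightarrow> 'v \<Rightarrow> bool) \<Rightarrow> 'v \<Rightarrow> 'v \<Rightarrow> 'v set" where
  "half_tree E x y = {z. (\<lambda>a b. E a b \<and> {a, b} \<noteq> {x, y})\<^sup>*\<^sup>* x z}"

section \<open>Groups of tree automorphisms\<close>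

definition Aut :: "('v \<Rightarrow> 'v \<Rightarrow> bool) \<Rightarrow> ('v \<Rightarrow> 'v) monoid" where
  "Aut E = \<lparr>carrier = {g. bij g \<and> (\<forall>x y. E (g x) (g y) \<longleftrightarrow> E x y)}, mult = (\<circ>), one = id\<rparr>"

text \<open>The topology of pointwise convergence, vertices being discrete.\<close>

definition Aut_topology :: "('v \<Rightarrow> 'v \<Rightarrow> bool) \<Rightarrow> ('v \<Rightarrow> 'v) topology" where
  "Aut_topology E =
     subtopology (product_topology (\<lambda>_. discrete_topology UNIV) UNIV) (carrier (Aut E))"

definition vertex_transitive :: "('v \<Rightarrow> 'v) set \<Rightarrow> bool" where
  "vertex_transitive G \<longleftrightarrow> (\<forall>x y. \<exists>g\<in>G. g x = y)"

definition boundary_transitive :: "('v \<Rightarrow> 'v \<Rightarrow> bool) \<Rightarrow> ('v \<Rightarrow> 'v) set \<Rightarrow> bool" where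
  "boundary_transitive E G \<longleftrightarrow>
     (\<forall>\<xi>\<in>boundary E. \<forall>\<eta>\<in>boundary E. \<exists>g\<in>G. boundary_action g \<xi> = \<eta>)"

definition fixator :: "('v \<Rightarrow> 'v) set \<Rightarrow> 'v set \<Rightarrow> ('v \<Rightarrow> 'v) set" where
  "fixator G S = {g\<in>G. \<forall>s\<in>S. g s = s}"

definition tits_independence :: "('v \<Rightarrow> 'v \<Rightarrow> bool) \<Rightarrow> ('v \<Rightarrow> 'v) set \<Rightarrow> bool" where
  "tits_independence E G \<longleftrightarrow> (\<forall>x y. E x y \<longrightarrow>
     fixator G {x, y} =
       fixator G (half_tree E x y) <#>\<^bsub>Aut E\<^esub> fixator G (half_tree E y x))"

end

theory Submission
  imports Defs "HOL-Computational_Algebra.Fundamental_Theorem_Algebra"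
begin

text \<open>
  Let \<open>Z\<close> be a nonzero central projection of \<open>\<pi>(G)''\<close>. Since the commutant preserves the space of
  vectors of \<open>Z H\<close> fixed by the pointwise stabilizer of a finite set of vertices, the projection onto
  it lies in \<open>\<pi>(G)''\<close>, and by continuity this space is nonzero for large finite sets. Three cases
  arise, as in Olshanskii's classification of the irreducible representations.
  (1) A vertex stabilizer has nonzero fixed vectors. \<open>G\<close> is transitive on pairs of vertices at a given
  distance, so compressing \<open>\<pi>(G)\<close> to them gives averages over spheres, which commute.
  (2) Only edges do. The vectors obtained by moving an edge around a vertex sum to zero, so
  compressing \<open>\<pi>(g)\<close> gives a scalar multiple of the identity or of the edge inversion.
  (3) Otherwise take a smallest subtree \<open>S\<close> whose 1-neighbourhood \<open>T\<close> has nonzero fixed vectors. By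
  Tits independence the compression of \<open>\<pi>(g)\<close> vanishes unless \<open>g S = S\<close>, so only the finite group induced
  by the setwise stabilizer on \<open>T\<close> matters, and an irreducible subspace of it
  yields a minimal projection by Schur's lemma.
\<close>

section \<open>Hilbert space geometry\<close>

text \<open>Transitivity on ends concerns all of \<open>G\<close>, whereas the first two cases need
  vertex stabilizers that are transitive on spheres; bridging this gap is the combinatorial core,
  and it is done edge by edge with distances. Analytically, neither Haar measure nor operator
  topologies occur: averages over compact open subgroups become elements of minimal norm in closed
  convex hulls, and density of the span of the operators \<open>\<pi> g\<close> in the bicommutant
  enters only through its action on two vectors at a time. The representation is arbitrary, so
  irreducibility is replaced by invariance under the commutant. In the third case the finite group
  may act noncommutatively on the fixed space, whose projection then need not be abelian; hence the
  descent to the commutant orbit of a single vector. The order of the cases is dictated by Tits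
  factorization: cutting a vertex off \<open>S\<close> leaves the neighbourhood of a smaller
  subtree, but if \<open>S\<close> is one vertex only an edge remains, so minimality of
  \<open>S\<close> helps only once edges are known to have no fixed vectors, and the argument for
  edges in turn needs that vertices have none.\<close>

lemma parallelogram_law:
  fixes a b :: "'a::real_inner"
  shows "(norm (a + b))\<^sup>2 + (norm (a - b))\<^sup>2 = 2 * (norm a)\<^sup>2 + 2 * (norm b)\<^sup>2"
  by (simp add: power2_norm_eq_inner inner_simps inner_commute)

text \<open>The midpoint of \<open>a\<close> and \<open>b\<close> lies in \<open>C\<close>, hence at
  distance at least \<delta> from \<open>x\<close>; the parallelogram law for \<open>x - a\<close>
  and \<open>x - b\<close> converts this into the bound. It yields both the Cauchy property of
  minimizing sequences and the uniqueness of nearest points.\<close>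

lemma dist_convex_parallelogram:
  fixes C :: "'a::real_inner set"
  assumes "convex C" "a \<in> C" "b \<in> C" "\<And>y. y \<in> C \<Longrightarrow> \<delta> \<le> dist x y" "\<delta> \<ge> 0"
  shows "(dist a b)\<^sup>2 \<le> 2 * (dist x a)\<^sup>2 + 2 * (dist x b)\<^sup>2 - 4 * \<delta>\<^sup>2"
proof -
  define m where "m = (1/2) *\<^sub>R a + (1/2) *\<^sub>R b"
  have "m \<in> C" unfolding m_def by (rule convexD[OF assms(1-3)]) auto
  then have "\<delta> \<le> dist x m" by (rule assms(4))
  then have "\<delta>\<^sup>2 \<le> (dist x m)\<^sup>2" using assms(5) by (simp add: power_mono)
  moreover have "(x - a) + (x - b) = 2 *\<^sub>R (x - m)"
    by (simp add: m_def scaleR_right_diff_distrib scaleR_right_distrib scaleR_2)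
  then have "(norm ((x - a) + (x - b)))\<^sup>2 = 4 * (dist x m)\<^sup>2"
    by (simp add: dist_norm power_mult_distrib)
  moreover have "(norm ((x - a) - (x - b)))\<^sup>2 = (dist a b)\<^sup>2"
    by (simp add: dist_norm norm_minus_commute)
  ultimately show ?thesis using parallelogram_law[of "x - a" "x - b"] by (simp add: dist_norm)
qed

lemma hilbert_closest_point_exists:
  fixes C :: "'a::{real_inner,complete_space} set"
  assumes "closed C" "convex C" "C \<noteq> {}"
  obtains c where "c \<in> C" "\<And>y. y \<in> C \<Longrightarrow> dist x c \<le> dist x y"
proof -
  define \<delta> where "\<delta> = infdist x C"
  have lower: "\<delta> \<le> dist x y" if "y \<in> C" for y
    using that by (simp add: \<delta>_def infdist_le)
  have \<delta>0: "\<delta> \<ge> 0" by (simp add: \<delta>_def infdist_nonneg)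
  have "\<exists>y\<in>C. dist x y < \<delta> + 1 / Suc n" for n
  proof -
    have "(INF a\<in>C. dist x a) < \<delta> + 1 / Suc n"
      using assms(3) by (simp add: \<delta>_def infdist_def)
    then show ?thesis by (subst (asm) cINF_less_iff) (use assms(3) in auto)
  qed
  then obtain c where c: "\<And>n. c n \<in> C" "\<And>n. dist x (c n) < \<delta> + 1 / Suc n" by metis
  have "Cauchy c"
  proof (rule metric_CauchyI)
    fix \<epsilon> :: real assume \<epsilon>: "\<epsilon> > 0"
    \<comment> \<open>The bound 1 keeps \<open>e * e\<close> below \<open>e\<close>, so the estimate
      becomes linear in \<open>e\<close>; the factor 8 then leaves at most half of
      \<open>\<epsilon>\<^sup>2\<close>.\<close>
    define e where "e = min 1 (\<epsilon>\<^sup>2 / (8 * (2 * \<delta> + 1)))"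
    have e: "e > 0" "e \<le> 1" using \<epsilon> \<delta>0 by (auto simp: e_def)
    have e4: "4 * (e * (2 * \<delta> + 1)) < \<epsilon>\<^sup>2"
    proof -
      have "e * (2 * \<delta> + 1) \<le> \<epsilon>\<^sup>2 / (8 * (2 * \<delta> + 1)) * (2 * \<delta> + 1)"
        using \<delta>0 by (intro mult_right_mono) (auto simp: e_def)
      also have "\<dots> = \<epsilon>\<^sup>2 / 8" using \<delta>0 by (simp add: field_simps)
      finally show ?thesis using \<epsilon> zero_less_power[OF \<epsilon>, of 2] by linarith
    qed
    obtain N where N: "1 / Suc N < e" using e(1) nat_approx_posE by metis
    have close: "(dist x (c n))\<^sup>2 \<le> (\<delta> + e)\<^sup>2" if "n \<ge> N" for n
    proof -
      have "1 / Suc n \<le> 1 / Suc N" using that by (simp add: frac_le)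
      then have "dist x (c n) \<le> \<delta> + e" using c(2)[of n] N by linarith
      then show ?thesis by (simp add: power_mono)
    qed
    show "\<exists>M. \<forall>m\<ge>M. \<forall>n\<ge>M. dist (c m) (c n) < \<epsilon>"
    proof (intro exI allI impI)
      fix m n assume mn: "N \<le> m" "N \<le> n"
      have "(dist (c m) (c n))\<^sup>2 \<le> 2 * (dist x (c m))\<^sup>2 + 2 * (dist x (c n))\<^sup>2 - 4 * \<delta>\<^sup>2"
        by (rule dist_convex_parallelogram[OF assms(2) c(1) c(1) lower \<delta>0])
      also have "\<dots> \<le> 4 * (\<delta> + e)\<^sup>2 - 4 * \<delta>\<^sup>2" using close[OF mn(1)] close[OF mn(2)] by linarith
      also have "\<dots> = 4 * (e * (2 * \<delta> + e))" by (simp add: power2_eq_square algebra_simps)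
      also have "\<dots> \<le> 4 * (e * (2 * \<delta> + 1))" using e by (simp add: mult_left_mono)
      also have "\<dots> < \<epsilon>\<^sup>2" by (rule e4)
      finally show "dist (c m) (c n) < \<epsilon>" using \<epsilon> by (simp add: power2_less_imp_less)
    qed
  qed
  then obtain l where l: "c \<longlonglongrightarrow> l" using Cauchy_convergent_iff convergent_def by blast
  have "l \<in> C" using assms(1) c(1) l closed_sequentially by blast
  moreover have "dist x l \<le> \<delta>"
  proof (rule LIMSEQ_le)
    show "(\<lambda>n. dist x (c n)) \<longlonglongrightarrow> dist x l" by (intro tendsto_intros l)
    show "(\<lambda>n. \<delta> + 1 / Suc n) \<longlonglongrightarrow> \<delta>"
      using tendsto_add[OF tendsto_const[of \<delta>] LIMSEQ_Suc[OF lim_1_over_n]] by simp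
    show "\<exists>N. \<forall>n\<ge>N. dist x (c n) \<le> \<delta> + 1 / Suc n" using c(2) less_imp_le by blast
  qed
  ultimately show ?thesis using that[of l] lower by force
qed

lemma hilbert_closest_point_unique:
  fixes C :: "'a::real_inner set"
  assumes "convex C" "a \<in> C" "b \<in> C" "\<And>y. y \<in> C \<Longrightarrow> dist x a \<le> dist x y" "dist x b \<le> dist x a"
  shows "a = b"
proof -
  have "(dist a b)\<^sup>2 \<le> 2 * (dist x a)\<^sup>2 + 2 * (dist x b)\<^sup>2 - 4 * (dist x a)\<^sup>2"
    by (rule dist_convex_parallelogram[OF assms(1-4)]) auto
  moreover have "(dist x b)\<^sup>2 \<le> (dist x a)\<^sup>2" using assms(5) by (simp add: power_mono)
  ultimately have "(dist a b)\<^sup>2 \<le> 0" by linarith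
  then show ?thesis by simp
qed

section \<open>Closed subspaces and orthogonal projections\<close>

lemma subspace_closure:
  fixes S :: "'a::real_normed_vector set"
  assumes "subspace S"
  shows "subspace (closure S)"
  unfolding subspace_def
proof (intro conjI ballI allI)
  show "0 \<in> closure S" using subspace_0[OF assms] closure_subset by blast
  fix x y :: 'a and c :: real assume x: "x \<in> closure S"
  obtain u where u: "\<And>n. u n \<in> S" "u \<longlonglongrightarrow> x" using x by (auto simp: closure_sequential)
  show "x + y \<in> closure S" if y: "y \<in> closure S"
  proof -
    obtain v where v: "\<And>n. v n \<in> S" "v \<longlonglongrightarrow> y" using y by (auto simp: closure_sequential)
    have "(\<lambda>n. u n + v n) \<longlonglongrightarrow> x + y" by (intro tendsto_intros u v)
    moreover have "\<forall>n. u n + v n \<in> S" using subspace_add[OF assms u(1) v(1)] by simp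
    ultimately show ?thesis unfolding closure_sequential by (intro exI[of _ "\<lambda>n. u n + v n"]) simp
  qed
  have "(\<lambda>n. c *\<^sub>R u n) \<longlonglongrightarrow> c *\<^sub>R x" by (intro tendsto_intros u)
  moreover have "\<forall>n. c *\<^sub>R u n \<in> S" using subspace_scale[OF assms u(1)] by simp
  ultimately show "c *\<^sub>R x \<in> closure S"
    unfolding closure_sequential by (intro exI[of _ "\<lambda>n. c *\<^sub>R u n"]) simp
qed

text \<open>Characterized by real orthogonality so that it also serves
  \<open>'h \<times> 'h\<close>, which is used only as a real Hilbert space; for complex subspaces
  the map is complex linear anyway (\<open>bounded_clinear_hproj\<close>).\<close>

definition hproj :: "'a::{real_inner,complete_space} set \<Rightarrow> 'a \<Rightarrow> 'a" where
  "hproj W x = (SOME c. c \<in> W \<and> (\<forall>w\<in>W. inner (x - c) w = 0))"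

lemma
  assumes "closed W" "subspace W"
  shows hproj_in: "hproj W x \<in> W" and hproj_orth: "w \<in> W \<Longrightarrow> inner (x - hproj W x) w = 0"
proof -
  obtain c where c: "c \<in> W" "\<And>y. y \<in> W \<Longrightarrow> dist x c \<le> dist x y"
    using hilbert_closest_point_exists[of W x] assms subspace_imp_convex subspace_0 by blast
  have "inner (x - c) w = 0" if "w \<in> W" for w
  proof (cases "w = 0")
    case False
    \<comment> \<open>The point \<open>c + t *\<^sub>R w\<close> is nearest to \<open>x\<close> on
      the line through \<open>c\<close> in direction \<open>w\<close>; minimality of
      \<open>c\<close> forces \<open>t\<close> to vanish.\<close>
    define t where "t = inner (x - c) w / inner w w"
    have "c + t *\<^sub>R w \<in> W" using assms(2) c(1) that by (simp add: subspace_add subspace_scale)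
    then have "(dist x c)\<^sup>2 \<le> (dist x (c + t *\<^sub>R w))\<^sup>2" using c(2) by (simp add: power_mono)
    then have "inner (x - c) (x - c) \<le> inner (x - c - t *\<^sub>R w) (x - c - t *\<^sub>R w)"
      by (simp add: dist_norm power2_norm_eq_inner diff_diff_eq)
    also have "\<dots> = inner (x - c) (x - c) - 2 * (t * inner (x - c) w) + t * (t * inner w w)"
      by (simp add: inner_diff_left inner_diff_right inner_commute algebra_simps)
    also have "t * inner w w = inner (x - c) w" using False by (simp add: t_def)
    finally have "t * inner (x - c) w \<le> 0" by linarith
    moreover have "inner w w > 0" using False by simp
    ultimately have "(inner (x - c) w)\<^sup>2 \<le> 0"
      by (simp add: t_def power2_eq_square divide_le_0_iff)
    then show ?thesis by simp
  qed auto
  then have "\<exists>c. c \<in> W \<and> (\<forall>w\<in>W. inner (x - c) w = 0)" using c(1) by blast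
  from someI_ex[OF this] show "hproj W x \<in> W" "w \<in> W \<Longrightarrow> inner (x - hproj W x) w = 0"
    by (auto simp: hproj_def)
qed

lemma hproj_eqI:
  assumes "closed W" "subspace W" "c \<in> W" "\<And>w. w \<in> W \<Longrightarrow> inner (x - c) w = 0"
  shows "hproj W x = c"
proof -
  have d: "hproj W x - c \<in> W" by (intro subspace_diff assms hproj_in)
  have "inner (hproj W x - c) (hproj W x - c) =
      inner (x - c) (hproj W x - c) - inner (x - hproj W x) (hproj W x - c)"
    by (simp add: inner_diff_left)
  also have "\<dots> = 0" using assms(4)[OF d] hproj_orth[OF assms(1,2) d] by simp
  finally show ?thesis by simp
qed

lemma hproj_id: "closed W \<Longrightarrow> subspace W \<Longrightarrow> w \<in> W \<Longrightarrow> hproj W w = w"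
  by (rule hproj_eqI) auto

text \<open>Since the adjoint preserves \<open>W\<close>, \<open>T\<close> preserves the orthogonal
  complement as well and respects the decomposition of \<open>x\<close>. Asking of \<open>T\<close>
  only compatibility with differences lets one lemma cover homogeneity of \<open>hproj\<close>,
  unitaries, commutant elements and diagonal operators on pairs.\<close>

lemma hproj_commute:
  assumes W: "closed W" "subspace W"
    and lin: "\<And>x y. T (x - y) = T x - T y"
    and adj: "\<And>x y. inner (T x) y = inner x (T' y)"
    and inv: "\<And>w. w \<in> W \<Longrightarrow> T w \<in> W" "\<And>w. w \<in> W \<Longrightarrow> T' w \<in> W"
  shows "hproj W (T x) = T (hproj W x)"
proof (rule hproj_eqI[OF W])
  show "T (hproj W x) \<in> W" by (intro inv hproj_in W)
  fix w assume "w \<in> W"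
  then show "inner (T x - T (hproj W x)) w = 0"
    unfolding lin[symmetric] adj by (intro hproj_orth W inv)
qed

lemma hproj_selfadjoint:
  assumes W: "closed W" "subspace W"
  shows "inner (hproj W x) y = inner x (hproj W y)"
proof -
  have "inner (hproj W x) (y - hproj W y) = 0"
    using hproj_orth[OF W hproj_in[OF W, of x], of y] by (simp add: inner_commute)
  moreover have "inner (x - hproj W x) (hproj W y) = 0" by (intro hproj_orth W hproj_in)
  ultimately show ?thesis by (simp add: inner_diff_left inner_diff_right)
qed

lemma bounded_linear_hproj:
  assumes W: "closed W" "subspace W"
  shows "bounded_linear (hproj W)"
proof (rule bounded_linear_intro[where K=1])
  show "hproj W (x + y) = hproj W x + hproj W y" for x y
  proof (rule hproj_eqI[OF W])
    show "hproj W x + hproj W y \<in> W" by (intro subspace_add hproj_in W)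
    fix w assume "w \<in> W"
    then show "inner (x + y - (hproj W x + hproj W y)) w = 0"
      using hproj_orth[OF W, of w x] hproj_orth[OF W, of w y] by (simp add: inner_simps)
  qed
  show "hproj W (r *\<^sub>R x) = r *\<^sub>R hproj W x" for r x
    by (rule hproj_commute[OF W, where T'="\<lambda>x. r *\<^sub>R x"])
      (auto simp: scaleR_right_diff_distrib subspace_scale W)
  show "norm (hproj W x) \<le> norm x * 1" for x
  proof -
    have "(norm (hproj W x))\<^sup>2 = inner x (hproj W x)"
      using hproj_orth[OF W hproj_in[OF W, of x], of x] by (simp add: power2_norm_eq_inner inner_diff_left)
    also have "\<dots> \<le> norm x * norm (hproj W x)" by (rule norm_cauchy_schwarz)
    finally show ?thesis by (cases "norm (hproj W x) = 0") (auto simp: power2_eq_square)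
  qed
qed

lemma riesz_representation:
  fixes f :: "'a::{real_inner,complete_space} \<Rightarrow> real"
  assumes "bounded_linear f"
  obtains z where "\<And>x. f x = inner x z"
proof (cases "\<forall>x. f x = 0")
  case True
  then show ?thesis using that[of 0] by simp
next
  case False
  interpret f: bounded_linear f by fact
  let ?W = "{x. f x = 0}"
  have W: "closed ?W" "subspace ?W"
    by (auto intro!: closed_Collect_eq continuous_intros f.continuous_on simp: subspace_def f.add f.scaleR)
  obtain x0 where x0: "f x0 \<noteq> 0" using False by blast
  define u where "u = x0 - hproj ?W x0"
  have fu: "f u \<noteq> 0" using x0 hproj_in[OF W, of x0] by (simp add: u_def f.diff)
  have "f x = inner x ((f u / inner u u) *\<^sub>R u)" for x
  proof -
    have "x - (f x / f u) *\<^sub>R u \<in> ?W" using fu by (simp add: f.diff f.scaleR)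
    then have "inner u (x - (f x / f u) *\<^sub>R u) = 0" unfolding u_def by (rule hproj_orth[OF W])
    moreover have "u \<noteq> 0" using fu f.zero by auto
    ultimately show ?thesis using fu by (simp add: inner_diff_right inner_commute field_simps)
  qed
  then show ?thesis using that by blast
qed

section \<open>Complex scalars, adjoints and complex subspaces\<close>

lemma scaleC_zero_left [simp]: "scaleC 0 x = (0::'h::chilbert_space)"
  using scaleR_eq_scaleC[of 0 x] by simp

lemma scaleC_one [simp]: "scaleC 1 x = (x::'h::chilbert_space)"
  using scaleR_eq_scaleC[of 1 x] by simp

lemma scaleC_zero_right [simp]: "scaleC c 0 = (0::'h::chilbert_space)"
  using scaleC_add_right[of c 0 "0::'h"] by simp

lemma scaleC_minus_left: "scaleC (- c) x = - scaleC c (x::'h::chilbert_space)"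
  using scaleC_add_left[of c "-c" x] by (simp add: eq_neg_iff_add_eq_0 add.commute)

lemma scaleC_minus_right: "scaleC c (- x) = - scaleC c (x::'h::chilbert_space)"
  using scaleC_add_right[of c x "-x"] by (simp add: eq_neg_iff_add_eq_0 add.commute)

lemma scaleC_diff_right: "scaleC c (x - y) = scaleC c x - scaleC c (y::'h::chilbert_space)"
  using scaleC_add_right[of c x "-y"] by (simp add: scaleC_minus_right)

lemma scaleC_scaleR: "scaleC c (r *\<^sub>R x) = r *\<^sub>R scaleC c (x::'h::chilbert_space)"
  by (simp add: scaleR_eq_scaleC scaleC_scaleC mult.commute)

lemma cinner_scaleC_right: "cinner x (scaleC a y) = cnj a * cinner x (y::'h::chilbert_space)"
  using cinner_commute[of x "scaleC a y"] cinner_commute[of x y] by (simp add: cinner_scaleC_left)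

lemma inner_scaleC: "inner (scaleC c x) y = inner x (scaleC (cnj c) (y::'h::chilbert_space))"
  by (simp add: inner_eq_Re_cinner cinner_scaleC_left cinner_scaleC_right)

lemma cinner_eq_Complex: "cinner x y = Complex (inner x y) (inner x (scaleC \<i> (y::'h::chilbert_space)))"
  by (simp add: inner_eq_Re_cinner cinner_scaleC_right complex_eq_iff)

lemma norm_scaleC: "norm (scaleC c x) = cmod c * norm (x::'h::chilbert_space)"
proof (rule power2_eq_imp_eq)
  have "scaleC (cnj c) (scaleC c x) = (cmod c)\<^sup>2 *\<^sub>R x"
    by (simp add: scaleC_scaleC scaleR_eq_scaleC complex_norm_square mult.commute del: of_real_power)
  then show "(norm (scaleC c x))\<^sup>2 = (cmod c * norm x)\<^sup>2"
    by (simp add: power2_norm_eq_inner inner_scaleC power_mult_distrib)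
qed auto

lemma bounded_linear_scaleC: "bounded_linear (scaleC c :: 'h::chilbert_space \<Rightarrow> 'h)"
  by (rule bounded_linear_intro[where K="cmod c"])
    (auto simp: scaleC_add_right scaleC_scaleR norm_scaleC)

lemma bounded_clinear_bl: "bounded_clinear A \<Longrightarrow> bounded_linear A"
  and bounded_clinear_scaleC: "bounded_clinear A \<Longrightarrow> A (scaleC c x) = scaleC c (A x)"
  by (auto simp: bounded_clinear_def)

text \<open>The imaginary part of \<open>cinner x y\<close> is the real inner product of
  \<open>x\<close> with \<open>scaleC \<i> y\<close>, and a complex-linear \<open>A\<close> lets the
  factor \<i> pass. Thus adjoints can be found by the real Riesz theorem.\<close>

lemma is_adjoint_iff_inner:
  assumes "\<And>c x. A (scaleC c x) = scaleC c (A x)"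
  shows "is_adjoint A B \<longleftrightarrow> (\<forall>x y. inner (A x) y = inner x (B y))"
proof
  assume adj: "\<forall>x y. inner (A x) y = inner x (B y)"
  have "inner (A x) (scaleC \<i> y) = inner x (scaleC \<i> (B y))" for x y
  proof -
    have "inner (A x) (scaleC \<i> y) = inner (A (scaleC (- \<i>) x)) y"
      by (simp add: assms inner_scaleC)
    also have "\<dots> = inner x (scaleC \<i> (B y))" by (simp add: adj inner_scaleC)
    finally show ?thesis .
  qed
  then show "is_adjoint A B" using adj by (simp add: is_adjoint_def cinner_eq_Complex)
qed (auto simp: is_adjoint_def inner_eq_Re_cinner)

lemma is_adjoint_inner: "is_adjoint A B \<Longrightarrow> inner (A x) y = inner x (B y)"
  by (auto simp: is_adjoint_def inner_eq_Re_cinner)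

lemma is_adjoint_sym: "is_adjoint A B \<Longrightarrow> is_adjoint B A"
  unfolding is_adjoint_def using cinner_commute by metis

lemma adjoint_exists:
  fixes A :: "'h::chilbert_space \<Rightarrow> 'h"
  assumes "bounded_clinear A"
  obtains B where "bounded_clinear B" "is_adjoint A B"
proof -
  interpret A: bounded_linear A using assms by (rule bounded_clinear_bl)
  have "\<exists>z. \<forall>x. inner (A x) y = inner x z" for y
  proof -
    have "bounded_linear (\<lambda>x. inner (A x) y)"
      using bounded_linear_compose[OF bounded_linear_inner_left A.bounded_linear_axioms] by simp
    then show ?thesis using riesz_representation by metis
  qed
  then obtain B where B: "\<And>x y. inner (A x) y = inner x (B y)" by metis
  have adj: "is_adjoint A B" 
    using B is_adjoint_iff_inner[OF bounded_clinear_scaleC[OF assms]] by blast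
  have ext: "u = v" if "\<And>x. inner x u = inner x v" for u v :: 'h
    using that vector_eq_ldot[of u v] by simp
  have Bc: "B (scaleC c y) = scaleC c (B y)" for c y
  proof (rule ext)
    fix x
    have "inner x (B (scaleC c y)) = inner (A x) (scaleC (cnj (cnj c)) y)" by (simp add: B)
    also have "\<dots> = inner (scaleC (cnj c) x) (B y)"
      unfolding inner_scaleC[symmetric] by (simp add: B[symmetric] bounded_clinear_scaleC[OF assms])
    also have "\<dots> = inner x (scaleC c (B y))" by (simp add: inner_scaleC)
    finally show "inner x (B (scaleC c y)) = inner x (scaleC c (B y))" .
  qed
  have "bounded_linear B"
  proof -
    obtain K where K: "K \<ge> 0" "\<And>x. norm (A x) \<le> norm x * K" using A.nonneg_bounded by blast
    show ?thesis
    proof (rule bounded_linear_intro[where K=K])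
      show "B (x + y) = B x + B y" for x y by (rule ext) (simp add: B[symmetric] inner_add_right)
      show "B (r *\<^sub>R x) = r *\<^sub>R B x" for r x by (rule ext) (simp add: B[symmetric])
      show "norm (B y) \<le> norm y * K" for y
      proof -
        have "(norm (B y))\<^sup>2 = inner (A (B y)) y" by (simp add: power2_norm_eq_inner B)
        also have "\<dots> \<le> norm (A (B y)) * norm y" by (rule norm_cauchy_schwarz)
        also have "\<dots> \<le> norm (B y) * K * norm y" by (intro mult_right_mono K) auto
        finally show ?thesis by (cases "norm (B y) = 0") (auto simp: power2_eq_square K mult_ac)
      qed
    qed
  qed
  then show ?thesis using that[of B] adj Bc by (auto simp: bounded_clinear_def)
qed

definition csubspace :: "'h::chilbert_space set \<Rightarrow> bool" where
  "csubspace W \<longleftrightarrow> subspace W \<and> (\<forall>c. \<forall>x\<in>W. scaleC c x \<in> W)"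

lemma csubspace_subspace: "csubspace W \<Longrightarrow> subspace W"
  and csubspace_scaleC: "csubspace W \<Longrightarrow> x \<in> W \<Longrightarrow> scaleC c x \<in> W"
  by (auto simp: csubspace_def)

lemma bounded_clinear_hproj:
  assumes W: "closed W" "csubspace W"
  shows "bounded_clinear (hproj W)"
proof -
  have "hproj W (scaleC c x) = scaleC c (hproj W x)" for c x
    by (rule hproj_commute[OF W(1) csubspace_subspace[OF W(2)], where T'="scaleC (cnj c)"])
      (auto simp: scaleC_diff_right inner_scaleC csubspace_scaleC[OF W(2)])
  then show ?thesis
    using bounded_linear_hproj[OF W(1) csubspace_subspace[OF W(2)]] by (simp add: bounded_clinear_def)
qed

lemma orthogonal_projection_hproj:
  assumes W: "closed W" "csubspace W"
  shows "orthogonal_projection (hproj W)"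
proof -
  note sW = W(1) csubspace_subspace[OF W(2)]
  have "is_adjoint (hproj W) (hproj W)"
    using is_adjoint_iff_inner[OF bounded_clinear_scaleC[OF bounded_clinear_hproj[OF W]]]
      hproj_selfadjoint[OF sW] by blast
  moreover have "hproj W \<circ> hproj W = hproj W"
    using hproj_id[OF sW hproj_in[OF sW]] by (simp add: fun_eq_iff)
  ultimately show ?thesis using bounded_clinear_hproj[OF W] by (simp add: orthogonal_projection_def)
qed

section \<open>Commutants\<close>

lemma commutant_bounded: "A \<in> commutant S \<Longrightarrow> bounded_clinear A"
  by (simp add: commutant_def)

lemma commutant_commute: "A \<in> commutant S \<Longrightarrow> B \<in> S \<Longrightarrow> A (B x) = B (A x)"
  by (auto simp: commutant_def fun_eq_iff)

lemma commutantI: "bounded_clinear A \<Longrightarrow> (\<And>B x. B \<in> S \<Longrightarrow> A (B x) = B (A x)) \<Longrightarrow> A \<in> commutant S"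
  by (auto simp: commutant_def fun_eq_iff)

lemma commutant_antimono: "S \<subseteq> T \<Longrightarrow> commutant T \<subseteq> commutant S"
  by (auto simp: commutant_def)

lemma subset_bicommutant: "(\<And>A. A \<in> S \<Longrightarrow> bounded_clinear A) \<Longrightarrow> S \<subseteq> commutant (commutant S)"
  by (auto intro!: commutantI simp: commutant_commute)

lemma bicommutant_commutant:
  assumes "\<And>A. A \<in> S \<Longrightarrow> bounded_clinear A"
  shows "commutant (commutant (commutant S)) = commutant S"
proof
  show "commutant (commutant (commutant S)) \<subseteq> commutant S"
    by (rule commutant_antimono[OF subset_bicommutant]) (rule assms)
  show "commutant S \<subseteq> commutant (commutant (commutant S))"
    by (rule subset_bicommutant) (rule commutant_bounded)
qed

definition adjoint_closed :: "('h::chilbert_space \<Rightarrow> 'h) set \<Rightarrow> bool" where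
  "adjoint_closed S \<longleftrightarrow> (\<forall>A\<in>S. \<exists>B\<in>S. is_adjoint A B)"

lemma adjoint_closed_commutant:
  assumes "adjoint_closed S"
  shows "adjoint_closed (commutant S)"
  unfolding adjoint_closed_def
proof
  fix A assume A: "A \<in> commutant S"
  obtain B where B: "bounded_clinear B" "is_adjoint A B"
    using adjoint_exists[OF commutant_bounded[OF A]] .
  have "B (s y) = s (B y)" if s: "s \<in> S" for s y
  proof -
    obtain t where t: "t \<in> S" "is_adjoint s t" using assms s by (auto simp: adjoint_closed_def)
    have "inner x (B (s y)) = inner x (s (B y))" for x
      using is_adjoint_inner[OF B(2), of x "s y"] is_adjoint_inner[OF B(2), of "t x" y]
        is_adjoint_inner[OF is_adjoint_sym[OF t(2)], of x "B y"]
        is_adjoint_inner[OF is_adjoint_sym[OF t(2)], of "A x" y] commutant_commute[OF A t(1), of x]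
      by simp
    then show ?thesis using vector_eq_ldot[of "B (s y)" "s (B y)"] by simp
  qed
  then show "\<exists>B\<in>commutant S. is_adjoint A B" using B by (auto intro!: commutantI)
qed

lemma von_neumann_algebra_bicommutant:
  assumes "\<And>A. A \<in> S \<Longrightarrow> bounded_clinear A" "adjoint_closed S"
  shows "von_neumann_algebra (commutant (commutant S))"
  using bicommutant_commutant[of "commutant S"] commutant_bounded
    adjoint_closed_commutant[OF adjoint_closed_commutant[OF assms(2)]]
  by (auto simp: von_neumann_algebra_def adjoint_closed_def)

text \<open>With \<open>C\<close> the commutant of a representation, this is how projections in the
  generated von Neumann algebra are produced: it suffices to exhibit a closed subspace invariant
  under the commutant.\<close>

lemma hproj_in_commutant:
  assumes W: "closed W" "csubspace W"
    and C: "adjoint_closed C" "\<And>A. A \<in> C \<Longrightarrow> bounded_clinear A"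
    and inv: "\<And>A w. A \<in> C \<Longrightarrow> w \<in> W \<Longrightarrow> A w \<in> W"
  shows "hproj W \<in> commutant C"
proof (rule commutantI[OF bounded_clinear_hproj[OF W]])
  fix A x assume A: "A \<in> C"
  obtain B where B: "B \<in> C" "is_adjoint A B" using C A by (auto simp: adjoint_closed_def)
  interpret A: bounded_linear A using C(2)[OF A] by (rule bounded_clinear_bl)
  show "hproj W (A x) = A (hproj W x)"
    by (rule hproj_commute[OF W(1) csubspace_subspace[OF W(2)], where T'=B])
      (auto simp: A.diff is_adjoint_inner[OF B(2)] inv A B)
qed

text \<open>
  Von Neumann's density argument for two vectors: the projection onto a closed subspace of
  \<open>H \<times> H\<close> invariant under all \<open>B \<times> B\<close> is a matrix with entries in the commutant.
\<close>

lemma bicommutant_pair: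
  fixes S :: "('h::chilbert_space \<Rightarrow> 'h) set"
  assumes S: "\<And>B. B \<in> S \<Longrightarrow> bounded_clinear B" "id \<in> S" "adjoint_closed S"
      "\<And>B C. B \<in> S \<Longrightarrow> C \<in> S \<Longrightarrow> B \<circ> C \<in> S"
    and A: "A \<in> commutant (commutant S)"
    and W: "closed W" "subspace W" "\<And>c u v. (u, v) \<in> W \<Longrightarrow> (scaleC c u, scaleC c v) \<in> W"
      "\<And>B. B \<in> S \<Longrightarrow> (B x, B y) \<in> W"
  shows "(A x, A y) \<in> W"
proof -
  \<comment> \<open>All complex multiples are included because \<open>span\<close> is the real
    span.\<close>
  define X where "X = {(scaleC c (B x), scaleC c (B y)) | c B. B \<in> S}"
  define U where "U = closure (span X)"
  have U: "closed U" "subspace U" by (auto simp: U_def subspace_span subspace_closure)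
  have "X \<subseteq> W" using W(3,4) by (auto simp: X_def)
  then have UW: "U \<subseteq> W" unfolding U_def using W(1,2) by (intro closure_minimal span_minimal) auto
  have XU: "X \<subseteq> U" unfolding U_def using span_superset closure_subset by blast
  have xyU: "(x, y) \<in> U"
    using XU S(2) by (auto simp: X_def intro!: exI[of _ 1] exI[of _ id] dest!: subsetD[where c="(x, y)"])
  have inv: "map_prod T T w \<in> U" if T: "bounded_linear T" and TX: "map_prod T T ` X \<subseteq> X" and w: "w \<in> U" for T w
  proof -
    have bl: "bounded_linear (map_prod T T)"
    proof -
      have "bounded_linear (\<lambda>z. (T (fst z), T (snd z)))"
        by (intro bounded_linear_Pair bounded_linear_compose[OF T] bounded_linear_fst bounded_linear_snd)
      then show ?thesis by (simp add: map_prod_def case_prod_unfold)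
    qed
    have "map_prod T T ` U \<subseteq> closure (map_prod T T ` span X)"
      unfolding U_def by (rule closure_bounded_linear_image_subset[OF bl])
    also have "map_prod T T ` span X = span (map_prod T T ` X)"
      using linear_span_image[OF bounded_linear.linear[OF bl]] by simp
    also have "closure (span (map_prod T T ` X)) \<subseteq> U"
      unfolding U_def by (intro closure_mono span_mono TX)
    finally show ?thesis using w by blast
  qed
  have invS: "map_prod B B w \<in> U" if "B \<in> S" "w \<in> U" for B w
  proof (rule inv[OF bounded_clinear_bl[OF S(1)[OF that(1)]] _ that(2)])
    show "map_prod B B ` X \<subseteq> X"
    proof
      fix z assume "z \<in> map_prod B B ` X"
      then obtain c C where C: "C \<in> S" "z = (B (scaleC c (C x)), B (scaleC c (C y)))" by (auto simp: X_def)
      then have "z = (scaleC c ((B \<circ> C) x), scaleC c ((B \<circ> C) y))"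
        using bounded_clinear_scaleC[OF S(1)[OF that(1)]] by simp
      then show "z \<in> X" using S(4)[OF that(1) C(1)] unfolding X_def by blast
    qed
  qed
  have invc: "map_prod (scaleC c) (scaleC c) w \<in> U" if "w \<in> U" for c w
    by (rule inv[OF bounded_linear_scaleC _ that]) (force simp: X_def scaleC_scaleC)
  let ?Q = "hproj U"
  have QS: "?Q (map_prod B B w) = map_prod B B (?Q w)" if B: "B \<in> S" for B w
  proof -
    obtain B' where B': "B' \<in> S" "is_adjoint B B'" using S(3) B by (auto simp: adjoint_closed_def)
    interpret B: bounded_linear B using S(1)[OF B] by (rule bounded_clinear_bl)
    show ?thesis
      by (rule hproj_commute[OF U, where T'="map_prod B' B'"])
        (auto simp: B.diff inner_prod_def is_adjoint_inner[OF B'(2)] intro: invS[OF B] invS[OF B'(1)])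
  qed
  have Qc: "?Q (map_prod (scaleC c) (scaleC c) w) = map_prod (scaleC c) (scaleC c) (?Q w)" for c w
    by (rule hproj_commute[OF U, where T'="map_prod (scaleC (cnj c)) (scaleC (cnj c))"])
      (auto simp: scaleC_diff_right inner_prod_def inner_scaleC intro: invc)
  have comm: "p (?Q (q (A h))) = A (p (?Q (q h)))"
    if pq: "bounded_linear q" "bounded_linear p"
      "\<And>T h. T 0 = 0 \<Longrightarrow> q (T h) = map_prod T T (q h)" "\<And>T z. p (map_prod T T z) = T (p z)"
    for p :: "'h \<times> 'h \<Rightarrow> 'h" and q h
  proof -
    have "(\<lambda>h. p (?Q (q h))) \<in> commutant S"
    proof (rule commutantI)
      have "bounded_linear (\<lambda>h. p (?Q (q h)))"
        by (intro bounded_linear_compose[OF pq(2)] bounded_linear_compose[OF bounded_linear_hproj[OF U]] pq(1))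
      moreover have "p (?Q (q (scaleC c h))) = scaleC c (p (?Q (q h)))" for c h
        by (simp add: pq Qc)
      ultimately show "bounded_clinear (\<lambda>h. p (?Q (q h)))" by (simp add: bounded_clinear_def)
      fix B h assume B: "B \<in> S"
      interpret B: bounded_linear B using S(1)[OF B] by (rule bounded_clinear_bl)
      show "p (?Q (q (B h))) = B (p (?Q (q h)))" by (simp add: pq(3)[of B h, OF B.zero] QS[OF B] pq(4))
    qed
    from commutant_commute[OF A this, of h] show ?thesis by simp
  qed
  have q: "bounded_linear (\<lambda>h::'h. (h, 0::'h))" "bounded_linear (\<lambda>h::'h. (0::'h, h))"
    by (auto intro!: bounded_linear_Pair bounded_linear_ident bounded_linear_zero)
  have split: "(u, v) = (u, 0) + (0, v)" for u v :: 'h by simp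
  interpret A: bounded_linear A using commutant_bounded[OF A] by (rule bounded_clinear_bl)
  interpret Q: bounded_linear ?Q by (rule bounded_linear_hproj[OF U])
  have "?Q (A x, A y) = ?Q (A x, 0) + ?Q (0, A y)"
    by (subst split) (rule Q.add)
  also have "\<dots> = map_prod A A (?Q (x, 0)) + map_prod A A (?Q (0, y))"
    using comm[OF q(1) bounded_linear_fst, of x] comm[OF q(1) bounded_linear_snd, of x]
      comm[OF q(2) bounded_linear_fst, of y] comm[OF q(2) bounded_linear_snd, of y]
    by (intro arg_cong2[where f=plus] prod_eqI) auto
  also have "\<dots> = map_prod A A (?Q (x, 0) + ?Q (0, y))"
    by (rule prod_eqI) (auto simp: A.add)
  also have "?Q (x, 0) + ?Q (0, y) = ?Q (x, y)"
    by (subst (3) split) (rule Q.add[symmetric])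
  also have "?Q (x, y) = (x, y)" by (rule hproj_id[OF U xyU])
  finally have "(A x, A y) = ?Q (A x, A y)" by simp
  also have "\<dots> \<in> U" by (rule hproj_in[OF U])
  finally show ?thesis using UW by blast
qed

section \<open>Distances in trees\<close>

text \<open>Walks without backtracking, which in a tree are the geodesics. Only the values at
  \<open>0..n\<close> matter: a walk is shortened by lowering \<open>n\<close> and extended by a
  function update.\<close>

definition reduced_walk :: "('v \<Rightarrow> 'v \<Rightarrow> bool) \<Rightarrow> nat \<Rightarrow> (nat \<Rightarrow> 'v) \<Rightarrow> bool" where
  "reduced_walk E n w \<longleftrightarrow>
     (\<forall>i<n. E (w i) (w (Suc i))) \<and> (\<forall>i. Suc (Suc i) \<le> n \<longrightarrow> w i \<noteq> w (Suc (Suc i)))"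

locale tree_graph =
  fixes E :: "'v \<Rightarrow> 'v \<Rightarrow> bool"
  assumes tree: "tree E"
begin

abbreviation D :: "'v \<Rightarrow> 'v \<Rightarrow> nat" where "D \<equiv> graph_dist E"

lemma E_sym: "E x y \<Longrightarrow> E y x"
  using tree by (auto simp: tree_def symp_def)

lemma E_irrefl: "\<not> E x x"
  using tree by (auto simp: tree_def irreflp_def)

lemma connected: "E\<^sup>*\<^sup>* x y"
  using tree by (auto simp: tree_def)

lemma no_cycle: "length xs \<ge> 3 \<Longrightarrow> distinct xs \<Longrightarrow> successively E xs \<Longrightarrow> \<not> E (last xs) (hd xs)"
  using tree by (auto simp: tree_def)

text \<open>A repetition with smallest gap \<open>k\<close> closes a cycle. Irreflexivity excludes
  \<open>k = 1\<close> and the absence of backtracking excludes \<open>k = 2\<close>, so the cycle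
  has the length of at least three that \<open>no_cycle\<close> requires.\<close>

lemma reduced_walk_inj_on:
  assumes "reduced_walk E n w"
  shows "inj_on w {..n}"
proof (rule ccontr)
  assume "\<not> inj_on w {..n}"
  then obtain i0 j0 where ij0: "i0 \<le> n" "j0 \<le> n" "i0 \<noteq> j0" "w i0 = w j0"
    by (auto simp: inj_on_def)
  define P where "P k \<longleftrightarrow> k > 0 \<and> (\<exists>i. i + k \<le> n \<and> w i = w (i + k))" for k
  have "P (max i0 j0 - min i0 j0)"
    unfolding P_def using ij0 by (auto intro!: exI[of _ "min i0 j0"] simp: max_def min_def)
  then obtain k where k: "P k" and kmin: "\<And>l. l < k \<Longrightarrow> \<not> P l"
    using exists_least_iff[of P] by blast
  then obtain i where i: "k > 0" "i + k \<le> n" "w i = w (i + k)" by (auto simp: P_def)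
  have step: "\<And>l. l < n \<Longrightarrow> E (w l) (w (Suc l))" and nb: "\<And>l. Suc (Suc l) \<le> n \<Longrightarrow> w l \<noteq> w (Suc (Suc l))"
    using assms by (auto simp: reduced_walk_def)
  have "k \<noteq> 1" using step[of i] i E_irrefl by auto
  moreover have "k \<noteq> 2" using nb[of i] i by (auto simp: numeral_2_eq_2)
  ultimately have k3: "k \<ge> 3" using i by linarith
  define xs where "xs = map w [i..<i+k]"
  have "distinct xs"
  proof -
    have "inj_on w {i..<i+k}"
    proof (rule inj_onI, rule ccontr)
      fix a b assume ab: "a \<in> {i..<i+k}" "b \<in> {i..<i+k}" "w a = w b" "a \<noteq> b"
      have "P (max a b - min a b)"
        unfolding P_def using ab i by (auto intro!: exI[of _ "min a b"] simp: max_def min_def)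
      moreover have "max a b - min a b < k" using ab by (auto simp: max_def min_def)
      ultimately show False using kmin by blast
    qed
    then show ?thesis by (simp add: xs_def distinct_map)
  qed
  moreover have "successively E xs"
    unfolding xs_def successively_conv_nth using step i by auto
  moreover have "E (last xs) (hd xs)"
  proof -
    have "last xs = w (i + k - 1)" "hd xs = w i"
      using k3 by (auto simp: xs_def last_map hd_map)
    moreover have "E (w (i + k - 1)) (w (Suc (i + k - 1)))" using step[of "i + k - 1"] i by auto
    ultimately show ?thesis using i by auto
  qed
  ultimately show False using no_cycle[of xs] k3 by (auto simp: xs_def)
qed

lemma reduced_walk_unique:
  "reduced_walk E n w \<Longrightarrow> reduced_walk E m w' \<Longrightarrow> w 0 = w' 0 \<Longrightarrow> w n = w' m \<Longrightarrow>
    n = m \<and> (\<forall>i\<le>n. w i = w' i)"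
proof (induction n arbitrary: m)
  case 0
  then have "m = 0" using inj_onD[OF reduced_walk_inj_on[of m w'], of m 0] by auto
  with 0 show ?case by auto
next
  case (Suc k)
  have "m \<noteq> 0"
    using inj_onD[OF reduced_walk_inj_on[OF Suc.prems(1)], of "Suc k" 0] Suc.prems by (auto intro!: gr0I)
  then obtain l where l: "m = Suc l" using not0_implies_Suc by blast
  have w: "\<And>i. i \<le> k \<Longrightarrow> E (w i) (w (Suc i))" "\<And>i. Suc i \<le> k \<Longrightarrow> w i \<noteq> w (Suc (Suc i))"
    and w': "\<And>i. i \<le> l \<Longrightarrow> E (w' i) (w' (Suc i))" "\<And>i. Suc i \<le> l \<Longrightarrow> w' i \<noteq> w' (Suc (Suc i))"
    using Suc.prems by (auto simp: reduced_walk_def l)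
  show ?case
  proof (cases "w k = w' l")
    case True
    have "reduced_walk E k w" "reduced_walk E l w'"
      using Suc.prems by (auto simp: reduced_walk_def l)
    with Suc.IH[of l] True Suc.prems have "k = l \<and> (\<forall>i\<le>k. w i = w' i)" by auto
    then show ?thesis using l Suc.prems by (auto simp: le_Suc_eq)
  next
    case False
    \<comment> \<open>If the last steps differ, \<open>w\<close> followed by the reverse of
      \<open>w'\<close> does not backtrack at the turning point either; it would be a closed reduced
      walk, contradicting injectivity.\<close>
    define c where "c i = (if i \<le> Suc k then w i else w' (Suc k + m - i))" for i
    have c1: "c i = w' (Suc k + m - i)" if "i \<ge> Suc k" for i
      using that Suc.prems by (auto simp: c_def)
    have "reduced_walk E (Suc k + m) c"
      unfolding reduced_walk_def
    proof (intro conjI allI impI)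
      fix i assume i: "i < Suc k + m"
      show "E (c i) (c (Suc i))"
      proof (cases "i \<ge> Suc k")
        case True
        have "E (w' (Suc k + m - Suc i)) (w' (Suc (Suc k + m - Suc i)))"
          using w'(1)[of "Suc k + m - Suc i"] True i l by auto
        moreover have "Suc (Suc k + m - Suc i) = Suc k + m - i" using i by auto
        moreover have "c i = w' (Suc k + m - i)" "c (Suc i) = w' (Suc k + m - Suc i)"
          using c1[of i] c1[of "Suc i"] True by auto
        ultimately show ?thesis by (metis E_sym)
      next
        case False then show ?thesis using w(1)[of i] by (auto simp: c_def)
      qed
    next
      fix i assume i: "Suc (Suc i) \<le> Suc k + m"
      consider "i \<ge> Suc k" | "i = k" | "i < k" by linarith
      then show "c i \<noteq> c (Suc (Suc i))"
      proof cases
        case 1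
        define a where "a = Suc k + m - Suc (Suc i)"
        have "Suc k + m - i = Suc (Suc a)" using i by (simp add: a_def)
        then have "c i = w' (Suc (Suc a))" "c (Suc (Suc i)) = w' a"
          using c1[of i] c1[of "Suc (Suc i)"] 1 a_def by simp_all
        moreover have "Suc a \<le> l" using 1 i l by (simp add: a_def)
        ultimately show ?thesis using w'(2)[of a] by simp
      next
        case 2
        then show ?thesis using False c1[of "Suc (Suc i)"] l by (auto simp: c_def)
      next
        case 3
        then show ?thesis using w(2)[of i] by (auto simp: c_def)
      qed
    qed
    from inj_onD[OF reduced_walk_inj_on[OF this], of 0 "Suc k + m"] 
    have False using Suc.prems c1[of "Suc k + m"] by (auto simp: c_def)
    then show ?thesis ..
  qed
qed

section \<open>The distance function of a tree and the half-trees of an edge\<close>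

lemma relpowp_D: "(E ^^ D x y) x y"
  unfolding graph_dist_def using rtranclp_imp_relpowp[OF connected[of x y]] by (rule LeastI_ex)

lemma D_le: "(E ^^ n) x y \<Longrightarrow> D x y \<le> n"
  unfolding graph_dist_def by (rule Least_le)

lemma geodesic_walk:
  obtains w where "reduced_walk E (D x y) w" "w 0 = x" "w (D x y) = y"
proof -
  obtain w where w: "w 0 = x" "w (D x y) = y" "\<And>i. i < D x y \<Longrightarrow> E (w i) (w (Suc i))"
    using relpowp_D[of x y] unfolding relpowp_fun_conv by auto
  have "w i \<noteq> w (Suc (Suc i))" if "Suc (Suc i) \<le> D x y" for i
  proof
    assume eq: "w i = w (Suc (Suc i))"
    have "(E ^^ i) x (w i)"
      unfolding relpowp_fun_conv using w that by (intro exI[of _ w]) auto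
    moreover have "(E ^^ (D x y - Suc (Suc i))) (w (Suc (Suc i))) y"
      unfolding relpowp_fun_conv using w that
      by (intro exI[of _ "\<lambda>j. w (j + Suc (Suc i))"])
        (simp add: le_add_diff_inverse2 del: diff_Suc_Suc add_Suc_right)
    ultimately have "(E ^^ (i + (D x y - Suc (Suc i)))) x y"
      unfolding relpowp_add eq by (rule relcomppI)
    then show False using D_le[of _ x y] that by fastforce
  qed
  then show ?thesis using that[of w] w by (auto simp: reduced_walk_def)
qed

lemma D_reduced_walk: "reduced_walk E n w \<Longrightarrow> D (w 0) (w n) = n"
proof -
  assume red: "reduced_walk E n w"
  obtain w' where w': "reduced_walk E (D (w 0) (w n)) w'" "w' 0 = w 0" "w' (D (w 0) (w n)) = w n"
    by (rule geodesic_walk)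
  from reduced_walk_unique[OF red w'(1) w'(2)[symmetric] w'(3)[symmetric]] show ?thesis by (rule sym[OF conjunct1])
qed

lemma D_refl [simp]: "D x x = 0"
proof -
  have "(E ^^ 0) x x" by simp
  from D_le[OF this] show ?thesis by simp
qed

lemma D_eq_0 [simp]: "D x y = 0 \<longleftrightarrow> x = y"
proof
  assume "D x y = 0"
  with relpowp_D[of x y] show "x = y" by simp
qed simp

lemma D_triangle: "D x z \<le> D x y + D y z"
proof (rule D_le)
  show "(E ^^ (D x y + D y z)) x z"
    unfolding relpowp_add using relpowp_D[of x y] relpowp_D[of y z] by (rule relcomppI)
qed

lemma D_commute: "D x y = D y x"
proof -
  have "D y x \<le> D x y" for x y
  proof -
    have "(E ^^ n) x y \<Longrightarrow> (E ^^ n) y x" for n x y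
    proof (induction n arbitrary: y)
      case (Suc n)
      then obtain z where "(E ^^ n) z x" "E z y" by auto
      then have "(E ^^ n) z x" "E y z" using E_sym by blast+
      then show ?case by (rule relpowp_Suc_I2[rotated])
    qed auto
    then show ?thesis using relpowp_D D_le by blast
  qed
  then show ?thesis by (simp add: antisym)
qed

lemma D_edge: "E x y \<Longrightarrow> D x y = 1"
proof -
  assume "E x y"
  then have "D x y \<le> 1" "x \<noteq> y" using D_le[of 1 x y] E_irrefl by (auto simp: relpowp_1)
  then show ?thesis using D_eq_0[of x y] by linarith
qed

text \<open>The geodesic from \<open>z\<close> to \<open>u\<close> either has \<open>v\<close> as
  its last vertex but one or extends to \<open>v\<close> without backtracking.\<close>

lemma D_adjacent:
  assumes "E u v"
  shows "D z u = Suc (D z v) \<or> D z v = Suc (D z u)"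
proof -
  obtain w where w: "reduced_walk E (D z u) w" "w 0 = z" "w (D z u) = u" by (rule geodesic_walk)
  define w' where "w' = w(Suc (D z u) := v)"
  show ?thesis
  proof (cases "D z u")
    case 0
    then show ?thesis using D_edge[OF assms] by auto
  next
    case (Suc k)
    show ?thesis
    proof (cases "w k = v")
      case True
      have "reduced_walk E k w" using w Suc by (auto simp: reduced_walk_def)
      then show ?thesis using D_reduced_walk[of k w] w Suc True by auto
    next
      case False
      have "reduced_walk E (Suc (D z u)) w'"
        using w Suc False assms by (auto simp: reduced_walk_def w'_def less_Suc_eq)
      from D_reduced_walk[OF this] have "D z v = Suc (D z u)" using w Suc by (simp add: w'_def)
      then show ?thesis ..
    qed
  qed
qed

lemma closer_neighbour_exists:
  assumes "z \<noteq> v"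
  obtains u where "E v u" "D z v = Suc (D z u)"
proof -
  obtain k where k: "D z v = Suc k" using assms not0_implies_Suc by fastforce
  obtain w where w: "reduced_walk E (D z v) w" "w 0 = z" "w (D z v) = v" by (rule geodesic_walk)
  have "reduced_walk E k w" using w k by (auto simp: reduced_walk_def)
  then have "D z (w k) = k" using D_reduced_walk w by auto
  moreover have "E (w k) v" using w k by (auto simp: reduced_walk_def)
  then have "E v (w k)" by (rule E_sym)
  ultimately show ?thesis using that[of "w k"] k by auto
qed

text \<open>Extending the geodesics from \<open>z\<close> to \<open>u\<close> and \<open>u'\<close>
  by \<open>v\<close> gives two reduced walks from \<open>z\<close> to \<open>v\<close>; uniqueness
  makes them agree one step before the end.\<close>

lemma closer_neighbour_unique:
  assumes "E v u" "E v u'" "D z u < D z v" "D z u' < D z v"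
  shows "u = u'"
proof -
  obtain w where w: "reduced_walk E (D z u) w" "w 0 = z" "w (D z u) = u" by (rule geodesic_walk)
  obtain w' where w': "reduced_walk E (D z u') w'" "w' 0 = z" "w' (D z u') = u'" by (rule geodesic_walk)
  have eq: "D z v = Suc (D z u)" "D z v = Suc (D z u')"
    using D_adjacent[of v u z] D_adjacent[of v u' z] assms by auto
  have far: "w i \<noteq> v" if "i \<le> D z u" "reduced_walk E (D z u) w" "w 0 = z" "D z v = Suc (D z u)"
    for i w u
  proof -
    have "reduced_walk E i w" using that by (auto simp: reduced_walk_def)
    then show ?thesis using D_reduced_walk[of i w] that by auto
  qed
  have "reduced_walk E (D z v) (w(D z v := v))"
    using w eq assms far[of _ u w] E_sym[OF assms(1)] by (auto simp: reduced_walk_def less_Suc_eq)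
  moreover have "reduced_walk E (D z v) (w'(D z v := v))"
    using w' eq assms far[of _ u' w'] E_sym[OF assms(2)] by (auto simp: reduced_walk_def less_Suc_eq)
  ultimately have "\<forall>i\<le>D z v. (w(D z v := v)) i = (w'(D z v := v)) i"
    using reduced_walk_unique[of "D z v" "w(D z v := v)" "D z v" "w'(D z v := v)"] w w' eq by auto
  then show ?thesis using w w' eq by (auto dest!: spec[of _ "D z u"])
qed

text \<open>An edge of a tree is a bridge, so every geodesic from the side of \<open>a\<close> to
  the side of \<open>b\<close> runs through it. Describing the sides by comparing distances reduces
  later separation arguments to arithmetic.\<close>

lemma D_across_edge:
  "E a b \<Longrightarrow> D z a < D z b \<Longrightarrow> D w b < D w a \<Longrightarrow> D z w = Suc (D z a + D b w)"
proof (induction "D b w" arbitrary: w rule: less_induct)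
  case less
  have zb: "D z b = Suc (D z a)" using D_adjacent[OF less.prems(1), of z] less.prems by auto
  have side: "D w' b < D w' a" if "E v w'" "D b v = Suc (D b w')" "D v b < D v a" for v w'
    using D_adjacent[OF that(1), of a] D_adjacent[OF less.prems(1), of v] 
      D_adjacent[OF less.prems(1), of w'] that(2,3) D_commute[of a v] D_commute[of a w']
      D_commute[of b v] D_commute[of b w'] by linarith
  show ?case
  proof (cases "w = b")
    case True then show ?thesis using zb by auto
  next
    case False
    then obtain w' where w': "E w w'" "D b w = Suc (D b w')" using closer_neighbour_exists[of b w] by auto
    have s': "D w' b < D w' a" by (rule side[OF w' less.prems(3)])
    have IH: "D z w' = Suc (D z a + D b w')"
      by (rule less.hyps[OF _ less.prems(1,2) s']) (simp add: w')
    \<comment> \<open>Otherwise \<open>w\<close> and the vertex following \<open>w'\<close> on the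
      way to \<open>b\<close> (or \<open>a\<close>, if \<open>w' = b\<close>) would both be the
      unique neighbour of \<open>w'\<close> closer to \<open>z\<close>, though they lie on different
      sides of \<open>w'\<close>.\<close>
    have "\<not> D z w < D z w'"
    proof
      assume lt: "D z w < D z w'"
      show False
      proof (cases "w' = b")
        case True
        then have "w = a"
          using closer_neighbour_unique[of b w a z] E_sym[OF w'(1)] E_sym[OF less.prems(1)] less.prems(2) lt
          by simp
        then show False using less.prems(3) by simp
      next
        case False
        then obtain w'' where w'': "E w' w''" "D b w' = Suc (D b w'')" using closer_neighbour_exists[of b w'] by auto
        then have "D z w'' = Suc (D z a + D b w'')"
          using less.hyps[OF _ less.prems(1,2) side[OF w'' s']] w'(2) w''(2) by simp
        then have "w = w''"
          using closer_neighbour_unique[OF E_sym[OF w'(1)] w''(1) lt] IH w''(2) by simp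
        with w'(2) w''(2) show False by simp
      qed
    qed
    then show ?thesis using D_adjacent[OF w'(1), of z] IH w'(2) by linarith
  qed
qed

lemma D_edge_neq: "E a b \<Longrightarrow> D z a \<noteq> D z b"
  using D_adjacent[of a b z] by auto

text \<open>By \<open>D_across_edge\<close> an edge that changes sides can only be
  \<open>{x, y}\<close> itself, so paths avoiding it stay on one side; conversely, stepping towards
  \<open>x\<close> never leaves the side of \<open>x\<close>.\<close>

lemma half_tree_eq:
  assumes "E x y"
  shows "half_tree E x y = {z. D z x < D z y}"
proof -
  let ?R = "\<lambda>a b. E a b \<and> {a, b} \<noteq> {x, y}"
  have "D z x < D z y" if "?R\<^sup>*\<^sup>* x z" for z
    using that
  proof (induction)
    case base
    then show ?case using assms E_irrefl by (auto simp: zero_less_iff_neq_zero)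
  next
    case (step c c')
    show ?case
    proof (rule ccontr)
      assume "\<not> ?thesis"
      then have "D c' y < D c' x" using D_edge_neq[OF assms, of c'] by auto
      then have "D c c' = Suc (D c x + D y c')" by (rule D_across_edge[OF assms step.IH])
      moreover have "D c c' = 1" using D_edge[of c c'] step.hyps(2) by blast
      ultimately have "D c x = 0" "D y c' = 0" by linarith+
      then show False using step.hyps(2) by simp
    qed
  qed
  moreover have "?R\<^sup>*\<^sup>* x z" if "D z x < D z y" for z
    using that
  proof (induction "D x z" arbitrary: z)
    case 0
    then show ?case by auto
  next
    case (Suc k)
    then have "x \<noteq> z" by auto
    then obtain z' where z': "E z z'" "D x z = Suc (D x z')" by (rule closer_neighbour_exists)
    have lt: "D z' x < D z' y" 
      using D_adjacent[OF z'(1), of y] D_adjacent[OF assms, of z] D_adjacent[OF assms, of z'] z'(2) Suc.prems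
        D_commute[of x z] D_commute[of x z'] D_commute[of y z] D_commute[of y z'] by linarith
    have "?R\<^sup>*\<^sup>* x z'" using Suc.hyps(1)[OF _ lt] Suc.hyps(2) z'(2) by simp
    moreover have "?R z' z" using lt Suc.prems E_sym[OF z'(1)] by (auto simp: doubleton_eq_iff)
    ultimately show ?case by (rule rtranclp.rtrancl_into_rtrancl)
  qed
  ultimately show ?thesis unfolding half_tree_def by blast
qed

lemma geodesic_point_exists:
  assumes "i \<le> D x z"
  obtains w where "D x w = i" "D w z = D x z - i"
proof -
  have "\<exists>w. D x w = i \<and> D x w + D w z = D x z" if "D x z = i + j" for i j z
    using that
  proof (induction j arbitrary: z)
    case 0
    then show ?case by auto
  next
    case (Suc j)
    then have "x \<noteq> z" by auto
    obtain u where u: "E z u" "D x z = Suc (D x u)" using \<open>x \<noteq> z\<close> by (rule closer_neighbour_exists)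
    then obtain w where w: "D x w = i" "D x w + D w u = D x u" using Suc.IH[of u] Suc.prems by force
    have "D w z \<le> Suc (D w u)" using D_adjacent[OF u(1), of w] by linarith
    then have "D x w + D w z = D x z" using w(2) u(2) D_triangle[of x z w] by linarith
    then show ?case using w(1) by blast
  qed
  from this[of z i "D x z - i"] assms obtain w where "D x w = i" "D x w + D w z = D x z" by auto
  then show ?thesis using that[of w] by simp
qed

text \<open>Walking back from \<open>z\<close>, both vertices lie behind the unique neighbour of
  \<open>z\<close> closer to \<open>x\<close>. This is the tool for showing that an automorphism
  fixes vertices in the middle of a geodesic.\<close>

lemma geodesic_point_unique:
  "D x w = D x w' \<Longrightarrow> D x z = D x w + D w z \<Longrightarrow> D x z = D x w' + D w' z \<Longrightarrow> w = w'"
proof (induction "D w z" arbitrary: z)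
  case 0
  then have "D w z = 0" "D w' z = 0" by linarith+
  then show ?case by simp
next
  case (Suc j)
  have "D w z > 0" using Suc.hyps(2) by linarith
  moreover have "D w' z > 0" using Suc.hyps(2) Suc.prems by linarith
  moreover have "D x z > 0" using Suc.hyps(2) Suc.prems by linarith
  ultimately have ne: "w \<noteq> z" "w' \<noteq> z" and "x \<noteq> z" by auto
  obtain u where u: "E z u" "D x z = Suc (D x u)" using \<open>x \<noteq> z\<close> by (rule closer_neighbour_exists)
  have "D v u = D v z - 1" if "v \<noteq> z" and eq: "D x z = D x v + D v z" for v
  proof -
    obtain t where t: "E z t" "D v z = Suc (D v t)" using \<open>v \<noteq> z\<close> by (rule closer_neighbour_exists)
    have "D x t < D x z" using D_triangle[of x t v] t(2) eq by linarith
    then have "t = u" using closer_neighbour_unique[OF t(1) u(1), of x] u(2) by simp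
    then show ?thesis using t(2) by simp
  qed
  from this[OF ne(1) Suc.prems(2)] this[OF ne(2) Suc.prems(3)]
  have "D w u = D w z - 1" "D w' u = D w' z - 1" .
  moreover have "D w z > 0" "D w' z > 0" using ne by (simp_all add: zero_less_iff_neq_zero)
  ultimately have "D w u = j" "D x u = D x w + D w u" "D x u = D x w' + D w' u"
    using Suc.hyps(2) Suc.prems(2,3) u(2) by linarith+
  then show ?case using Suc.hyps(1)[of u] Suc.prems(1) by simp
qed

lemma automorphism_D:
  assumes "g \<in> carrier (Aut E)"
  shows "D (g x) (g y) = D x y"
proof -
  have g: "bij g" "\<And>x y. E (g x) (g y) \<longleftrightarrow> E x y" using assms by (auto simp: Aut_def)
  have "(E ^^ n) x y \<Longrightarrow> (E ^^ n) (g x) (g y)" for n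
  proof (induction n arbitrary: y)
    case (Suc n)
    then obtain z where "(E ^^ n) x z" "E z y" by auto
    with Suc.IH g(2) have "(E ^^ n) (g x) (g z)" "E (g z) (g y)" by auto
    then show ?case by (rule relpowp_Suc_I)
  qed auto
  moreover have "(E ^^ n) (g x) (g y) \<Longrightarrow> (E ^^ n) x y" for n
  proof (induction n arbitrary: y)
    case 0 then show ?case using g(1) by (auto simp: bij_def inj_def)
  next
    case (Suc n)
    then obtain z where z: "(E ^^ n) (g x) z" "E z (g y)" by auto
    obtain z' where "z = g z'" using surjD[OF bij_is_surj[OF g(1)]] by blast
    then show ?case using z Suc.IH g by auto
  qed
  ultimately have "(E ^^ n) (g x) (g y) \<longleftrightarrow> (E ^^ n) x y" for n by blast
  then show ?thesis by (simp add: graph_dist_def)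
qed

end

section \<open>Boundary-transitive groups\<close>

lemma group_Aut: "group (Aut E)"
proof (rule groupI)
  fix g assume g: "g \<in> carrier (Aut E)"
  have b: "bij g" using g by (simp add: Aut_def)
  have "E (inv_into UNIV g x) (inv_into UNIV g y) \<longleftrightarrow> E x y" for x y
    using g bij_inv_eq_iff[OF b] surj_f_inv_f[OF bij_is_surj[OF b]]
    by (auto simp: Aut_def) (metis)+
  then have "inv_into UNIV g \<in> carrier (Aut E)"
    using bij_imp_bij_inv[OF b] by (simp add: Aut_def)
  moreover have "inv_into UNIV g \<circ> g = id" using b by (simp add: bij_is_inj)
  ultimately show "\<exists>h\<in>carrier (Aut E). h \<otimes>\<^bsub>Aut E\<^esub> g = \<one>\<^bsub>Aut E\<^esub>"
    by (auto simp: Aut_def)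
qed (auto simp: Aut_def bij_comp o_assoc)

locale tree_group =
  fixes d :: nat and E :: "'v \<Rightarrow> 'v \<Rightarrow> bool" and G :: "('v \<Rightarrow> 'v) set"
  assumes d3: "d \<ge> 3"
    and reg: "regular_tree d E"
    and sub: "subgroup G (Aut E)"
    and vt: "vertex_transitive G"
    and bt: "boundary_transitive E G"
    and tits: "tits_independence E G"
begin

sublocale tree_graph E
  using reg by unfold_locales (simp add: regular_tree_def)

lemma finite_neighbours: "finite {y. E x y}" and card_neighbours: "card {y. E x y} = d"
  using reg by (auto simp: regular_tree_def)

text \<open>Here \<open>d \<ge> 3\<close> enters geometrically: two directions can be forbidden at
  once.\<close>

lemma neighbour_avoiding: obtains c where "E b c" "c \<noteq> u" "c \<noteq> v"
proof -
  have "\<not> {y. E b y} \<subseteq> {u, v}"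
  proof
    assume "{y. E b y} \<subseteq> {u, v}"
    then have "card {y. E b y} \<le> card {u, v}" by (intro card_mono) auto
    also have "\<dots> \<le> 2" by (simp add: card_insert_if)
    finally show False using d3 card_neighbours by simp
  qed
  then show ?thesis using that by blast
qed

lemma finite_ball: "finite {z. D x z \<le> n}"
proof (induction n)
  case 0
  then show ?case by simp
next
  case (Suc n)
  have "{z. D x z \<le> Suc n} \<subseteq> {z. D x z \<le> n} \<union> (\<Union>y\<in>{z. D x z \<le> n}. {z. E y z})"
  proof
    fix z assume z: "z \<in> {z. D x z \<le> Suc n}"
    show "z \<in> {z. D x z \<le> n} \<union> (\<Union>y\<in>{z. D x z \<le> n}. {z. E y z})"
    proof (cases "x = z")
      case False
      then obtain u where "E z u" "D x z = Suc (D x u)" by (rule closer_neighbour_exists)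
      then have "D x u \<le> n" "E u z" using z E_sym by auto
      then show ?thesis by blast
    qed simp
  qed
  then show ?case by (rule finite_subset) (auto simp: Suc finite_neighbours)
qed

lemma countable_vertices: "countable (UNIV :: 'v set)"
proof -
  fix x :: 'v
  have "(UNIV :: 'v set) = (\<Union>n. {z. D x z \<le> n})" by auto
  also have "countable \<dots>" by (rule countable_UN) (auto intro: countable_finite finite_ball)
  finally show ?thesis .
qed

lemma neighbours_D: "E y a \<Longrightarrow> E y b \<Longrightarrow> a \<noteq> b \<Longrightarrow> D a b = 2"
  using D_adjacent[of y b a] D_edge[of y a] D_eq_0[of a b] D_commute[of a y] by linarith

lemma G_Aut: "g \<in> G \<Longrightarrow> g \<in> carrier (Aut E)"
  using subgroup.subset[OF sub] by blast

lemma G_bij: "g \<in> G \<Longrightarrow> bij g" and G_E: "g \<in> G \<Longrightarrow> E (g x) (g y) \<longleftrightarrow> E x y"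
  using G_Aut by (auto simp: Aut_def)

lemma G_D: "g \<in> G \<Longrightarrow> D (g x) (g y) = D x y"
  by (rule automorphism_D[OF G_Aut])

lemma G_id: "id \<in> G" and G_comp: "g \<in> G \<Longrightarrow> h \<in> G \<Longrightarrow> g \<circ> h \<in> G"
  using subgroup.one_closed[OF sub] subgroup.m_closed[OF sub] by (auto simp: Aut_def)

lemma G_inv:
  assumes "g \<in> G"
  obtains h where "h \<in> G" "g \<circ> h = id" "h \<circ> g = id"
proof -
  let ?h = "inv\<^bsub>Aut E\<^esub> g"
  have "?h \<in> G" by (rule subgroup.m_inv_closed[OF sub assms])
  moreover have "g \<circ> ?h = id" "?h \<circ> g = id"
    using group.r_inv[OF group_Aut G_Aut[OF assms]] group.l_inv[OF group_Aut G_Aut[OF assms]]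
    by (auto simp: Aut_def)
  ultimately show ?thesis by (rule that)
qed

lemma G_inv_apply:
  assumes "g \<in> G"
  shows "\<exists>h\<in>G. (\<forall>x. g (h x) = x) \<and> (\<forall>x. h (g x) = x)"
proof -
  obtain h where "h \<in> G" "g \<circ> h = id" "h \<circ> g = id" using G_inv[OF assms] .
  then show ?thesis by (auto simp: fun_eq_iff)
qed

lemma G_vt: obtains g where "g \<in> G" "g x = y"
  using vt by (auto simp: vertex_transitive_def)

section \<open>From transitivity on ends to transitivity on spheres\<close>

lemma ray_D: "r \<in> geodesic_rays E \<Longrightarrow> m \<le> n \<Longrightarrow> D (r m) (r n) = n - m"
  by (simp add: geodesic_rays_def)

lemma G_bt:
  assumes "r \<in> geodesic_rays E" "s \<in> geodesic_rays E"
  obtains g m n where "g \<in> G" "\<And>k. g (r (m + k)) = s (n + k)"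
proof -
  let ?c = "cofinal_rays E"
  have "?c `` {r} \<in> boundary E" "?c `` {s} \<in> boundary E"
    using assms by (auto simp: boundary_def intro!: quotientI)
  then obtain g where g: "g \<in> G" "boundary_action g (?c `` {r}) = ?c `` {s}"
    using bt unfolding boundary_transitive_def by blast
  have "r \<in> ?c `` {r}" using assms by (auto simp: cofinal_rays_def)
  then have "g \<circ> r \<in> ?c `` {s}" using g(2) by (auto simp: boundary_action_def)
  then obtain m n where "\<forall>k. s (m + k) = (g \<circ> r) (n + k)" by (auto simp: cofinal_rays_def)
  then show ?thesis using that[of g n m] g(1) by simp
qed

lemma reduced_ray:
  assumes "\<And>i. E (s i) (s (Suc i))" "\<And>i. s i \<noteq> s (Suc (Suc i))"
  shows "s \<in> geodesic_rays E"
proof -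
  have "D (s m) (s n) = n - m" if "m \<le> n" for m n
  proof -
    have "reduced_walk E (n - m) (\<lambda>i. s (m + i))" using assms by (auto simp: reduced_walk_def)
    from D_reduced_walk[OF this] show ?thesis using that by simp
  qed
  then show ?thesis by (simp add: geodesic_rays_def)
qed

lemma ray_from_step:
  assumes "\<And>a b. E b (N a b)" "\<And>a b. N a b \<noteq> a" "E a b"
  obtains s where "s \<in> geodesic_rays E" "s 0 = a" "s 1 = b" "\<And>i. s (Suc (Suc i)) = N (s i) (s (Suc i))"
    "\<And>i. E (s i) (s (Suc i))"
proof -
  define p where "p n = ((\<lambda>(a, b). (b, N a b)) ^^ n) (a, b)" for n
  define s where "s n = fst (p n)" for n
  have p: "p 0 = (a, b)" "\<And>n. p (Suc n) = (snd (p n), N (fst (p n)) (snd (p n)))"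
    by (auto simp: p_def case_prod_beta)
  have snd: "snd (p n) = s (Suc n)" for n by (simp add: s_def p)
  have step: "s (Suc (Suc i)) = N (s i) (s (Suc i))" for i
    by (simp add: s_def p)
  have edge: "E (s i) (s (Suc i))" for i
    by (induction i) (auto simp: step assms, simp add: s_def p assms)
  have ne: "s i \<noteq> s (Suc (Suc i))" for i
    unfolding step using assms(2)[of "s i"] by (rule not_sym)
  have "s \<in> geodesic_rays E" by (rule reduced_ray[of s, OF edge ne])
  moreover have "s 0 = a" "s 1 = b" by (simp_all add: s_def p)
  ultimately show ?thesis using step edge by (rule that)
qed

text \<open>For fixed \<open>x\<close> and \<open>b\<close> these \<open>z\<close> form a branch;
  branches play the role of the basic open sets of the boundary.\<close>

definition beyond :: "'v \<Rightarrow> 'v \<Rightarrow> 'v \<Rightarrow> bool" where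
  "beyond x b z \<longleftrightarrow> D x z = D x b + D b z"

lemma beyond_trans: "beyond x a b \<Longrightarrow> beyond x b c \<Longrightarrow> beyond x a c"
  using D_triangle[of a c b] D_triangle[of x c a] unfolding beyond_def by linarith

lemma beyond_chain:
  assumes "beyond x a z" "beyond x c z" "D x a \<le> D x c"
  shows "beyond x a c"
proof -
  obtain w where w: "D x w = D x a" "D w c = D x c - D x a"
    using geodesic_point_exists[OF assms(3)] .
  have "D w z \<le> D w c + D c z" "D x z \<le> D x w + D w z" by (rule D_triangle)+
  then have "D x z = D x w + D w z" using w assms unfolding beyond_def by linarith
  then have "w = a" using geodesic_point_unique[of x w a z] w assms(1) by (simp add: beyond_def)
  then show ?thesis using w assms(3) by (simp add: beyond_def)
qed

lemma beyond_step: obtains c where "E b c" "D x c = Suc (D x b)"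
proof -
  obtain u where u: "\<And>c. E b c \<Longrightarrow> D x c < D x b \<Longrightarrow> c = u"
  proof (cases "\<exists>u. E b u \<and> D x u < D x b")
    case True
    then obtain u where "E b u" "D x u < D x b" by blast
    then show ?thesis using that[of u] closer_neighbour_unique[of b _ u x] by blast
  qed (use that in blast)
  obtain c where c: "E b c" "c \<noteq> u" using neighbour_avoiding[of b u u] .
  then show ?thesis using that[of c] D_adjacent[OF c(1), of x] u[of c] by auto
qed

lemma beyond_extend: "\<exists>c. beyond x b c \<and> D b c = n"
proof (induction n)
  case 0
  then show ?case by (intro exI[of _ b]) (simp add: beyond_def)
next
  case (Suc n)
  then obtain c where c: "beyond x b c" "D b c = n" by blast
  obtain c' where c': "E c c'" "D x c' = Suc (D x c)" using beyond_step .
  have "D b c' \<le> D b c + 1" using D_triangle[of b c' c] D_edge[OF c'(1)] by linarith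
  then have "beyond x b c' \<and> D b c' = Suc n"
    using c c'(2) D_triangle[of x c' b] unfolding beyond_def by linarith
  then show ?case by blast
qed

text \<open>The stabilizer of the edge is transitive on each sphere about \<open>b\<close> inside
  the half-tree of \<open>b\<close>. The orientation matters: goodness propagates forward along
  paths, and only at the end is it known for both directions.\<close>

definition good :: "'v \<Rightarrow> 'v \<Rightarrow> bool" where
  "good a b \<longleftrightarrow> E a b \<and> (\<forall>z z'. D b z < D a z \<and> D b z' < D a z' \<and> D b z = D b z' \<longrightarrow>
     (\<exists>h\<in>G. h a = a \<and> h b = b \<and> h z = z'))"

lemma goodD:
  assumes "good a b" "D b z < D a z" "D b z' < D a z'" "D b z = D b z'"
  shows "\<exists>h\<in>G. h a = a \<and> h b = b \<and> h z = z'"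
  using assms by (simp add: good_def)

text \<open>
  A diagonal argument replaces the Baire category theorem: if every branch avoided the translates of
  a fixed ray starting at each of the countably many vertices, one could build a ray that is not
  cofinal to any translate.
\<close>

lemma exists_good_edge: obtains a b where "good a b"
proof -
  fix x :: 'v
  define N where "N a b = (SOME c. E b c \<and> c \<noteq> a)" for a b
  have "\<exists>c. E b c \<and> c \<noteq> a" for a b using neighbour_avoiding[of b a a] by blast
  then have "E b (N a b) \<and> N a b \<noteq> a" for a b unfolding N_def by (rule someI_ex)
  then have N: "\<And>a b. E b (N a b)" "\<And>a b. N a b \<noteq> a" by blast+
  obtain y where y: "E x y" using neighbour_avoiding .
  obtain r where r: "r \<in> geodesic_rays E" by (rule ray_from_step[OF N y])
  define e where "e = from_nat_into (UNIV :: 'v set)"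
  have e: "surj e" using range_from_nat_into[OF _ countable_vertices] by (simp add: e_def)
  \<comment> \<open>\<open>P v b\<close>: some translate of \<open>r\<close> starting at
    \<open>v\<close> has its end in the branch at \<open>b\<close>.\<close>
  define P where "P v b \<longleftrightarrow> (\<exists>g\<in>G. g (r 0) = v \<and> (\<exists>K. \<forall>k\<ge>K. beyond x b (g (r k))))" for v b
  have "\<exists>v b. \<forall>b'. beyond x b b' \<longrightarrow> P v b'"
  proof (rule ccontr)
    assume "\<not> ?thesis"
    then have neg: "\<exists>b'. beyond x b b' \<and> \<not> P v b'" for v b by blast
    have "\<exists>b'. beyond x b b' \<and> D x b < D x b' \<and> \<not> P v b'" for v b
    proof -
      obtain b' where b': "beyond x b b'" "\<not> P v b'" using neg by blast
      obtain c where c: "beyond x b' c" "D b' c = 1" using beyond_extend by blast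
      have "\<not> P v c" using b'(2) beyond_trans[OF c(1)] unfolding P_def by blast
      moreover have "D x b < D x c" using b'(1) c unfolding beyond_def by linarith
      ultimately show ?thesis using beyond_trans[OF b'(1) c(1)] by blast
    qed
    \<comment> \<open>\<open>nxt v b\<close> shrinks the branch at \<open>b\<close> to one missed by
      all translates starting at \<open>v\<close>; strict descent makes the sequence
      \<open>q\<close> run off to infinity.\<close>
    define nxt where "nxt v b = (SOME b'. beyond x b b' \<and> D x b < D x b' \<and> \<not> P v b')" for v b
    have "beyond x b (nxt v b) \<and> D x b < D x (nxt v b) \<and> \<not> P v (nxt v b)" for v b
      unfolding nxt_def by (rule someI_ex) fact
    then have nxt: "\<And>v b. beyond x b (nxt v b)" "\<And>v b. D x b < D x (nxt v b)" 
        "\<And>v b. \<not> P v (nxt v b)"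
      by blast+
    define q where "q = rec_nat x (\<lambda>n b. nxt (e n) b)"
    have q: "q (Suc n) = nxt (e n) (q n)" for n by (simp add: q_def)
    have far: "n \<le> D x (q n)" for n
    proof (induction n)
      case (Suc n)
      then show ?case using nxt(2)[of "q n" "e n"] by (simp add: q)
    qed simp
    have qq: "beyond x (q m) (q n)" if "m \<le> n" for m n
      using that
    proof (induction n)
      case 0 then show ?case by (simp add: beyond_def)
    next
      case (Suc n)
      then show ?case using beyond_trans[OF Suc.IH, of "q (Suc n)"] nxt(1)[of "q n" "e n"]
        by (cases "m = Suc n") (auto simp: q beyond_def)
    qed
    have "\<exists>w. D x w = n \<and> beyond x w (q n)" for n
    proof -
      obtain w where "D x w = n" "D w (q n) = D x (q n) - n" using geodesic_point_exists[OF far] .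
      then show ?thesis using far[of n] by (intro exI[of _ w]) (simp add: beyond_def)
    qed
    then obtain s where s: "\<And>n. D x (s n) = n" "\<And>n. beyond x (s n) (q n)" by metis
    have sq: "beyond x (s m) (q n)" if "m \<le> n" for m n
      by (rule beyond_trans[OF s(2) qq[OF that]])
    have "s \<in> geodesic_rays E"
      unfolding geodesic_rays_def
    proof (intro CollectI allI impI)
      fix m n :: nat assume "m \<le> n"
      then have "beyond x (s m) (s n)" by (intro beyond_chain[OF sq s(2)]) (auto simp: s)
      then show "D (s m) (s n) = n - m" by (simp add: beyond_def s)
    qed
    from G_bt[OF r this] obtain g m n where g: "g \<in> G" "\<And>k. g (r (m + k)) = s (n + k)" by blast
    \<comment> \<open>The translate that is cofinal to \<open>s\<close> starts at some
      \<open>e i\<close>, a starting point ruled out at stage \<open>i\<close>, although the tail of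
      \<open>s\<close> lies beyond \<open>q (Suc i)\<close>.\<close>
    obtain i where i: "g (r 0) = e i" using surjD[OF e] by blast
    have "beyond x (q (Suc i)) (g (r k))" if k: "k \<ge> m + D x (q (Suc i))" for k
    proof -
      have eq: "g (r k) = s (n + (k - m))" using g(2)[of "k - m"] k by simp
      have le: "D x (q (Suc i)) \<le> n + (k - m)" using k by linarith
      then have "Suc i \<le> n + (k - m)" using far[of "Suc i"] by linarith
      then show ?thesis unfolding eq
        by (intro beyond_chain[OF qq sq[OF order_refl]]) (use le s in auto)
    qed
    then have "P (e i) (q (Suc i))" unfolding P_def using g(1) i by blast
    then show False unfolding q using nxt(3) by blast
  qed
  then obtain v b where vb: "\<And>b'. beyond x b b' \<Longrightarrow> P v b'" by blast
  \<comment> \<open>The depth \<open>Suc (D x v)\<close> puts \<open>b1\<close> farther from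
    \<open>x\<close> than \<open>v\<close>, so \<open>v\<close> lies outside the branch at
    \<open>b1\<close> and sees it through the edge from \<open>a\<close>.\<close>
  obtain b1 where b1: "beyond x b b1" "D b b1 = Suc (D x v)" using beyond_extend by blast
  have far: "D x v < D x b1" using b1 unfolding beyond_def by linarith
  then have "x \<noteq> b1" by auto
  then obtain a where a: "E b1 a" "D x b1 = Suc (D x a)" by (rule closer_neighbour_exists)
  have vside: "D v c < D v z" if "E z c" "D x z = Suc (D x c)" "D x v < D x z" for z c
  proof (rule ccontr)
    assume "\<not> ?thesis"
    then have "D v z < D v c" using D_edge_neq[OF that(1), of v] by linarith
    then have "D x v = Suc (D x c + D z v)" using D_across_edge[OF E_sym[OF that(1)], of x v] that(2) by simp
    then show False using that(2,3) by linarith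
  qed
  have va: "D v a < D v b1" by (rule vside[OF a far])
  \<comment> \<open>Some translate starting at \<open>v\<close> ends beyond \<open>z\<close>. The
    last edge before \<open>z\<close> separates \<open>v\<close> from everything beyond
    \<open>z\<close>, so this translate passes through \<open>z\<close>, necessarily at time
    \<open>D v z\<close>.\<close>
  have reach: "\<exists>g\<in>G. g (r 0) = v \<and> g (r (D v z)) = z" if z: "D z b1 < D z a" for z
  proof -
    have xz: "D x z = Suc (D x a + D b1 z)"
      by (rule D_across_edge[OF E_sym[OF a(1)] _ z]) (simp add: a)
    then have "beyond x b1 z" using a(2) unfolding beyond_def by linarith
    then have "P v z" by (intro vb beyond_trans[OF b1(1)])
    then obtain g K where g: "g \<in> G" "g (r 0) = v" "\<And>k. k \<ge> K \<Longrightarrow> beyond x z (g (r k))"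
      unfolding P_def by blast
    define w where "w = g (r (K + D v z))"
    have w: "beyond x z w" using g(3)[of "K + D v z"] by (simp add: w_def)
    have "D x v < D x z" using xz far a(2) by linarith
    then have "x \<noteq> z" by auto
    then obtain c where c: "E z c" "D x z = Suc (D x c)" by (rule closer_neighbour_exists)
    have "D z w < D c w" using w c(2) D_triangle[of x w c] unfolding beyond_def by linarith
    then have "D v w = Suc (D v c + D z w)"
      using D_across_edge[OF E_sym[OF c(1)] vside[OF c \<open>D x v < D x z\<close>], of w]
      by (simp add: D_commute[of w])
    moreover have "D v z = Suc (D v c)"
      using D_adjacent[OF c(1), of v] vside[OF c \<open>D x v < D x z\<close>] by linarith
    ultimately have vw: "D v w = D v z + D z w" by simp
    have "D v (g (r (D v z))) = D v z"
      unfolding g(2)[symmetric] G_D[OF g(1)] using ray_D[OF r, of 0 "D (g (r 0)) z"] by simp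
    moreover have "D (g (r (D v z))) w = K" unfolding w_def G_D[OF g(1)] 
      using ray_D[OF r, of "D v z" "K + D v z"] by simp
    moreover have "D v w = K + D v z"
      unfolding w_def g(2)[symmetric] G_D[OF g(1)] using ray_D[OF r, of 0] by simp
    ultimately have "g (r (D v z)) = z"
      by (intro geodesic_point_unique[of v _ z w]) (use vw in auto)
    then show ?thesis using g by blast
  qed
  have "good a b1"
    unfolding good_def
  proof (intro conjI allI impI)
    show "E a b1" by (rule E_sym[OF a(1)])
    fix z z' assume asm: "D b1 z < D a z \<and> D b1 z' < D a z' \<and> D b1 z = D b1 z'"
    then have side: "D z b1 < D z a" "D z' b1 < D z' a" by (auto simp: D_commute)
    have vz: "D v z = Suc (D v a + D b1 z)" "D v z' = Suc (D v a + D b1 z')"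
      using D_across_edge[OF E_sym[OF a(1)] va] side by blast+
    obtain g where g: "g \<in> G" "g (r 0) = v" "g (r (D v z)) = z" using reach[OF side(1)] by blast
    obtain g' where g': "g' \<in> G" "g' (r 0) = v" "g' (r (D v z')) = z'" using reach[OF side(2)] by blast
    obtain k where k: "k \<in> G" "\<And>x. k (g x) = x" using G_inv_apply[OF g(1)] by metis
    \<comment> \<open>Undoing one translate and applying the other fixes \<open>v\<close> and
      carries \<open>z\<close> to \<open>z'\<close>; the vertices \<open>a\<close> and
      \<open>b1\<close> lie on the geodesics from \<open>v\<close> to both, so they stay.\<close>
    define h where "h = g' \<circ> k"
    have h: "h \<in> G" using G_comp g' k h_def by blast
    have kv: "k v = r 0" "k z = r (D v z)" using k(2)[of "r 0"] k(2)[of "r (D v z)"] g by auto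
    have hv: "h v = v" using kv g' by (simp add: h_def)
    have hz: "h z = z'" using kv g' vz asm by (simp add: h_def)
    have stays: "h c = c" if c: "D v z' = D v c + D c z'" "D c z' = D c z" for c
    proof (rule geodesic_point_unique[of v _ _ z'])
      show "D v (h c) = D v c" using G_D[OF h, of v c] hv by simp
      show "D v z' = D v (h c) + D (h c) z'"
        using G_D[OF h, of v c] G_D[OF h, of c z] hv hz c by simp
      show "D v z' = D v c + D c z'" by (rule c)
    qed
    have vb1: "D v b1 = Suc (D v a)" using D_adjacent[OF a(1), of v] va by linarith
    have az: "D a z = Suc (D b1 z)" "D a z' = Suc (D b1 z')"
      using D_across_edge[OF E_sym[OF a(1)], of a] side D_edge[OF E_sym[OF a(1)]] by auto
    have "h a = a" by (rule stays) (use az vz asm in auto)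
    moreover have "h b1 = b1" by (rule stays) (use vb1 vz asm in auto)
    ultimately show "\<exists>h\<in>G. h a = a \<and> h b1 = b1 \<and> h z = z'" using h hz by blast
  qed
  then show ?thesis by (rule that)
qed

text \<open>Vertices behind \<open>c\<close> at equal distance from \<open>c\<close> are behind
  \<open>b\<close> at equal distance from \<open>b\<close>, so \<open>good a b\<close> supplies the
  element; it fixes \<open>c\<close>, which lies on both geodesics.\<close>

lemma good_forward:
  assumes "good a b" "E b c" "c \<noteq> a"
  shows "good b c"
  unfolding good_def
proof (intro conjI allI impI)
  show "E b c" by fact
  have ab: "E a b" using assms(1) by (simp add: good_def)
  fix z z' assume asm: "D c z < D b z \<and> D c z' < D b z' \<and> D c z = D c z'"
  have bz: "D b z = Suc (D c z)" "D b z' = Suc (D c z')"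
    using D_adjacent[OF assms(2), of z] D_adjacent[OF assms(2), of z'] asm by (auto simp: D_commute)
  have az: "D a w = Suc (D b w)" if "D c w < D b w" for w
  proof -
    have "D a b < D a c" using neighbours_D[OF E_sym[OF ab] assms(2)] assms(3) D_edge[OF ab] by auto
    then have "D a w = Suc (D a b + D c w)"
      using D_across_edge[OF assms(2), of a w] that by (simp add: D_commute[of w])
    moreover have "D b w = Suc (D c w)" using D_adjacent[OF assms(2), of w] that by (auto simp: D_commute)
    ultimately show ?thesis using D_edge[OF ab] by simp
  qed
  obtain h where h: "h \<in> G" "h b = b" "h z = z'"
    using goodD[OF assms(1), of z z'] az[of z] az[of z'] asm bz by auto
  have "h c = c"
  proof (rule geodesic_point_unique[of b _ _ z'])
    show "D b (h c) = D b c" using G_D[OF h(1), of b c] h by simp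
    show "D b z' = D b (h c) + D (h c) z'"
      using G_D[OF h(1), of b c] G_D[OF h(1), of c z] h asm bz D_edge[OF assms(2)] by simp
    show "D b z' = D b c + D c z'" using asm bz D_edge[OF assms(2)] by simp
  qed
  then show "\<exists>h\<in>G. h b = b \<and> h c = c \<and> h z = z'" using h by blast
qed

lemma good_image:
  assumes "good a b" "g \<in> G"
  shows "good (g a) (g b)"
  unfolding good_def
proof (intro conjI allI impI)
  show "E (g a) (g b)" using assms G_E by (simp add: good_def)
  fix z z' assume asm: "D (g b) z < D (g a) z \<and> D (g b) z' < D (g a) z' \<and> D (g b) z = D (g b) z'"
  obtain k where k: "k \<in> G" "\<And>x. g (k x) = x" "\<And>x. k (g x) = x" using G_inv_apply[OF assms(2)] by blast
  have "D (g y) w = D y (k w)" for y w using G_D[OF k(1), of "g y" w] k(3) by simp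
  then obtain h where h: "h \<in> G" "h a = a" "h b = b" "h (k z) = k z'"
    using goodD[OF assms(1), of "k z" "k z'"] asm by auto
  then show "\<exists>h\<in>G. h (g a) = g a \<and> h (g b) = g b \<and> h z = z'"
    using k by (intro bexI[of _ "g \<circ> (h \<circ> k)"]) (auto intro: G_comp assms)
qed

lemma good_neighbours:
  assumes "good a y" "E y b" "E y c" "b \<noteq> a" "c \<noteq> a"
  obtains h where "h \<in> G" "h y = y" "h b = c"
proof -
  have "E a y" using assms(1) by (simp add: good_def)
  then have "D a b = 2" "D a c = 2" "D y b = 1" "D y c = 1"
    using neighbours_D[OF E_sym] assms D_edge by blast+
  then obtain h where "h \<in> G" "h y = y" "h b = c"
    using goodD[OF assms(1), of b c] by auto
  then show ?thesis by (rule that)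
qed

text \<open>Were the good edge into each vertex unique, its origin would define a
  \<open>G\<close>-equivariant map \<open>f\<close>. Goodness propagates along some ray, so by
  boundary transitivity every ray traverses a good edge; but a ray following \<open>f\<close> (if
  \<open>f \<circ> f\<close> is not the identity) or avoiding \<open>f\<close> (if it is) traverses
  none. Hence two good edges enter some vertex, which makes its stabilizer transitive on neighbours,
  and \<open>G\<close> carries this everywhere.\<close>

lemma all_good:
  assumes "E a y"
  shows "good a y"
proof -
  obtain a0 b0 where good0: "good a0 b0" using exists_good_edge .
  have ex: "\<exists>a. good a y" for y
  proof -
    obtain g where "g \<in> G" "g b0 = y" using G_vt .
    then show ?thesis using good_image[OF good0] by blast
  qed
  have "\<exists>y a a'. good a y \<and> good a' y \<and> a \<noteq> a'"
  proof (rule ccontr)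
    assume neg: "\<not> ?thesis"
    define f where "f y = (SOME a. good a y)" for y
    have f: "good (f y) y" for y unfolding f_def using ex by (rule someI_ex)
    have funiq: "a = f y" if "good a y" for a y using neg f that by blast
    have fG: "f (g y) = g (f y)" if "g \<in> G" for g y using funiq[OF good_image[OF f that]] by simp
    have fE: "E (f y) y" for y using f by (simp add: good_def)
    define N where "N a b = (SOME c. E b c \<and> c \<noteq> a \<and> c \<noteq> f b)" for a b
    have "\<exists>c. E b c \<and> c \<noteq> a \<and> c \<noteq> f b" for a b using neighbour_avoiding[of b a "f b"] by blast
    then have "E b (N a b) \<and> N a b \<noteq> a \<and> N a b \<noteq> f b" for a b unfolding N_def by (rule someI_ex)
    then have N: "\<And>a b. E b (N a b)" "\<And>a b. N a b \<noteq> a" "\<And>a b. N a b \<noteq> f b" by blast+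
    have eventually_good: "\<exists>k\<ge>1. good (s k) (s (Suc k))" if s: "s \<in> geodesic_rays E" for s
    proof -
      have "E a0 b0" using good0 by (simp add: good_def)
      then obtain r where r: "r \<in> geodesic_rays E" "r 0 = a0" "r 1 = b0"
          "\<And>i. r (Suc (Suc i)) = N (r i) (r (Suc i))" "\<And>i. E (r i) (r (Suc i))"
        by (rule ray_from_step[OF N(1,2)]) blast
      have rg: "good (r i) (r (Suc i))" for i
      proof (induction i)
        case 0 then show ?case using r(2,3) good0 by simp
      next
        case (Suc i)
        then show ?case using good_forward[OF Suc] r(5)[of "Suc i"] r(4)[of i] N(2) by metis
      qed
      obtain g m n where g: "g \<in> G" "\<And>k. g (r (m + k)) = s (n + k)" using G_bt[OF r(1) s] by blast
      \<comment> \<open>The shift by one gives \<open>k \<ge> 1\<close>: in the involutive case the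
        vertex after \<open>s k\<close> must have been chosen by \<open>N\<close>.\<close>
      have "good (s (n + 1)) (s (n + 2))" using good_image[OF rg[of "m + 1"] g(1)] g(2)[of 1] g(2)[of 2] by simp
      then show ?thesis by (intro exI[of _ "n + 1"]) simp
    qed
    show False
    proof (cases "f (f y) = y")
      case False
      have ff: "f (f z) \<noteq> z" for z
      proof -
        obtain g where g: "g \<in> G" "g y = z" using G_vt .
        have "f (f z) = g (f (f y))" using fG[OF g(1)] g(2) by metis
        then show ?thesis using False g G_bij[OF g(1)] by (auto dest: bij_is_inj simp: inj_eq)
      qed
      define s where "s i = (f ^^ i) y" for i
      have sS: "s (Suc i) = f (s i)" for i by (simp add: s_def)
      have "s \<in> geodesic_rays E"
      proof (rule reduced_ray)
        show "E (s i) (s (Suc i))" for i unfolding sS by (rule E_sym[OF fE])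
        show "s i \<noteq> s (Suc (Suc i))" for i unfolding sS using ff by metis
      qed
      then obtain k where "good (s k) (s (Suc k))" using eventually_good by blast
      then show False using funiq[of "s k" "s (Suc k)"] ff[of "s k"] sS by metis
    next
      case True
      have ff: "f (f z) = z" for z
      proof -
        obtain g where g: "g \<in> G" "g y = z" using G_vt .
        then show ?thesis using fG[OF g(1)] True by metis
      qed
      obtain s where s: "s \<in> geodesic_rays E" "\<And>i. s (Suc (Suc i)) = N (s i) (s (Suc i))"
        by (rule ray_from_step[OF N(1,2) fE[of y]]) blast
      obtain k where k: "k \<ge> 1" "good (s k) (s (Suc k))" using eventually_good[OF s(1)] by blast
      obtain j where j: "k = Suc j" using k(1) by (cases k) auto
      have "f (s k) = s (Suc k)" using funiq[OF k(2)] ff by metis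
      then show False using s(2)[of j] N(3)[of "s j" "s k"] j by metis
    qed
  qed
  then obtain y0 a1 a2 where y0: "good a1 y0" "good a2 y0" "a1 \<noteq> a2" by blast
  \<comment> \<open>From \<open>e\<close> the stabilizer reaches every neighbour but
    \<open>a1\<close> through the first good edge, and \<open>a1\<close> through the second.\<close>
  obtain e where e: "E y0 e" "e \<noteq> a1" "e \<noteq> a2" using neighbour_avoiding .
  have to_e: "\<exists>h\<in>G. h y0 = y0 \<and> h e = b" if "E y0 b" for b
  proof (cases "b = a1")
    case False
    then show ?thesis using good_neighbours[OF y0(1) e(1) that e(2)] by metis
  next
    case True
    then show ?thesis using good_neighbours[OF y0(2) e(1) that e(3)] y0(3) by metis
  qed
  have a1: "E y0 a1" using y0(1) E_sym by (simp add: good_def)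
  obtain g where g: "g \<in> G" "g y0 = y" using G_vt .
  obtain k where k: "k \<in> G" "\<And>x. g (k x) = x" "\<And>x. k (g x) = x" using G_inv_apply[OF g(1)] by blast
  have "E y0 (k a)" using G_E[OF k(1), of y a] k(3)[of y0] g(2) E_sym[OF assms] by simp
  then obtain h where h: "h \<in> G" "h y0 = y0" "h e = k a" using to_e by blast
  obtain h1 where h1: "h1 \<in> G" "h1 y0 = y0" "h1 e = a1" using to_e[OF a1] by blast
  obtain h2 where h2: "h2 \<in> G" "\<And>x. h2 (h1 x) = x" using G_inv_apply[OF h1(1)] by metis
  have "h2 a1 = e" "h2 y0 = y0" using h2(2)[of e] h2(2)[of y0] h1 by auto
  then have "good e y0" using good_image[OF y0(1) h2(1)] by simp
  then have "good (k a) y0" using good_image[OF _ h(1), of e y0] h by simp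
  then have "good (g (k a)) (g y0)" by (rule good_image) (rule g(1))
  then show ?thesis using k(2) g(2) by simp
qed

text \<open>A third neighbour \<open>a\<close> of \<open>y\<close>, off the geodesics to
  \<open>z\<close> and \<open>z'\<close>, puts both vertices in the half-tree of \<open>y\<close>,
  where goodness of the edge from \<open>a\<close> applies.\<close>

lemma sphere_transitive:
  assumes "D y z = D y z'"
  obtains h where "h \<in> G" "h y = y" "h z = z'"
proof (cases "y = z")
  case True
  then have "D y z' = 0" using assms by simp
  then show ?thesis using that[of id] G_id True by auto
next
  case False
  then have "z \<noteq> y" "z' \<noteq> y" using assms by auto
  obtain u where u: "E y u" "D z y = Suc (D z u)" using closer_neighbour_exists[OF \<open>z \<noteq> y\<close>] .
  obtain u' where u': "E y u'" "D z' y = Suc (D z' u')" using closer_neighbour_exists[OF \<open>z' \<noteq> y\<close>] .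
  obtain a where a: "E y a" "a \<noteq> u" "a \<noteq> u'" using neighbour_avoiding .
  have "D y z < D a z" "D y z' < D a z'"
    using closer_neighbour_unique[OF a(1) u(1), of z] closer_neighbour_unique[OF a(1) u'(1), of z']
      D_edge_neq[OF a(1), of z] D_edge_neq[OF a(1), of z'] a(2,3) u(2) u'(2)
      D_commute[of z] D_commute[of z'] by (metis lessI linorder_neqE_nat)+
  then obtain h where "h \<in> G" "h y = y" "h z = z'"
    using goodD[OF all_good[OF E_sym[OF a(1)]]] assms by blast
  then show ?thesis by (rule that)
qed

text \<open>Move \<open>x\<close> to \<open>z\<close>, then rotate about \<open>z\<close>. This
  gives the symmetry behind the commuting sphere averages as well as the edge inversions.\<close>

lemma G_swap: obtains g where "g \<in> G" "g x = z" "g z = x"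
proof -
  obtain g1 where g1: "g1 \<in> G" "g1 x = z" using G_vt .
  have "D z (g1 z) = D z x" using G_D[OF g1(1), of x z] g1(2) by (simp add: D_commute)
  then obtain h where h: "h \<in> G" "h z = z" "h (g1 z) = x" by (rule sphere_transitive)
  then show ?thesis using that[of "h \<circ> g1"] G_comp g1 by auto
qed

lemma fixes_between:
  assumes "h \<in> G" "h x = x" "h z = z'" "D x z = D x c + D c z" "D x z' = D x c + D c z'"
  shows "h c = c"
proof (rule geodesic_point_unique[of x _ _ z'])
  show "D x (h c) = D x c" using G_D[OF assms(1), of x c] assms(2) by simp
  show "D x z' = D x (h c) + D (h c) z'"
    using G_D[OF assms(1), of x c] G_D[OF assms(1), of c z] G_D[OF assms(1), of x z] assms by simp
qed (rule assms)

section \<open>Convex subtrees and Tits independence\<close>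

lemma tits_factorization:
  assumes "E x y" "r \<in> G" "r x = x" "r y = y"
  obtains r1 r2 where "r1 \<in> G" "r2 \<in> G" "r = r1 \<circ> r2"
    "\<And>z. D z x < D z y \<Longrightarrow> r1 z = z" "\<And>z. D z y < D z x \<Longrightarrow> r2 z = z"
proof -
  have "r \<in> fixator G {x, y}" using assms by (simp add: fixator_def)
  then have "r \<in> fixator G (half_tree E x y) <#>\<^bsub>Aut E\<^esub> fixator G (half_tree E y x)"
    using tits assms(1) by (auto simp: tits_independence_def)
  then show ?thesis
    using that unfolding half_tree_eq[OF assms(1)] half_tree_eq[OF E_sym[OF assms(1)]]
    by (auto simp: set_mult_def fixator_def Aut_def)
qed

definition tree_convex :: "'v set \<Rightarrow> bool" where
  "tree_convex S \<longleftrightarrow> (\<forall>x\<in>S. \<forall>y\<in>S. \<forall>z. D x y = D x z + D z y \<longrightarrow> z \<in> S)"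

text \<open>For a nonempty subtree \<open>S\<close> this is a complete subtree in Olshanskii's
  sense: each vertex is a leaf or has all its neighbours inside. Indexing by \<open>S\<close> makes
  the removal of one vertex the basic descent.\<close>

definition nbhd :: "'v set \<Rightarrow> 'v set" where
  "nbhd S = S \<union> {z. \<exists>s\<in>S. E s z}"

text \<open>If \<open>z\<close> lies between \<open>a\<close> and \<open>b\<close>, one of them is
  on the side of \<open>z\<close> of the edge leading from \<open>z\<close> towards
  \<open>x\<close>, hence at least as far from \<open>x\<close> as \<open>z\<close>.\<close>

lemma tree_convex_ball: "tree_convex {z. D x z \<le> n}"
  unfolding tree_convex_def
proof (intro ballI allI impI CollectI)
  fix a b z assume ab: "a \<in> {z. D x z \<le> n}" "b \<in> {z. D x z \<le> n}" and z: "D a b = D a z + D z b"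
  show "D x z \<le> n"
  proof (cases "x = z")
    case False
    then obtain u where u: "E z u" "D x z = Suc (D x u)" by (rule closer_neighbour_exists)
    have *: "D x z \<le> n" if "D c z < D c u" "D x c \<le> n" for c
      using D_across_edge[OF E_sym[OF u(1)], of x c] that u(2) by simp
    have "\<not> (D a u < D a z \<and> D b u < D b z)"
      using D_triangle[of a b u] z D_commute[of b u] D_commute[of b z] by linarith
    then show ?thesis using * ab D_edge_neq[OF u(1), of a] D_edge_neq[OF u(1), of b] by force
  qed auto
qed

lemma tree_convex_image:
  assumes "g \<in> G" "tree_convex S"
  shows "tree_convex (g ` S)"
  unfolding tree_convex_def
proof (intro ballI allI impI)
  fix x y z assume xy: "x \<in> g ` S" "y \<in> g ` S" and z: "D x y = D x z + D z y"
  obtain k where k: "k \<in> G" "\<And>x. g (k x) = x" "\<And>x. k (g x) = x" using G_inv_apply[OF assms(1)] by blast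
  have "k x \<in> S" "k y \<in> S" using xy k(3) by auto
  moreover have "D (k x) (k y) = D (k x) (k z) + D (k z) (k y)" using z G_D[OF k(1)] by simp
  ultimately have "k z \<in> S" using assms(2) unfolding tree_convex_def by blast
  then show "z \<in> g ` S" using k(2)[of z] by (metis imageI)
qed

text \<open>Two elements of \<open>S\<close> in different directions from \<open>v\<close> would
  have \<open>v\<close> between them.\<close>

lemma convex_branch:
  assumes "tree_convex S" "S \<noteq> {}" "v \<notin> S"
  obtains u where "E v u" "\<And>s. s \<in> S \<Longrightarrow> D s u < D s v"
proof -
  obtain s0 where s0: "s0 \<in> S" using assms(2) by blast
  then have "s0 \<noteq> v" using assms(3) by blast
  then obtain u where u: "E v u" "D s0 v = Suc (D s0 u)" by (rule closer_neighbour_exists)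
  have "D s u < D s v" if s: "s \<in> S" for s
  proof (rule ccontr)
    assume "\<not> ?thesis"
    then have "D s v < D s u" using D_edge_neq[OF u(1), of s] by linarith
    then have "D s0 s = D s0 v + D v s" using D_across_edge[OF E_sym[OF u(1)], of s0 s] u(2) by simp
    then show False using assms(1,3) s0 s unfolding tree_convex_def by blast
  qed
  then show ?thesis using that u by blast
qed

lemma half_tree_neighbour:
  assumes "E v u" "D s u < D s v" "E s z"
  shows "z = v \<or> D z u < D z v"
proof (rule ccontr)
  assume "\<not> ?thesis"
  then have ne: "z \<noteq> v" "D z v < D z u" using D_edge_neq[OF assms(1), of z] by auto
  then have "D s z = Suc (D s u + D v z)" using D_across_edge[OF E_sym[OF assms(1)] assms(2)] by simp
  then have "D v z = 0" using D_edge[OF assms(3)] by linarith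
  then show False using ne by auto
qed

lemma neighbour_side: "E v u \<Longrightarrow> E v z \<Longrightarrow> z \<noteq> u \<Longrightarrow> D z v < D z u"
  using neighbours_D[of v z u] D_edge[of v z] D_commute[of v z] by simp

text \<open>
  The vertex \<open>v\<close> of \<open>S - S'\<close> farthest from a vertex of \<open>S'\<close> is an end of \<open>S\<close>, and the edge
  joining it to \<open>u\<close> separates \<open>S'\<close> from the part of the neighbourhood of \<open>S\<close> that is removed.
\<close>

lemma convex_separation:
  assumes S: "finite S" "tree_convex S" "\<not> S \<subseteq> S'" and S': "tree_convex S'" "S' \<noteq> {}"
  obtains v u where "v \<in> S" "E v u" "tree_convex (S - {v})"
    "\<And>R r. R = (if S = {v} then {u, v} else nbhd (S - {v})) \<Longrightarrow> r \<in> fixator G R \<Longrightarrow>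
      \<exists>r1\<in>fixator G (nbhd S'). \<exists>r2\<in>fixator G (nbhd S). r = r1 \<circ> r2"
proof -
  obtain s0 where s0: "s0 \<in> S'" using S'(2) by blast
  obtain v where v: "v \<in> S" "v \<notin> S'" and vmax: "\<And>w. w \<in> S \<Longrightarrow> w \<notin> S' \<Longrightarrow> D w s0 \<le> D v s0"
  proof -
    have "finite (S - S')" "S - S' \<noteq> {}" using S by auto
    then have "Max ((\<lambda>w. D w s0) ` (S - S')) \<in> (\<lambda>w. D w s0) ` (S - S')" by (intro Max_in) auto
    then obtain v where v: "v \<in> S - S'" "D v s0 = Max ((\<lambda>w. D w s0) ` (S - S'))" by auto
    have "D w s0 \<le> D v s0" if "w \<in> S" "w \<notin> S'" for w
      unfolding v(2) using \<open>finite (S - S')\<close> that by (intro Max_ge) auto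
    then show ?thesis using that[of v] v(1) by blast
  qed
  obtain u where u: "E v u" "\<And>s. s \<in> S' \<Longrightarrow> D s u < D s v" using convex_branch[OF S' v(2)] by blast
  \<comment> \<open>A vertex of \<open>S\<close> on the far side of \<open>v\<close> would be
    farther from \<open>s0\<close>, against the choice of \<open>v\<close>.\<close>
  have Sside: "D w u < D w v" if w: "w \<in> S" "w \<noteq> v" for w
  proof (rule ccontr)
    assume neg: "\<not> ?thesis"
    then have lt: "D w v < D w u" using D_edge_neq[OF u(1), of w] by linarith
    then have "D s0 w = Suc (D s0 u + D v w)"
      using D_across_edge[OF E_sym[OF u(1)] u(2)[OF s0]] by simp
    moreover have "D s0 v = Suc (D s0 u)" using D_adjacent[OF u(1), of s0] u(2)[OF s0] by linarith
    moreover have "D w s0 \<le> D v s0" using vmax[OF w(1)] u(2)[of w] neg by blast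
    ultimately have "D v w = 0" using D_commute[of w s0] D_commute[of v s0] by linarith
    then show False using w(2) by simp
  qed
  have conv: "tree_convex (S - {v})"
    unfolding tree_convex_def
  proof (intro ballI allI impI)
    fix x y z assume xy: "x \<in> S - {v}" "y \<in> S - {v}" "D x y = D x z + D z y"
    have "z \<noteq> v"
    proof
      assume "z = v"
      then show False
        using xy Sside[of x] Sside[of y] D_triangle[of x y u] D_commute[of y u] D_commute[of y v] by auto
    qed
    then show "z \<in> S - {v}" using xy S(2) unfolding tree_convex_def by blast
  qed
  \<comment> \<open>For \<open>S = {v}\<close> the neighbourhood of \<open>S - {v}\<close> would be
    empty; the edge is then the set that keeps Tits independence applicable.\<close>
  have "\<exists>r1\<in>fixator G (nbhd S'). \<exists>r2\<in>fixator G (nbhd S). r = r1 \<circ> r2"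
    if R: "R = (if S = {v} then {u, v} else nbhd (S - {v}))" and r: "r \<in> fixator G R" for R r
  proof -
    have uv: "u \<in> R" "v \<in> R" and RS: "\<And>z. z \<in> nbhd S \<Longrightarrow> z \<notin> R \<Longrightarrow> D z v < D z u"
      and Ru: "\<And>z. z \<in> R \<Longrightarrow> z = v \<or> D z u < D z v"
    proof -
      have near_v: "D z v < D z u" if "E v z" "z \<noteq> u" for z by (rule neighbour_side[OF u(1) that])
      have "u \<in> R \<and> v \<in> R \<and> (\<forall>z. z \<in> nbhd S \<longrightarrow> z \<notin> R \<longrightarrow> D z v < D z u) \<and>
          (\<forall>z\<in>R. z = v \<or> D z u < D z v)"
      proof (cases "S = {v}")
        case True
        then show ?thesis using near_v R D_edge[OF u(1)] by (auto simp: nbhd_def D_commute)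
      next
        case False
        then obtain w where w: "w \<in> S" "w \<noteq> v" using v(1) by blast
        have "D w v = D w u + D u v" using D_adjacent[OF u(1), of w] Sside[OF w] D_edge[OF E_sym[OF u(1)]]
          by linarith
        then have "u \<in> S" using S(2) w v(1) unfolding tree_convex_def by blast
        moreover have "u \<noteq> v" using u(1) E_irrefl by auto
        ultimately have "u \<in> S - {v}" by blast
        moreover have "z = v \<or> D z u < D z v" if "z \<in> nbhd (S - {v})" for z
          using that Sside half_tree_neighbour[OF u(1) Sside] by (auto simp: nbhd_def)
        ultimately show ?thesis
          using near_v R False E_sym[OF u(1)] by (auto simp: nbhd_def)
      qed
      then show "u \<in> R" "v \<in> R" "\<And>z. z \<in> nbhd S \<Longrightarrow> z \<notin> R \<Longrightarrow> D z v < D z u"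
        "\<And>z. z \<in> R \<Longrightarrow> z = v \<or> D z u < D z v" by blast+
    qed
    have rG: "r \<in> G" "\<And>z. z \<in> R \<Longrightarrow> r z = z" using r by (auto simp: fixator_def)
    obtain r1 r2 where r12: "r1 \<in> G" "r2 \<in> G" "r = r1 \<circ> r2"
        "\<And>z. D z u < D z v \<Longrightarrow> r1 z = z" "\<And>z. D z v < D z u \<Longrightarrow> r2 z = z"
      using tits_factorization[OF E_sym[OF u(1)] rG(1) rG(2)[OF uv(1)] rG(2)[OF uv(2)]] by blast
    have inj1: "inj r1" using G_bij[OF r12(1)] by (rule bij_is_inj)
    have v2: "r2 v = v" using r12(5)[of v] D_edge[OF u(1)] by simp
    then have v1: "r1 v = v" using r12(3) rG(2)[OF uv(2)] by simp
    \<comment> \<open>\<open>nbhd S'\<close> lies in the half-tree of \<open>u\<close> together with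
      \<open>v\<close>, all fixed by \<open>r1\<close>. On \<open>R\<close> both \<open>r\<close>
      and \<open>r1\<close> are trivial, hence so is \<open>r2\<close>; the rest of
      \<open>nbhd S\<close> lies in the half-tree of \<open>v\<close>.\<close>
    have "r1 \<in> fixator G (nbhd S')"
      using r12(1,4) v1 u(2) half_tree_neighbour[OF u(1) u(2)] by (auto simp: fixator_def nbhd_def)
    moreover have "r2 z = z" if z: "z \<in> nbhd S" for z
    proof (cases "z \<in> R")
      case True
      have "r1 (r2 z) = r1 z"
        using rG(2)[OF True] r12(3) Ru[OF True] r12(4)[of z] v1 by auto
      then show ?thesis using inj1 by (simp add: inj_eq)
    qed (use RS z r12(5) in blast)
    then have "r2 \<in> fixator G (nbhd S)" using r12(2) by (simp add: fixator_def)
    ultimately show ?thesis using r12(3) by blast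
  qed
  then show ?thesis by (rule that[OF v(1) u(1) conv])
qed

lemma finite_nbhd: "finite S \<Longrightarrow> finite (nbhd S)"
proof -
  assume "finite S"
  moreover have "nbhd S = S \<union> (\<Union>s\<in>S. {z. E s z})" by (auto simp: nbhd_def)
  ultimately show ?thesis using finite_neighbours by simp
qed

end

section \<open>The topology of pointwise convergence\<close>

abbreviation pointwise :: "('v \<Rightarrow> 'v) topology" where
  "pointwise \<equiv> product_topology (\<lambda>_. discrete_topology UNIV) UNIV"

lemma continuous_map_discrete_locally_constant:
  assumes "\<And>x. x \<in> topspace X \<Longrightarrow> \<exists>W. openin X W \<and> x \<in> W \<and> (\<forall>y\<in>W. f y = f x)"
  shows "continuous_map X (discrete_topology UNIV) f"
  unfolding continuous_map_def
proof (intro conjI allI impI)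
  fix U
  show "openin X {x \<in> topspace X. f x \<in> U}"
  proof (subst openin_subopen, intro ballI)
    fix x assume x: "x \<in> {x \<in> topspace X. f x \<in> U}"
    then obtain W where W: "openin X W" "x \<in> W" "\<forall>y\<in>W. f y = f x" using assms by blast
    have "W \<subseteq> {x \<in> topspace X. f x \<in> U}"
    proof
      fix y assume y: "y \<in> W"
      then have "f y = f x" using W(3) by blast
      then show "y \<in> {x \<in> topspace X. f x \<in> U}" using x y openin_subset[OF W(1)] by auto
    qed
    then show "\<exists>T. openin X T \<and> x \<in> T \<and> T \<subseteq> {x \<in> topspace X. f x \<in> U}" using W by blast
  qed
qed simp

lemma openin_eval: "openin pointwise {h. h v \<in> U}"
proof -
  have "continuous_map pointwise (discrete_topology UNIV) (\<lambda>h. h v)"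
    by (rule continuous_map_product_projection) simp
  from openin_continuous_map_preimage[OF this, of U] show ?thesis by simp
qed

lemma closedin_eval2: "closedin pointwise {h. R (h u) (h v)}"
proof -
  have "openin pointwise {h. \<not> R (h u) (h v)}"
  proof (subst openin_subopen, intro ballI)
    fix h assume h: "h \<in> {h. \<not> R (h u) (h v)}"
    let ?W = "{h'. h' u \<in> {h u}} \<inter> {h'. h' v \<in> {h v}}"
    have "openin pointwise ?W" by (intro openin_Int openin_eval)
    moreover have "h \<in> ?W" "?W \<subseteq> {h. \<not> R (h u) (h v)}" using h by auto
    ultimately show "\<exists>T. openin pointwise T \<and> h \<in> T \<and> T \<subseteq> {h. \<not> R (h u) (h v)}" by blast
  qed
  moreover have "{h. \<not> R (h u) (h v)} = UNIV - {h. R (h u) (h v)}" by blast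
  ultimately show ?thesis by (simp add: closedin_def)
qed

section \<open>\<open>G\<close> as a locally compact group\<close>

context tree_group
begin

abbreviation GT :: "('v \<Rightarrow> 'v) topology" where "GT \<equiv> subtopology (Aut_topology E) G"

abbreviation GG :: "('v \<Rightarrow> 'v) monoid" where "GG \<equiv> Aut E\<lparr>carrier := G\<rparr>"

lemma GT_eq: "GT = subtopology pointwise G"
proof -
  have "carrier (Aut E) \<inter> G = G" using G_Aut by blast
  then show ?thesis by (simp add: Aut_topology_def subtopology_subtopology)
qed

lemma topspace_GT: "topspace GT = G"
  unfolding GT_eq by simp

lemma openin_GT_eval: "openin GT {g \<in> G. g v = w}"
  unfolding GT_eq openin_subtopology by (intro exI[of _ "{h. h v \<in> {w}}"]) (use openin_eval[of v "{w}"] in auto)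

lemma continuous_map_into_GT:
  assumes "\<And>v. continuous_map X (discrete_topology UNIV) (\<lambda>x. f x v)" "f \<in> topspace X \<rightarrow> G"
  shows "continuous_map X GT f"
  using assms unfolding GT_eq continuous_map_in_subtopology
  by (auto simp: continuous_map_componentwise_UNIV)

lemma inv_GG:
  assumes "g \<in> G"
  shows "inv\<^bsub>GG\<^esub> g \<in> G" "g ((inv\<^bsub>GG\<^esub> g) x) = x" "(inv\<^bsub>GG\<^esub> g) (g x) = x"
proof -
  interpret GG: group GG by (rule subgroup.subgroup_is_group[OF sub group_Aut])
  have g: "g \<in> carrier GG" using assms by simp
  show "inv\<^bsub>GG\<^esub> g \<in> G" using GG.inv_closed[OF g] by simp
  have "g \<circ> inv\<^bsub>GG\<^esub> g = id" "inv\<^bsub>GG\<^esub> g \<circ> g = id"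
    using GG.r_inv[OF g] GG.l_inv[OF g] by (simp_all add: Aut_def)
  then show "g ((inv\<^bsub>GG\<^esub> g) x) = x" "(inv\<^bsub>GG\<^esub> g) (g x) = x" by (auto simp: fun_eq_iff)
qed

lemma topological_group_G: "topological_group GG GT"
  unfolding topological_group_def
proof (intro conjI)
  show "group GG" by (rule subgroup.subgroup_is_group[OF sub group_Aut])
  show "topspace GT = carrier GG" unfolding topspace_GT by simp
  show "continuous_map (prod_topology GT GT) GT (\<lambda>(g, h). g \<otimes>\<^bsub>GG\<^esub> h)"
  proof (rule continuous_map_into_GT)
    fix v
    show "continuous_map (prod_topology GT GT) (discrete_topology UNIV) (\<lambda>x. (case x of (g, h) \<Rightarrow> g \<otimes>\<^bsub>GG\<^esub> h) v)"
    proof (rule continuous_map_discrete_locally_constant)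
      fix x assume x: "x \<in> topspace (prod_topology GT GT)"
      obtain g h where gh: "x = (g, h)" "g \<in> G" "h \<in> G" using x by (auto simp: topspace_GT)
      let ?W = "{g' \<in> G. g' (h v) = g (h v)} \<times> {h' \<in> G. h' v = h v}"
      have "openin (prod_topology GT GT) ?W"
        unfolding openin_prod_Times_iff using openin_GT_eval by blast
      moreover have "x \<in> ?W" using gh by simp
      ultimately show "\<exists>W. openin (prod_topology GT GT) W \<and> x \<in> W \<and>
          (\<forall>y\<in>W. (case y of (g, h) \<Rightarrow> g \<otimes>\<^bsub>GG\<^esub> h) v = (case x of (g, h) \<Rightarrow> g \<otimes>\<^bsub>GG\<^esub> h) v)"
        using gh by (intro exI[of _ ?W]) (auto simp: Aut_def)
    qed
  qed (use G_comp in \<open>auto simp: topspace_GT Aut_def\<close>)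
  show "continuous_map GT GT (\<lambda>g. inv\<^bsub>GG\<^esub> g)"
  proof (rule continuous_map_into_GT)
    fix v
    show "continuous_map GT (discrete_topology UNIV) (\<lambda>g. (inv\<^bsub>GG\<^esub> g) v)"
    proof (rule continuous_map_discrete_locally_constant)
      fix g assume "g \<in> topspace GT"
      then have g: "g \<in> G" by (simp add: topspace_GT)
      let ?w = "(inv\<^bsub>GG\<^esub> g) v"
      let ?W = "{g' \<in> G. g' ?w = v}"
      have "(inv\<^bsub>GG\<^esub> g') v = ?w" if "g' \<in> ?W" for g'
        using that inv_GG(3)[of g' ?w] by auto
      moreover have "g \<in> ?W" using g inv_GG(2)[OF g] by simp
      ultimately show "\<exists>W. openin GT W \<and> g \<in> W \<and> (\<forall>y\<in>W. (inv\<^bsub>GG\<^esub> y) v = ?w)"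
        using openin_GT_eval[of ?w v] by blast
    qed
  qed (use inv_GG in \<open>auto simp: topspace_GT\<close>)
qed

text \<open>The coset lies in a product of finite balls, compact by Tychonoff, and is cut out by
  closed conditions. Surjectivity is not visibly closed; it is recovered by counting, since
  \<open>h\<close> maps each ball about \<open>x\<close> injectively into a ball of the same finite
  size about \<open>g x\<close>.\<close>

lemma compactin_point_coset:
  assumes "closedin (Aut_topology E) G" and g: "g \<in> G"
  shows "compactin GT {h \<in> G. h x = g x}"
proof -
  obtain F where F: "closedin pointwise F" "G = F \<inter> carrier (Aut E)"
    using assms(1) by (auto simp: Aut_topology_def closedin_subtopology)
  define C where "C = (\<Pi>\<^sub>E v\<in>UNIV. {z. D (g x) z \<le> D x v})"
  have C: "compactin pointwise C"
    unfolding C_def compactin_PiE by (simp add: compactin_discrete_topology finite_ball)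
  define B where "B = {h. h x = g x} \<inter> (\<Inter>u. \<Inter>v. {h. E (h u) (h v) \<longleftrightarrow> E u v} \<inter> {h. h u = h v \<longrightarrow> u = v})"
  have B: "closedin pointwise B"
  proof -
    have "closedin pointwise {h. h x = g x}" using closedin_eval2[of "\<lambda>a b. a = g x" x x] .
    moreover have "closedin pointwise (\<Inter>u. \<Inter>v. {h. E (h u) (h v) \<longleftrightarrow> E u v} \<inter> {h. h u = h v \<longrightarrow> u = v})"
      by (intro closedin_Inter closedin_Int) (auto intro!: closedin_INT closedin_Int closedin_eval2
          closedin_eval2[of "\<lambda>a b. a = b \<longrightarrow> _"])
    ultimately show ?thesis unfolding B_def by (rule closedin_Int)
  qed
  have eq: "{h \<in> G. h x = g x} = C \<inter> (F \<inter> B)"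
  proof
    show "{h \<in> G. h x = g x} \<subseteq> C \<inter> (F \<inter> B)"
    proof
      fix h assume h: "h \<in> {h \<in> G. h x = g x}"
      have "h \<in> C" using G_D[of h x] h by (auto simp: C_def)
      moreover have "h \<in> B" using h G_E[of h] bij_is_inj[OF G_bij[of h]] by (auto simp: B_def inj_eq)
      ultimately show "h \<in> C \<inter> (F \<inter> B)" using h F(2) by auto
    qed
    show "C \<inter> (F \<inter> B) \<subseteq> {h \<in> G. h x = g x}"
    proof
      fix h assume h: "h \<in> C \<inter> (F \<inter> B)"
      have inj: "inj h" and hE: "E (h u) (h v) \<longleftrightarrow> E u v" and hx: "h x = g x" for u v
        using h by (auto simp: B_def inj_def)
      have "y \<in> range h" for y
      proof -
        let ?n = "D (g x) y"
        let ?A = "{v. D x v \<le> ?n}" and ?B = "{z. D (g x) z \<le> ?n}"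
        have "?B = g ` ?A"
        proof -
          obtain k where k: "k \<in> G" "\<And>z. g (k z) = z" using G_inv_apply[OF g] by blast
          have "z \<in> g ` ?A" if "z \<in> ?B" for z
            using that k G_D[OF g, of x "k z"] by (intro image_eqI[of _ _ "k z"]) auto
          then show ?thesis using G_D[OF g] by auto
        qed
        moreover have "inj_on g ?A" using bij_is_inj[OF G_bij[OF g]] by (rule inj_on_subset) simp
        ultimately have card: "card ?B = card ?A" by (simp add: card_image)
        have "D (g x) (h v) \<le> D x v" for v using h by (simp add: C_def PiE_iff)
        then have "h ` ?A \<subseteq> ?B" using le_trans by blast
        moreover have "card (h ` ?A) = card ?A" using inj_on_subset[OF inj] by (intro card_image) simp
        ultimately have "h ` ?A = ?B" using card finite_ball by (intro card_subset_eq) auto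
        then show ?thesis by auto
      qed
      then have "bij h" using inj by (auto simp: bij_def)
      then have "h \<in> carrier (Aut E)" using hE by (simp add: Aut_def)
      then show "h \<in> {h \<in> G. h x = g x}" using F(2) h hx by blast
    qed
  qed
  have "compactin pointwise {h \<in> G. h x = g x}"
    unfolding eq by (rule compact_Int_closedin[OF C closedin_Int[OF F(1) B]])
  then show ?thesis by (auto simp: GT_eq compactin_subtopology)
qed

lemma locally_compact_group_G:
  assumes "closedin (Aut_topology E) G"
  shows "locally_compact_group GG GT"
  unfolding locally_compact_group_def
proof (intro conjI topological_group_G)
  show "Hausdorff_space GT"
    unfolding GT_eq by (intro Hausdorff_space_subtopology) (simp add: Hausdorff_space_product_topology)
  show "locally_compact_space GT"
    unfolding locally_compact_space_def
  proof
    fix g assume "g \<in> topspace GT"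
    then have g: "g \<in> G" by (simp add: topspace_GT)
    fix x :: 'v
    show "\<exists>U K. openin GT U \<and> compactin GT K \<and> g \<in> U \<and> U \<subseteq> K"
      using openin_GT_eval[of x "g x"] compactin_point_coset[OF assms g, of x] g
      by (intro exI[of _ "{h \<in> G. h x = g x}"]) auto
  qed
qed

lemma fixator_in_neighbourhood:
  assumes "openin GT W" "id \<in> W"
  obtains F where "finite F" "fixator G F \<subseteq> W"
proof -
  obtain O' where O': "openin pointwise O'" "W = O' \<inter> G"
    using assms(1) by (auto simp: GT_eq openin_subtopology)
  have "id \<in> O'" using assms(2) O'(2) by blast
  then obtain U where U: "finite {i. U i \<noteq> UNIV}" "id \<in> Pi\<^sub>E UNIV U" "Pi\<^sub>E UNIV U \<subseteq> O'"
    using O'(1) unfolding openin_product_topology_alt by auto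
  have "fixator G {i. U i \<noteq> UNIV} \<subseteq> W"
  proof
    fix g assume g: "g \<in> fixator G {i. U i \<noteq> UNIV}"
    have "g i \<in> U i" for i using g U(2) by (cases "U i = UNIV") (auto simp: fixator_def PiE_iff)
    then have "g \<in> O'" using U(3) by (auto simp: PiE_iff)
    then show "g \<in> W" using O'(2) g by (simp add: fixator_def)
  qed
  then show ?thesis using that U(1) by blast
qed

end

section \<open>Finite-dimensional invariant subspaces\<close>

text \<open>With \<open>u\<close> the part of \<open>x\<close> orthogonal to \<open>span B\<close>,
  membership in the larger span is tested by subtracting the component along \<open>u\<close>. That
  map is continuous, so the larger span is the preimage of a closed set.\<close>

lemma closed_span_finite:
  fixes B :: "'a::{real_inner,complete_space} set"
  assumes "finite B"
  shows "closed (span B)"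
  using assms
proof (induction B)
  case empty
  then show ?case by simp
next
  case (insert x B)
  note W = insert.IH subspace_span[of B]
  define u where "u = x - hproj (span B) x"
  have p: "hproj (span B) x \<in> span B" by (rule hproj_in[OF W])
  have orth: "inner w u = 0" if "w \<in> span B" for w
    using hproj_orth[OF W that, of x] by (simp add: u_def inner_commute)
  have mono: "span B \<subseteq> span (insert x B)" by (rule span_mono) blast
  have uin: "u \<in> span (insert x B)"
    unfolding u_def using mono p span_base[of x "insert x B"] by (intro span_diff) auto
  show ?case
  proof (cases "u = 0")
    case True
    then have "x \<in> span B" using p by (simp add: u_def)
    then show ?thesis using insert.IH by (simp add: span_redundant)
  next
    case False
    have "span (insert x B) = (\<lambda>y. y - (inner y u / inner u u) *\<^sub>R u) -` span B"
    proof
      show "span (insert x B) \<subseteq> (\<lambda>y. y - (inner y u / inner u u) *\<^sub>R u) -` span B"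
      proof
        fix y assume "y \<in> span (insert x B)"
        then obtain t where t: "y - t *\<^sub>R x \<in> span B" by (auto simp: span_insert)
        define b where "b = y - t *\<^sub>R x + t *\<^sub>R hproj (span B) x"
        have b: "b \<in> span B" unfolding b_def by (intro span_add span_scale t p)
        have y: "y = b + t *\<^sub>R u" by (simp add: b_def u_def algebra_simps)
        have "inner y u / inner u u = t" using False orth[OF b] by (simp add: y inner_add_left)
        then show "y \<in> (\<lambda>y. y - (inner y u / inner u u) *\<^sub>R u) -` span B" using b by (simp add: y)
      qed
      show "(\<lambda>y. y - (inner y u / inner u u) *\<^sub>R u) -` span B \<subseteq> span (insert x B)"
      proof
        fix y assume "y \<in> (\<lambda>y. y - (inner y u / inner u u) *\<^sub>R u) -` span B"
        then have "(y - (inner y u / inner u u) *\<^sub>R u) + (inner y u / inner u u) *\<^sub>R u \<in> span (insert x B)"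
          using mono by (intro span_add span_scale uin) auto
        then show "y \<in> span (insert x B)" by simp
      qed
    qed
    moreover have "continuous_on UNIV (\<lambda>y. y - (inner y u / inner u u) *\<^sub>R u)"
      by (intro continuous_intros) (use False in auto)
    ultimately show ?thesis using insert.IH by (simp add: closed_vimage)
  qed
qed

text \<open>\<open>poly_orbit T v p\<close> is \<open>p(T) v\<close>, evaluated by Horner's rule.\<close>

definition poly_orbit :: "('h::chilbert_space \<Rightarrow> 'h) \<Rightarrow> 'h \<Rightarrow> complex poly \<Rightarrow> 'h" where
  "poly_orbit T v p = fold_coeffs (\<lambda>a u. scaleC a v + T u) p 0"

context
  fixes T :: "'h::chilbert_space \<Rightarrow> 'h" and v :: 'h
  assumes T: "bounded_clinear T"
begin

interpretation T: bounded_linear T by (rule bounded_clinear_bl[OF T])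

lemma poly_orbit_0 [simp]: "poly_orbit T v 0 = 0"
  by (simp add: poly_orbit_def)

lemma poly_orbit_pCons [simp]: "poly_orbit T v (pCons a p) = scaleC a v + T (poly_orbit T v p)"
  by (cases "a = 0 \<and> p = 0") (auto simp: poly_orbit_def T.zero)

lemma poly_orbit_add: "poly_orbit T v (p + q) = poly_orbit T v p + poly_orbit T v q"
  by (induction p q rule: poly_induct2) (auto simp: scaleC_add_left T.add algebra_simps)

lemma poly_orbit_smult: "poly_orbit T v (smult c p) = scaleC c (poly_orbit T v p)"
  by (induction p) (auto simp: scaleC_add_right scaleC_scaleC bounded_clinear_scaleC[OF T])

lemma poly_orbit_monom: "poly_orbit T v (monom c n) = scaleC c ((T ^^ n) v)"
  by (induction n) (auto simp: monom_0 monom_Suc bounded_clinear_scaleC[OF T])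

lemma poly_orbit_root: "poly_orbit T v ([:- c, 1:] * p) = T (poly_orbit T v p) - scaleC c (poly_orbit T v p)"
proof -
  have "[:- c, 1:] * p = smult (- c) p + pCons 0 p" by simp
  then show ?thesis
    by (simp only: poly_orbit_add poly_orbit_smult poly_orbit_pCons) (simp add: scaleC_minus_left)
qed

lemma poly_orbit_in:
  assumes "csubspace V" "v \<in> V" "\<And>w. w \<in> V \<Longrightarrow> T w \<in> V"
  shows "poly_orbit T v p \<in> V"
proof (induction p)
  case 0
  then show ?case using subspace_0[OF csubspace_subspace[OF assms(1)]] by simp
next
  case (pCons a p)
  then show ?case using assms by (simp add: subspace_add csubspace_subspace csubspace_scaleC)
qed

lemma poly_orbit_span:
  "x \<in> span ((\<lambda>i. (T ^^ i) v) ` {..<k}) \<Longrightarrow> \<exists>p. (p = 0 \<or> degree p < k) \<and> poly_orbit T v p = x"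
proof (induction rule: span_induct_alt)
  case base
  show ?case by (intro exI[of _ 0]) simp
next
  case (step c x y)
  then obtain i p where ip: "i < k" "x = (T ^^ i) v" "p = 0 \<or> degree p < k" "poly_orbit T v p = y" by auto
  define q where "q = monom (of_real c) i + p"
  have "q = 0 \<or> degree q < k"
    using ip(1,3) degree_add_less[of "monom (of_real c) i :: complex poly" k p]
      le_less_trans[OF degree_monom_le[of "of_real c :: complex" i]] by (auto simp: q_def)
  moreover have "poly_orbit T v q = c *\<^sub>R x + y"
    by (simp add: q_def poly_orbit_add poly_orbit_monom ip scaleR_eq_scaleC)
  ultimately show ?case by blast
qed

text \<open>Take a nonzero \<open>q\<close> of least degree with \<open>q(T) v = 0\<close>; it
  exists because long orbits are linearly dependent in \<open>span B\<close>. Splitting off a factor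
  for a root \<open>c\<close> leaves \<open>q'\<close> with \<open>q'(T) v \<noteq> 0\<close> by
  minimality, and that vector is the eigenvector.\<close>

lemma eigenvector_exists:
  assumes V: "csubspace V" "V \<subseteq> span B" "finite B" and v: "v \<in> V" "v \<noteq> 0"
    and inv: "\<And>w. w \<in> V \<Longrightarrow> T w \<in> V"
  shows "\<exists>c w. w \<in> V \<and> w \<noteq> 0 \<and> T w = scaleC c w"
proof -
  have TV: "(T ^^ i) v \<in> V" for i by (induction i) (auto simp: v inv)
  have "\<exists>k. (T ^^ k) v \<in> span ((\<lambda>i. (T ^^ i) v) ` {..<k})"
  proof (rule ccontr)
    assume neg: "\<not> ?thesis"
    have "independent ((\<lambda>i. (T ^^ i) v) ` {..<k}) \<and> card ((\<lambda>i. (T ^^ i) v) ` {..<k}) = k" for k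
    proof (induction k)
      case 0
      then show ?case by (simp add: independent_empty)
    next
      case (Suc k)
      let ?X = "(\<lambda>i. (T ^^ i) v) ` {..<k}"
      have n: "(T ^^ k) v \<notin> span ?X" using neg by blast
      then have "(T ^^ k) v \<notin> ?X" by (rule contrapos_nn) (rule span_base)
      then show ?case using Suc n by (simp add: lessThan_Suc independent_insert)
    qed
    moreover have "(\<lambda>i. (T ^^ i) v) ` {..<k} \<subseteq> span B" for k using TV V(2) by auto
    ultimately have "k \<le> card B" for k using independent_span_bound[OF V(3)] by metis
    from this[of "Suc (card B)"] show False by simp
  qed
  then obtain k where "(T ^^ k) v \<in> span ((\<lambda>i. (T ^^ i) v) ` {..<k})" by blast
  from poly_orbit_span[OF this] obtain p where p: "p = 0 \<or> degree p < k" "poly_orbit T v p = (T ^^ k) v"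
    by blast
  define q where "q = monom 1 k - p"
  have "poly_orbit T v q = 0"
    using poly_orbit_add[of q p] by (simp add: q_def poly_orbit_monom p)
  moreover have "q \<noteq> 0"
    using p(1) by (auto simp: q_def degree_monom_eq)
  ultimately have "\<exists>q. q \<noteq> 0 \<and> poly_orbit T v q = 0" by blast
  then obtain q where q: "q \<noteq> 0" "poly_orbit T v q = 0"
    and qmin: "\<And>q'. q' \<noteq> 0 \<Longrightarrow> poly_orbit T v q' = 0 \<Longrightarrow> degree q \<le> degree q'"
    using ex_has_least_nat[of "\<lambda>q. q \<noteq> 0 \<and> poly_orbit T v q = 0" _ degree] by blast
  have "degree q \<noteq> 0"
  proof
    assume "degree q = 0"
    then obtain a where a: "q = [:a:]" by (rule degree_eq_zeroE)
    have "scaleC (inverse a) (scaleC a v) = 0" using q(2) by (simp add: a T.zero)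
    then show False using q(1) v(2) a by (simp add: scaleC_scaleC)
  qed
  then have "\<not> constant (poly q)" by (simp add: constant_degree)
  then obtain c where "poly q c = 0" using fundamental_theorem_of_algebra by blast
  then obtain q' where q': "q = [:- c, 1:] * q'" by (metis dvdE poly_eq_0_iff_dvd)
  have q'0: "q' \<noteq> 0" using q(1) q' by auto
  have "degree q = Suc (degree q')"
    unfolding q' using degree_mult_eq[OF _ q'0, of "[:- c, 1:]"] by simp
  then have "poly_orbit T v q' \<noteq> 0" using qmin[OF q'0] by auto
  moreover have "T (poly_orbit T v q') = scaleC c (poly_orbit T v q')"
    using q(2) unfolding q' poly_orbit_root by simp
  moreover have "poly_orbit T v q' \<in> V" by (rule poly_orbit_in[OF V(1) v(1) inv])
  ultimately show ?thesis by blast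
qed

end

lemma csubspace_span:
  assumes "\<And>c x. x \<in> X \<Longrightarrow> scaleC c x \<in> span X"
  shows "csubspace (span X)"
proof -
  have "scaleC c x \<in> span X" if "x \<in> span X" for c x
  proof -
    have "scaleC c x \<in> span (scaleC c ` X)"
      using linear_span_image[OF bounded_linear.linear[OF bounded_linear_scaleC[of c]], of X] that by blast
    also have "\<dots> \<subseteq> span X" by (rule span_minimal) (use assms in auto)
    finally show ?thesis .
  qed
  then show ?thesis by (simp add: csubspace_def)
qed

lemma bounded_clinear_compose:
  "bounded_clinear A \<Longrightarrow> bounded_clinear B \<Longrightarrow> bounded_clinear (\<lambda>x. A (B x))"
  unfolding bounded_clinear_def using bounded_linear_compose by auto

text \<open>
  A minimal nonzero subspace is found by minimizing the size of a spanning set.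
\<close>

lemma minimal_invariant_subspace:
  fixes \<Phi> :: "('h::chilbert_space \<Rightarrow> 'h) set"
  assumes "finite B0" "csubspace (span B0)" "span B0 \<noteq> {0}"
    and "\<And>A w. A \<in> \<Phi> \<Longrightarrow> w \<in> span B0 \<Longrightarrow> A w \<in> span B0"
  obtains B where "finite B" "csubspace (span B)" "span B \<noteq> {0}" "span B \<subseteq> span B0"
    "\<And>A w. A \<in> \<Phi> \<Longrightarrow> w \<in> span B \<Longrightarrow> A w \<in> span B"
    "\<And>V. csubspace V \<Longrightarrow> V \<noteq> {0} \<Longrightarrow> V \<subseteq> span B \<Longrightarrow> (\<And>A w. A \<in> \<Phi> \<Longrightarrow> w \<in> V \<Longrightarrow> A w \<in> V) \<Longrightarrow>
       V = span B"
proof -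
  define Q where "Q B \<longleftrightarrow> finite B \<and> csubspace (span B) \<and> span B \<noteq> {0} \<and> span B \<subseteq> span B0 \<and>
    (\<forall>A\<in>\<Phi>. \<forall>w\<in>span B. A w \<in> span B)" for B
  have "Q B0" using assms by (simp add: Q_def)
  then obtain B where B: "Q B" and Bmin: "\<And>B'. Q B' \<Longrightarrow> card B \<le> card B'"
    using ex_has_least_nat[of Q B0 card] by blast
  have fin: "finite B" using B by (simp add: Q_def)
  have "V = span B" if V: "csubspace V" "V \<noteq> {0}" "V \<subseteq> span B" "\<And>A w. A \<in> \<Phi> \<Longrightarrow> w \<in> V \<Longrightarrow> A w \<in> V" for V
  proof (rule ccontr)
    assume "V \<noteq> span B"
    then obtain x where x: "x \<in> span B" "x \<notin> V" using V(3) by blast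
    obtain B' where B': "B' \<subseteq> V" "independent B'" "V \<subseteq> span B'"
      using maximal_independent_subset[of V] by blast
    have sV: "span B' = V" 
      using B'(1,3) span_minimal[OF B'(1) csubspace_subspace[OF V(1)]] by blast
    have bound: "finite B'" using independent_span_bound[OF fin B'(2)] B'(1) V(3) by blast
    \<comment> \<open>A proper subspace leaves room for one more independent vector, so its basis
      \<open>B'\<close> has fewer elements than \<open>B\<close>.\<close>
    have "independent (insert x B')" using B'(2) x(2) sV by (simp add: independent_insert)
    then have "card (insert x B') \<le> card B"
      using independent_span_bound[OF fin] x(1) B'(1) V(3) by blast
    moreover have "x \<notin> B'" using x(2) B'(1) by blast
    ultimately have "card B' < card B" using bound by simp
    moreover have "Q B'" using B V bound by (auto simp: Q_def sV)
    ultimately show False using Bmin[of B'] by simp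
  qed
  moreover have "finite B" "csubspace (span B)" "span B \<noteq> {0}" "span B \<subseteq> span B0"
    "\<And>A w. A \<in> \<Phi> \<Longrightarrow> w \<in> span B \<Longrightarrow> A w \<in> span B"
    using B by (auto simp: Q_def)
  ultimately show ?thesis using that[of B] by (metis (lifting))
qed

section \<open>Unitary representations\<close>

lemma commutant_id: "id \<in> commutant S"
  by (rule commutantI) (auto simp: bounded_clinear_def bounded_linear_ident id_def)

lemma csubspace_commutant_orbit:
  fixes S :: "('h::chilbert_space \<Rightarrow> 'h) set"
  assumes S: "\<And>B. B \<in> S \<Longrightarrow> bounded_clinear B"
  shows "csubspace ((\<lambda>A. A x) ` commutant S)"
proof -
  let ?C = "commutant S"
  have add: "(\<lambda>y. A y + B y) \<in> ?C" if "A \<in> ?C" "B \<in> ?C" for A B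
  proof (rule commutantI)
    show "bounded_clinear (\<lambda>y. A y + B y)"
      using commutant_bounded[OF that(1)] commutant_bounded[OF that(2)]
      by (auto simp: bounded_clinear_def bounded_linear_add scaleC_add_right)
    fix T y assume T: "T \<in> S"
    interpret T: bounded_linear T using S[OF T] by (rule bounded_clinear_bl)
    show "A (T y) + B (T y) = T (A y + B y)"
      using commutant_commute[OF that(1) T] commutant_commute[OF that(2) T] by (simp add: T.add)
  qed
  have scale: "(\<lambda>y. scaleC c (A y)) \<in> ?C" if "A \<in> ?C" for A c
  proof (rule commutantI)
    show "bounded_clinear (\<lambda>y. scaleC c (A y))"
      using commutant_bounded[OF that] bounded_linear_compose[OF bounded_linear_scaleC[of c]]
      by (auto simp: bounded_clinear_def scaleC_scaleC mult.commute)
    fix T y assume T: "T \<in> S"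
    show "scaleC c (A (T y)) = T (scaleC c (A y))"
      using commutant_commute[OF that T] bounded_clinear_scaleC[OF S[OF T]] by simp
  qed
  have scaleI: "scaleC c z \<in> (\<lambda>A. A x) ` ?C" if z: "z \<in> (\<lambda>A. A x) ` ?C" for c z
  proof -
    obtain A where A: "A \<in> ?C" "z = A x" using z by blast
    then show ?thesis using imageI[OF scale[OF A(1), of c], of "\<lambda>A. A x"] by simp
  qed
  have addI: "y + z \<in> (\<lambda>A. A x) ` ?C" if yz: "y \<in> (\<lambda>A. A x) ` ?C" "z \<in> (\<lambda>A. A x) ` ?C" for y z
  proof -
    obtain A B where AB: "A \<in> ?C" "y = A x" "B \<in> ?C" "z = B x" using yz by blast
    then show ?thesis using imageI[OF add[OF AB(1,3)], of "\<lambda>A. A x"] by simp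
  qed
  have "0 \<in> (\<lambda>A. A x) ` ?C"
    using scaleI[OF imageI[OF commutant_id[of S], of "\<lambda>A. A x"], of 0] by simp
  then show ?thesis using addI scaleI by (simp add: csubspace_def subspace_def scaleR_eq_scaleC)
qed

lemma csubspace_closure:
  assumes "csubspace W"
  shows "csubspace (closure W)"
proof -
  have "scaleC c x \<in> closure W" if "x \<in> closure W" for c x
  proof -
    have "scaleC c ` closure W \<subseteq> closure (scaleC c ` W)"
      by (rule closure_bounded_linear_image_subset[OF bounded_linear_scaleC])
    also have "\<dots> \<subseteq> closure W" by (rule closure_mono) (use assms in \<open>auto simp: csubspace_def\<close>)
    finally show ?thesis using that by blast
  qed
  then show ?thesis using subspace_closure[OF csubspace_subspace[OF assms]] by (simp add: csubspace_def)
qed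

lemma cinner_diff_left: "cinner (x - y) (z::'h::chilbert_space) = cinner x z - cinner y z"
  using cinner_add_left[of "x - y" y z] by simp

lemma cinner_zero_left [simp]: "cinner 0 (y::'h::chilbert_space) = 0"
  using cinner_scaleC_left[of 0 0 y] by simp

lemma cinner_self_eq_0: "cinner x x = 0 \<longleftrightarrow> x = (0::'h::chilbert_space)"
  using inner_eq_Re_cinner[of x x] by auto

locale tree_group_rep = tree_group d E G for d and E :: "'v \<Rightarrow> 'v \<Rightarrow> bool" and G +
  fixes \<pi> :: "('v \<Rightarrow> 'v) \<Rightarrow> 'h::chilbert_space \<Rightarrow> 'h"
  assumes rep: "unitary_representation GG GT \<pi>"
begin

abbreviation comm :: "('h \<Rightarrow> 'h) set" where "comm \<equiv> commutant (\<pi> ` G)"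
abbreviation vN :: "('h \<Rightarrow> 'h) set" where "vN \<equiv> commutant comm"

lemma pi_unitary: "g \<in> G \<Longrightarrow> unitary_operator (\<pi> g)"
  using rep by (simp add: unitary_representation_def)

lemma pi_comp: "g \<in> G \<Longrightarrow> h \<in> G \<Longrightarrow> \<pi> (g \<circ> h) x = \<pi> g (\<pi> h x)"
  using rep by (simp add: unitary_representation_def Aut_def fun_eq_iff)

lemma pi_bcl: "g \<in> G \<Longrightarrow> bounded_clinear (\<pi> g)"
  and pi_cinner: "g \<in> G \<Longrightarrow> cinner (\<pi> g x) (\<pi> g y) = cinner x y"
  using pi_unitary by (auto simp: unitary_operator_def)

lemma pi_bl: "g \<in> G \<Longrightarrow> bounded_linear (\<pi> g)"
  using pi_bcl bounded_clinear_bl by blast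

lemma pi_inner: "g \<in> G \<Longrightarrow> inner (\<pi> g x) (\<pi> g y) = inner x y"
  by (simp add: inner_eq_Re_cinner pi_cinner)

lemma pi_norm: "g \<in> G \<Longrightarrow> norm (\<pi> g x) = norm x"
  by (simp add: norm_eq_sqrt_inner pi_inner)

text \<open>Multiplicativity makes \<open>\<pi> id\<close> idempotent, and an idempotent isometry is
  the identity.\<close>

lemma pi_id: "\<pi> id x = x"
proof -
  interpret bounded_linear "\<pi> id" by (rule pi_bl[OF G_id])
  have "\<pi> id (\<pi> id x) = \<pi> id x" using pi_comp[OF G_id G_id, of x] by simp
  then have "norm (\<pi> id (\<pi> id x - x)) = 0" by (simp add: diff)
  then have "norm (\<pi> id x - x) = 0" using pi_norm[OF G_id] by metis
  then show ?thesis by simp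
qed

lemma pi_adjoint:
  assumes "g \<in> G" "k \<in> G" "\<And>x. g (k x) = x"
  shows "\<pi> g (\<pi> k x) = x" "inner (\<pi> g x) y = inner x (\<pi> k y)" "is_adjoint (\<pi> g) (\<pi> k)"
proof -
  have "g \<circ> k = id" using assms(3) by auto
  then show *: "\<pi> g (\<pi> k x) = x" for x using pi_comp[OF assms(1,2), of x] by (simp add: pi_id)
  show "inner (\<pi> g x) y = inner x (\<pi> k y)" using pi_inner[OF assms(1), of x "\<pi> k y"] * by simp
  show "is_adjoint (\<pi> g) (\<pi> k)"
    unfolding is_adjoint_def using pi_cinner[OF assms(1)] * by metis
qed

lemma pi_adjoint_closed: "adjoint_closed (\<pi> ` G)"
  unfolding adjoint_closed_def using pi_adjoint(3) G_inv_apply by (metis imageE imageI)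

lemma pi_continuous:
  assumes "\<epsilon> > 0"
  obtains F where "finite F" "\<And>g. g \<in> fixator G F \<Longrightarrow> norm (\<pi> g x - x) < \<epsilon>"
proof -
  let ?W = "{g \<in> topspace GT. \<pi> g x \<in> ball x \<epsilon>}"
  have "continuous_map GT euclidean (\<lambda>g. \<pi> g x)" using rep by (simp add: unitary_representation_def)
  then have "openin GT ?W" by (rule openin_continuous_map_preimage) auto
  moreover have "id \<in> ?W" using assms G_id pi_id topspace_GT by auto
  ultimately obtain F where "finite F" "fixator G F \<subseteq> ?W" by (rule fixator_in_neighbourhood)
  then show ?thesis using that[of F] by (auto simp: dist_norm norm_minus_commute)
qed

lemma pi_in_vN: "g \<in> G \<Longrightarrow> \<pi> g \<in> vN"
  using subset_bicommutant[of "\<pi> ` G"] pi_bcl by blast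

lemma comm_adjoint_closed: "adjoint_closed comm"
  by (rule adjoint_closed_commutant[OF pi_adjoint_closed])

lemma comm_pi: "a \<in> comm \<Longrightarrow> g \<in> G \<Longrightarrow> a (\<pi> g x) = \<pi> g (a x)"
  by (rule commutant_commute) auto

lemma von_neumann_algebra_vN: "von_neumann_algebra vN"
  by (rule von_neumann_algebra_bicommutant) (auto simp: pi_bcl pi_adjoint_closed)

text \<open>The pairs on which \<open>F\<close> and \<open>H\<close> agree form a closed complex
  subspace containing the orbit of \<open>(x, y)\<close> under \<open>G\<close>, so
  \<open>bicommutant_pair\<close> applies. Operator identities on the generated algebra are thereby
  checked on group elements only.\<close>

lemma vN_pair:
  assumes F: "bounded_clinear F" "bounded_clinear H"
    and eq: "\<And>g. g \<in> G \<Longrightarrow> F (\<pi> g x) = H (\<pi> g y)" and A: "A \<in> vN"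
  shows "F (A x) = H (A y)"
proof -
  interpret F: bounded_linear F by (rule bounded_clinear_bl[OF F(1)])
  interpret H: bounded_linear H by (rule bounded_clinear_bl[OF F(2)])
  let ?W = "{z. F (fst z) = H (snd z)}"
  have "(A x, A y) \<in> ?W"
  proof (rule bicommutant_pair[of "\<pi> ` G" A])
    have "\<pi> id = id" using pi_id by (simp add: fun_eq_iff)
    then show "id \<in> \<pi> ` G" using imageI[OF G_id, of \<pi>] by simp
    show "B \<circ> C \<in> \<pi> ` G" if BC: "B \<in> \<pi> ` G" "C \<in> \<pi> ` G" for B C
    proof -
      obtain g h where gh: "g \<in> G" "h \<in> G" "B = \<pi> g" "C = \<pi> h" using BC by blast
      then have "B \<circ> C = \<pi> (g \<circ> h)" by (simp add: pi_comp fun_eq_iff)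
      then show ?thesis using G_comp gh by blast
    qed
    show "closed ?W"
      by (intro closed_Collect_eq bounded_linear.continuous_on[OF F.bounded_linear_axioms]
          bounded_linear.continuous_on[OF H.bounded_linear_axioms] continuous_intros)
    show "subspace ?W" by (auto simp: subspace_def F.add H.add F.scaleR H.scaleR F.zero H.zero)
  qed (use A eq F in \<open>auto simp: pi_bcl pi_adjoint_closed bounded_clinear_scaleC\<close>)
  then show ?thesis by simp
qed

lemma fixator_G: "k \<in> fixator G F \<Longrightarrow> k \<in> G"
  by (simp add: fixator_def)

lemma fixator_id: "id \<in> fixator G F"
  by (simp add: fixator_def G_id)

lemma fixator_comp: "k \<in> fixator G F \<Longrightarrow> l \<in> fixator G F \<Longrightarrow> k \<circ> l \<in> fixator G F"
  by (auto simp: fixator_def intro: G_comp)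

lemma fixator_inv:
  assumes "k \<in> fixator G F"
  shows "\<exists>l\<in>fixator G F. (\<forall>x. k (l x) = x) \<and> (\<forall>x. l (k x) = x)"
proof -
  obtain l where l: "l \<in> G" "\<And>x. k (l x) = x" "\<And>x. l (k x) = x"
    using G_inv_apply assms unfolding fixator_def by blast
  have "l s = s" if "s \<in> F" for s using l(3)[of s] assms that by (simp add: fixator_def)
  then have "l \<in> fixator G F" using l(1) by (simp add: fixator_def)
  then show ?thesis using l by blast
qed

end

section \<open>Fixed vectors of fixators in the range of a central projection\<close>

locale tree_group_rep_central = tree_group_rep d E G \<pi>
  for d and E :: "'v \<Rightarrow> 'v \<Rightarrow> bool" and G and \<pi> :: "('v \<Rightarrow> 'v) \<Rightarrow> 'h::chilbert_space \<Rightarrow> 'h" +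
  fixes Z :: "'h \<Rightarrow> 'h"
  assumes central: "central_projection vN Z"
begin

lemma Z_bcl: "bounded_clinear Z" and Z_Z: "Z (Z x) = Z x"
  using central by (auto simp: central_projection_def orthogonal_projection_def fun_eq_iff)

interpretation Z: bounded_linear Z by (rule bounded_clinear_bl[OF Z_bcl])

lemma Z_pi: "g \<in> G \<Longrightarrow> Z (\<pi> g x) = \<pi> g (Z x)"
  using central pi_in_vN by (auto simp: central_projection_def intro: commutant_commute)

lemma Z_comm: "a \<in> comm \<Longrightarrow> Z (a x) = a (Z x)"
  using central by (auto simp: central_projection_def intro: commutant_commute)

text \<open>Restricting to the range of \<open>Z\<close> places the projections onto these spaces
  below \<open>Z\<close>.\<close>

definition fixed :: "'v set \<Rightarrow> 'h set" where
  "fixed F = {x. Z x = x \<and> (\<forall>k\<in>fixator G F. \<pi> k x = x)}"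

lemma fixed_Z: "x \<in> fixed F \<Longrightarrow> Z x = x"
  and fixed_pi: "x \<in> fixed F \<Longrightarrow> k \<in> fixator G F \<Longrightarrow> \<pi> k x = x"
  by (auto simp: fixed_def)

lemma fixed_mono: "F \<subseteq> F' \<Longrightarrow> fixed F \<subseteq> fixed F'"
  by (auto simp: fixed_def fixator_def)

lemma closed_fixed: "closed (fixed F)"
proof -
  have "fixed F = {x. Z x = x} \<inter> (\<Inter>k\<in>fixator G F. {x. \<pi> k x = x})" by (auto simp: fixed_def)
  moreover have "closed {x. \<pi> k x = x}" if "k \<in> fixator G F" for k
    by (intro closed_Collect_eq bounded_linear.continuous_on[OF pi_bl[OF fixator_G[OF that]]] continuous_intros)
  moreover have "closed {x. Z x = x}" by (intro closed_Collect_eq Z.continuous_on continuous_intros)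
  ultimately show ?thesis by (simp add: closed_Int closed_INT)
qed

lemma csubspace_fixed: "csubspace (fixed F)"
proof -
  have "\<pi> k (x + y) = \<pi> k x + \<pi> k y \<and> \<pi> k (scaleC c x) = scaleC c (\<pi> k x) \<and> \<pi> k 0 = 0"
    if "k \<in> fixator G F" for k x y c
  proof -
    have k: "k \<in> G" using that by (rule fixator_G)
    interpret k: bounded_linear "\<pi> k" by (rule pi_bl[OF k])
    show ?thesis by (simp add: k.add k.zero bounded_clinear_scaleC[OF pi_bcl[OF k]])
  qed
  then show ?thesis
    by (auto simp: csubspace_def subspace_def fixed_def Z.add Z.zero bounded_clinear_scaleC[OF Z_bcl]
        scaleR_eq_scaleC)
qed

lemma comm_fixed:
  assumes "a \<in> comm" "x \<in> fixed F"
  shows "a x \<in> fixed F"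
proof -
  have "\<pi> k (a x) = a x" if "k \<in> fixator G F" for k
    using comm_pi[OF assms(1) fixator_G[OF that], of x] fixed_pi[OF assms(2) that] by simp
  then show ?thesis using Z_comm[OF assms(1), of x] fixed_Z[OF assms(2)] by (simp add: fixed_def)
qed

text \<open>The inverse of \<open>g\<close> composed with \<open>h\<close> fixes \<open>F\<close>
  pointwise. So \<open>\<pi> g x\<close> depends only on \<open>g\<close> restricted to
  \<open>F\<close>, which turns analysis into combinatorics of images of \<open>F\<close>.\<close>

lemma pi_cong:
  assumes "x \<in> fixed F" "g \<in> G" "h \<in> G" "\<And>s. s \<in> F \<Longrightarrow> g s = h s"
  shows "\<pi> g x = \<pi> h x"
proof -
  obtain k where k: "k \<in> G" "\<And>s. g (k s) = s" "\<And>s. k (g s) = s" using G_inv_apply[OF assms(2)] by blast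
  have "k (h s) = s" if "s \<in> F" for s using k(3)[of s] assms(4)[OF that] by simp
  then have "k \<circ> h \<in> fixator G F" using k assms(3) G_comp by (simp add: fixator_def)
  then have "\<pi> k (\<pi> h x) = x" using fixed_pi[OF assms(1)] pi_comp[OF k(1) assms(3)] by metis
  then show ?thesis using pi_adjoint(1)[OF assms(2) k(1,2), of "\<pi> h x"] by simp
qed

lemma pi_fixed:
  assumes "x \<in> fixed F" "g \<in> G"
  shows "\<pi> g x \<in> fixed (g ` F)"
proof -
  have "\<pi> k (\<pi> g x) = \<pi> g x" if "k \<in> fixator G (g ` F)" for k
  proof -
    have k: "k \<in> G" "\<And>s. s \<in> F \<Longrightarrow> k (g s) = g s" using that by (auto simp: fixator_def)
    have "\<pi> (k \<circ> g) x = \<pi> g x"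
      by (rule pi_cong[OF assms(1) G_comp[OF k(1) assms(2)] assms(2)]) (simp add: k)
    then show ?thesis using pi_comp[OF k(1) assms(2)] by simp
  qed
  then show ?thesis using Z_pi[OF assms(2)] fixed_Z[OF assms(1)] by (simp add: fixed_def)
qed

text \<open>
  The element of minimal norm of the closed convex hull of an orbit replaces the average over the
  compact open subgroup.
\<close>

lemma averaging:
  assumes "Z x = x"
  obtains c where "c \<in> fixed F" "c \<in> closure (convex hull ((\<lambda>k. \<pi> k x) ` fixator G F))"
proof -
  define X where "X = (\<lambda>k. \<pi> k x) ` fixator G F"
  define Q where "Q = closure (convex hull X)"
  have "X \<noteq> {}" using fixator_id[of F] by (auto simp: X_def)
  then have Q: "closed Q" "convex Q" "Q \<noteq> {}"
    by (auto simp: Q_def convex_closure convex_convex_hull)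
  obtain c where c: "c \<in> Q" "\<And>y. y \<in> Q \<Longrightarrow> dist 0 c \<le> dist 0 y"
    by (rule hilbert_closest_point_exists[OF Q, of 0]) blast
  have "\<pi> k c = c" if k: "k \<in> fixator G F" for k
  proof -
    have kG: "k \<in> G" using k by (rule fixator_G)
    have "\<pi> k ` Q \<subseteq> closure (\<pi> k ` (convex hull X))"
      unfolding Q_def by (rule closure_bounded_linear_image_subset[OF pi_bl[OF kG]])
    also have "\<pi> k ` (convex hull X) = convex hull (\<pi> k ` X)"
      by (rule convex_hull_linear_image[OF bounded_linear.linear[OF pi_bl[OF kG]]])
    also have "closure (convex hull (\<pi> k ` X)) \<subseteq> Q"
      unfolding Q_def
    proof (intro closure_mono hull_mono)
      show "\<pi> k ` X \<subseteq> X"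
      proof
        fix y assume "y \<in> \<pi> k ` X"
        then obtain l where l: "l \<in> fixator G F" "y = \<pi> k (\<pi> l x)" by (auto simp: X_def)
        then have "y = \<pi> (k \<circ> l) x" using pi_comp[OF kG fixator_G[OF l(1)], of x] by simp
        then show "y \<in> X" using fixator_comp[OF k l(1)] by (auto simp: X_def)
      qed
    qed
    finally have "\<pi> k c \<in> Q" using c(1) by blast
    moreover have "dist 0 (\<pi> k c) \<le> dist 0 c" using pi_norm[OF kG] by simp
    ultimately show ?thesis using hilbert_closest_point_unique[OF Q(2) c(1) _ c(2)] by metis
  qed
  moreover have "Q \<subseteq> {y. Z y = y}"
  proof -
    have "X \<subseteq> {y. Z y = y}" using Z_pi[OF fixator_G] assms by (auto simp: X_def)
    moreover have "convex {y. Z y = y}"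
      by (rule subspace_imp_convex) (auto simp: subspace_def Z.add Z.scaleR Z.zero)
    moreover have "closed {y. Z y = y}" by (intro closed_Collect_eq Z.continuous_on continuous_intros)
    ultimately show ?thesis unfolding Q_def by (intro closure_minimal hull_minimal) auto
  qed
  ultimately have "c \<in> fixed F" using c(1) by (auto simp: fixed_def)
  then show ?thesis using that c(1) by (simp add: Q_def X_def)
qed

text \<open>For a small enough stabilizer the orbit of \<open>x\<close> stays in a ball of half the
  norm of \<open>x\<close> about \<open>x\<close>; its closed convex hull then misses 0, and so does
  the invariant vector found there.\<close>

lemma fixed_nonzero_finite:
  assumes "x \<noteq> 0" "Z x = x"
  obtains F where "finite F" "fixed F \<noteq> {0}"
proof -
  obtain F where F: "finite F" "\<And>g. g \<in> fixator G F \<Longrightarrow> norm (\<pi> g x - x) < norm x / 2"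
    using pi_continuous[of "norm x / 2" x] assms(1) by auto
  obtain c where c: "c \<in> fixed F" "c \<in> closure (convex hull ((\<lambda>k. \<pi> k x) ` fixator G F))"
    by (rule averaging[OF assms(2)])
  have "closure (convex hull ((\<lambda>k. \<pi> k x) ` fixator G F)) \<subseteq> cball x (norm x / 2)"
  proof (intro closure_minimal hull_minimal)
    show "(\<lambda>k. \<pi> k x) ` fixator G F \<subseteq> cball x (norm x / 2)"
      using F(2) by (auto simp: dist_norm norm_minus_commute less_imp_le)
  qed auto
  then have "dist x c \<le> norm x / 2" using c(2) by auto
  then have "c \<noteq> 0" using assms(1) by auto
  then show ?thesis using that[OF F(1)] c(1) by blast
qed

text \<open>The factor \<open>r2\<close> is absorbed by \<open>x\<close> and \<open>r1\<close> by
  \<open>y\<close>, so the inner product with \<open>y\<close> is constant on the orbit of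
  \<open>x\<close> under the fixator of \<open>R\<close>. It keeps this value at the invariant
  vector of the hull, which is 0.\<close>

lemma inner_fixed_zero:
  assumes "fixed R = {0}" "x \<in> fixed F" "y \<in> fixed F'"
    and fac: "\<And>r. r \<in> fixator G R \<Longrightarrow> \<exists>r1\<in>fixator G F'. \<exists>r2\<in>fixator G F. r = r1 \<circ> r2"
  shows "inner x y = 0"
proof -
  have const: "inner (\<pi> r x) y = inner x y" if r: "r \<in> fixator G R" for r
  proof -
    obtain r1 r2 where r12: "r1 \<in> fixator G F'" "r2 \<in> fixator G F" "r = r1 \<circ> r2" using fac[OF r] by blast
    obtain l where l: "l \<in> fixator G F'" "\<And>z. r1 (l z) = z" using fixator_inv[OF r12(1)] by blast
    have G12: "r1 \<in> G" "r2 \<in> G" "l \<in> G" using r12 l fixator_G by blast+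
    have "\<pi> r x = \<pi> r1 x" using pi_comp[OF G12(1,2)] fixed_pi[OF assms(2) r12(2)] r12(3) by simp
    then have "inner (\<pi> r x) y = inner x (\<pi> l y)" using pi_adjoint(2)[OF G12(1,3) l(2)] by simp
    then show ?thesis using fixed_pi[OF assms(3) l(1)] by simp
  qed
  obtain c where c: "c \<in> fixed R" "c \<in> closure (convex hull ((\<lambda>k. \<pi> k x) ` fixator G R))"
    by (rule averaging[OF fixed_Z[OF assms(2)]])
  have "closure (convex hull ((\<lambda>k. \<pi> k x) ` fixator G R)) \<subseteq> {z. inner y z = inner x y}"
  proof (intro closure_minimal hull_minimal)
    show "(\<lambda>k. \<pi> k x) ` fixator G R \<subseteq> {z. inner y z = inner x y}"
      using const by (auto simp: inner_commute[of y])
  qed (auto simp: convex_hyperplane closed_hyperplane)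
  then have "inner y c = inner x y" using c(2) by auto
  then show ?thesis using c(1) assms(1) by simp
qed

definition comm_invariant :: "'h set \<Rightarrow> bool" where
  "comm_invariant W \<longleftrightarrow> closed W \<and> csubspace W \<and> (\<forall>w\<in>W. Z w = w) \<and> (\<forall>a\<in>comm. \<forall>w\<in>W. a w \<in> W)"

lemma comm_invariant_fixed: "comm_invariant (fixed F)"
  using closed_fixed csubspace_fixed fixed_Z comm_fixed by (simp add: comm_invariant_def)

section \<open>Corners cut out by subspaces invariant under the commutant\<close>

context
  fixes W assumes inv: "comm_invariant W"
begin

lemma W: "closed W" "csubspace W" and Ws: "subspace W" and WZ: "w \<in> W \<Longrightarrow> Z w = w"
  using inv csubspace_subspace by (auto simp: comm_invariant_def)

lemma hproj_vN: "hproj W \<in> vN"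
  by (rule hproj_in_commutant[OF W comm_adjoint_closed commutant_bounded])
    (use inv in \<open>auto simp: comm_invariant_def\<close>)

lemma proj_le: "Z \<circ> hproj W = hproj W"
  using WZ hproj_in[OF W(1) Ws] by (simp add: fun_eq_iff)

lemma proj_nonzero: "W \<noteq> {0} \<Longrightarrow> hproj W \<noteq> (\<lambda>x. 0)"
proof
  assume "W \<noteq> {0}" and 0: "hproj W = (\<lambda>x. 0)"
  then obtain w where "w \<in> W" "w \<noteq> 0" using subspace_0[OF Ws] by blast
  then show False using hproj_id[OF W(1) Ws, of w] 0 by simp
qed

lemma abelian_corner:
  assumes "\<And>A B w. A \<in> vN \<Longrightarrow> B \<in> vN \<Longrightarrow> w \<in> W \<Longrightarrow>
    hproj W (A (hproj W (B w))) = hproj W (B (hproj W (A w)))"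
  shows "abelian_projection vN (hproj W)"
  unfolding abelian_projection_def
proof (intro conjI ballI)
  show "orthogonal_projection (hproj W)" by (rule orthogonal_projection_hproj[OF W])
  show "hproj W \<in> vN" by (rule hproj_vN)
  fix A B assume AB: "A \<in> vN" "B \<in> vN"
  have PP: "hproj W (hproj W x) = hproj W x" for x using hproj_id hproj_in W(1) Ws by blast
  show "hproj W \<circ> A \<circ> hproj W \<circ> (hproj W \<circ> B \<circ> hproj W) = hproj W \<circ> B \<circ> hproj W \<circ> (hproj W \<circ> A \<circ> hproj W)"
    using assms[OF AB hproj_in[OF W(1) Ws]] by (simp add: fun_eq_iff PP)
qed

text \<open>The relation is linear in each operator, so \<open>vN_pair\<close> extends it in two
  rounds: from \<open>g\<close> to \<open>A\<close> with \<open>h\<close> kept, then from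
  \<open>h\<close> to \<open>B\<close> with \<open>A\<close> kept.\<close>

lemma abelian_of_commuting:
  assumes "\<And>g h w. g \<in> G \<Longrightarrow> h \<in> G \<Longrightarrow> w \<in> W \<Longrightarrow>
    hproj W (\<pi> g (hproj W (\<pi> h w))) = hproj W (\<pi> h (hproj W (\<pi> g w)))"
  shows "abelian_projection vN (hproj W)"
proof (rule abelian_corner)
  note P = bounded_clinear_hproj[OF W]
  have step: "hproj W (A (hproj W (\<pi> h w))) = hproj W (\<pi> h (hproj W (A w)))"
    if A: "A \<in> vN" and h: "h \<in> G" and w: "w \<in> W" for A h w
    by (rule vN_pair[OF P bounded_clinear_compose[OF P bounded_clinear_compose[OF pi_bcl[OF h] P]] _ A])
      (rule assms[OF _ h w])
  fix A B w assume AB: "A \<in> vN" "B \<in> vN" and w: "w \<in> W"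
  have "hproj W (B (hproj W (A w))) = hproj W (A (hproj W (B w)))"
    by (rule vN_pair[OF P bounded_clinear_compose[OF P bounded_clinear_compose[OF commutant_bounded[OF AB(1)] P]] _ AB(2)])
      (rule step[OF AB(1) _ w, symmetric])
  then show "hproj W (A (hproj W (B w))) = hproj W (B (hproj W (A w)))" by simp
qed

end

lemma hproj_pi_fixed:
  assumes "k \<in> fixator G F"
  shows "hproj (fixed F) (\<pi> k x) = hproj (fixed F) x"
proof (rule hproj_eqI[OF closed_fixed csubspace_subspace[OF csubspace_fixed]])
  note W = closed_fixed csubspace_subspace[OF csubspace_fixed]
  show "hproj (fixed F) x \<in> fixed F" by (rule hproj_in[OF W])
  fix w assume w: "w \<in> fixed F"
  obtain l where l: "l \<in> fixator G F" "\<And>z. k (l z) = z" using fixator_inv[OF assms] by blast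
  have "inner (\<pi> k x) w = inner x w"
    using pi_adjoint(2)[OF fixator_G[OF assms] fixator_G[OF l(1)] l(2)] fixed_pi[OF w l(1)] by simp
  then show "inner (\<pi> k x - hproj (fixed F) x) w = 0"
    using hproj_orth[OF W w, of x] by (simp add: inner_diff_left)
qed

end

context tree_group_rep_central
begin

section \<open>Vectors fixed by a vertex stabilizer\<close>

definition sphere :: "nat \<Rightarrow> 'v \<Rightarrow> 'v set" where
  "sphere n y = {z. D y z = n}"

lemma finite_sphere: "finite (sphere n y)"
  by (rule finite_subset[OF _ finite_ball[of y n]]) (auto simp: sphere_def)

lemma sphere_image:
  assumes "g \<in> G"
  shows "bij_betw g (sphere n y) (sphere n (g y))"
proof -
  obtain k where k: "k \<in> G" "\<And>z. g (k z) = z" "\<And>z. k (g z) = z" using G_inv_apply[OF assms] by blast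
  show ?thesis
    by (rule bij_betw_byWitness[where f'=k])
      (use k G_D[OF assms] G_D[OF k(1), of "g y"] in \<open>auto simp: sphere_def\<close>)
qed

text \<open>\<open>translate x \<xi> y\<close> is \<open>\<pi> g \<xi>\<close> for any \<open>g\<close> with \<open>g x = y\<close>, provided \<open>\<xi> \<in> fixed {x}\<close>.\<close>

definition translate :: "'v \<Rightarrow> 'h \<Rightarrow> 'v \<Rightarrow> 'h" where
  "translate x \<xi> y = \<pi> (SOME g. g \<in> G \<and> g x = y) \<xi>"

lemma translate_eq:
  assumes "\<xi> \<in> fixed {x}" "g \<in> G" "g x = y"
  shows "translate x \<xi> y = \<pi> g \<xi>"
proof -
  have "\<exists>g. g \<in> G \<and> g x = y" using assms by blast
  from someI_ex[OF this] show ?thesis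
    unfolding translate_def using assms by (intro pi_cong[OF assms(1)]) auto
qed

lemma pi_translate:
  assumes "\<xi> \<in> fixed {x}" "g \<in> G"
  shows "\<pi> g (translate x \<xi> y) = translate x \<xi> (g y)"
proof -
  obtain h where h: "h \<in> G" "h x = y" using G_vt .
  have "translate x \<xi> (g y) = \<pi> (g \<circ> h) \<xi>" using h assms G_comp by (intro translate_eq) auto
  then show ?thesis using translate_eq[OF assms(1) h] pi_comp[OF assms(2) h(1)] by simp
qed

lemma pi_sum: "g \<in> G \<Longrightarrow> \<pi> g (\<Sum>i\<in>I. f i) = (\<Sum>i\<in>I. \<pi> g (f i))"
  using linear_sum[OF bounded_linear.linear[OF pi_bl]] by blast

lemma pi_scaleR: "g \<in> G \<Longrightarrow> \<pi> g (c *\<^sub>R x) = c *\<^sub>R \<pi> g x"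
  by (rule linear_scale[OF bounded_linear.linear[OF pi_bl]])

lemma pi_sphere_sum:
  assumes "\<xi> \<in> fixed {x}" "g \<in> G"
  shows "\<pi> g (\<Sum>z\<in>sphere n y. translate x \<xi> z) = (\<Sum>z\<in>sphere n (g y). translate x \<xi> z)"
  unfolding pi_sum[OF assms(2)] pi_translate[OF assms]
  by (rule sum.reindex_bij_betw[OF sphere_image[OF assms(2)]])

lemma Z_pi_fixed: "\<xi> \<in> fixed F \<Longrightarrow> g \<in> G \<Longrightarrow> Z (\<pi> g \<xi>) = \<pi> g \<xi>"
  using Z_pi fixed_Z by simp

lemma Z_sum: "Z (\<Sum>i\<in>I. f i) = (\<Sum>i\<in>I. Z (f i))"
  by (rule linear_sum[OF bounded_linear.linear[OF bounded_clinear_bl[OF Z_bcl]]])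

lemma Z_translate: "\<xi> \<in> fixed {x} \<Longrightarrow> Z (translate x \<xi> y) = translate x \<xi> y"
  using translate_eq G_vt[of x y] Z_pi_fixed by metis

lemma sphere_sum_fixed:
  assumes "\<xi> \<in> fixed {x}"
  shows "(\<Sum>z\<in>sphere n x. translate x \<xi> z) \<in> fixed {x}"
proof -
  have "\<pi> k (\<Sum>z\<in>sphere n x. translate x \<xi> z) = (\<Sum>z\<in>sphere n x. translate x \<xi> z)"
    if "k \<in> fixator G {x}" for k
    using pi_sphere_sum[OF assms fixator_G[OF that], of n x] that by (simp add: fixator_def)
  then show ?thesis by (simp add: fixed_def Z_sum Z_translate[OF assms])
qed

text \<open>The stabilizer of \<open>x\<close> permutes the sphere transitively and fixes
  \<open>w\<close>, so all translates over the sphere have the same inner product with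
  \<open>w\<close>; their mean is the projection.\<close>

lemma hproj_translate:
  assumes \<xi>: "\<xi> \<in> fixed {x}" and n: "D x y = n"
  shows "hproj (fixed {x}) (translate x \<xi> y) =
    (1 / card (sphere n x)) *\<^sub>R (\<Sum>z\<in>sphere n x. translate x \<xi> z)"
proof (rule hproj_eqI[OF closed_fixed csubspace_subspace[OF csubspace_fixed]])
  let ?S = "\<Sum>z\<in>sphere n x. translate x \<xi> z"
  show "(1 / card (sphere n x)) *\<^sub>R ?S \<in> fixed {x}"
    by (intro subspace_scale csubspace_subspace csubspace_fixed sphere_sum_fixed \<xi>)
  fix w assume w: "w \<in> fixed {x}"
  have same: "inner (translate x \<xi> z) w = inner (translate x \<xi> y) w" if z: "z \<in> sphere n x" for z
  proof -
    have "D x y = D x z" using z n by (simp add: sphere_def)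
    then obtain k where k: "k \<in> G" "k x = x" "k y = z" by (rule sphere_transitive)
    then have kf: "k \<in> fixator G {x}" by (simp add: fixator_def)
    obtain l where l: "l \<in> fixator G {x}" "\<And>z. k (l z) = z" using fixator_inv[OF kf] by blast
    have "translate x \<xi> z = \<pi> k (translate x \<xi> y)" using pi_translate[OF \<xi> k(1), of y] k(3) by simp
    then show ?thesis
      using pi_adjoint(2)[OF k(1) fixator_G[OF l(1)] l(2)] fixed_pi[OF w l(1)] by simp
  qed
  have "y \<in> sphere n x" using n by (simp add: sphere_def)
  then have "card (sphere n x) > 0" using finite_sphere card_gt_0_iff by blast
  moreover have "inner ?S w = card (sphere n x) * inner (translate x \<xi> y) w"
    by (simp add: inner_sum_left same)
  ultimately show "inner (translate x \<xi> y - (1 / card (sphere n x)) *\<^sub>R ?S) w = 0"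
    by (simp add: inner_diff_left)
qed

lemma hproj_pi_vertex:
  assumes "\<xi> \<in> fixed {x}" "g \<in> G"
  shows "hproj (fixed {x}) (\<pi> g \<xi>) = (1 / card (sphere (D x (g x)) x)) *\<^sub>R
    (\<Sum>z\<in>sphere (D x (g x)) x. translate x \<xi> z)"
  using hproj_translate[OF assms(1) refl, of "g x"] translate_eq[OF assms refl] by simp

text \<open>An element exchanging \<open>x\<close> and \<open>z\<close> exchanges the two
  conditions. This is Gelfand's trick in combinatorial form.\<close>

lemma count_symmetric:
  "card {y. D x y = m \<and> D y z = n} = card {y. D x y = n \<and> D y z = m}"
proof -
  obtain g where g: "g \<in> G" "g x = z" "g z = x" using G_swap .
  obtain k where k: "k \<in> G" "\<And>z. g (k z) = z" "\<And>z. k (g z) = z" using G_inv_apply[OF g(1)] by blast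
  have kx: "k x = z" "k z = x" using k(3)[of z] k(3)[of x] g by auto
  have "bij_betw g {y. D x y = m \<and> D y z = n} {y. D x y = n \<and> D y z = m}"
  proof (rule bij_betw_byWitness[where f'=k])
    show "g ` {y. D x y = m \<and> D y z = n} \<subseteq> {y. D x y = n \<and> D y z = m}"
      using G_D[OF g(1), of z] G_D[OF g(1), of _ x] g D_commute by auto
    show "k ` {y. D x y = n \<and> D y z = m} \<subseteq> {y. D x y = m \<and> D y z = n}"
      using G_D[OF k(1), of z] G_D[OF k(1), of _ x] kx D_commute by auto
  qed (use k in auto)
  then show ?thesis by (rule bij_betw_same_card)
qed

text \<open>The order of \<open>g\<close> and \<open>h\<close> survives only in the counting
  coefficients. The ball of radius \<open>m + n\<close> contains every sphere of radius
  \<open>n\<close> about a point of the sphere of radius \<open>m\<close>, and its radius is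
  symmetric in both.\<close>

lemma hproj_pi_pi_vertex:
  assumes \<xi>: "\<xi> \<in> fixed {x}" and gh: "g \<in> G" "h \<in> G" and mn: "D x (g x) = m" "D x (h x) = n"
  shows "hproj (fixed {x}) (\<pi> g (hproj (fixed {x}) (\<pi> h \<xi>))) =
    (1 / card (sphere m x) * (1 / card (sphere n x))) *\<^sub>R
    (\<Sum>z | D x z \<le> m + n. real (card {y. D x y = m \<and> D y z = n}) *\<^sub>R translate x \<xi> z)"
proof -
  let ?P = "hproj (fixed {x})" and ?B = "{z. D x z \<le> m + n}"
  let ?\<eta> = "?P (\<pi> h \<xi>)"
  have \<eta>: "?\<eta> = (1 / card (sphere n x)) *\<^sub>R (\<Sum>z\<in>sphere n x. translate x \<xi> z)"
    using hproj_pi_vertex[OF \<xi> gh(2)] mn by simp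
  have \<eta>f: "?\<eta> \<in> fixed {x}" by (rule hproj_in[OF closed_fixed csubspace_subspace[OF csubspace_fixed]])
  have t\<eta>: "translate x ?\<eta> y = (1 / card (sphere n x)) *\<^sub>R (\<Sum>z | z \<in> ?B \<and> D y z = n. translate x \<xi> z)"
    if y: "y \<in> sphere m x" for y
  proof -
    obtain k where k: "k \<in> G" "k x = y" using G_vt .
    have "translate x ?\<eta> y = (1 / card (sphere n x)) *\<^sub>R (\<Sum>z\<in>sphere n y. translate x \<xi> z)"
      unfolding translate_eq[OF \<eta>f k] unfolding \<eta> pi_scaleR[OF k(1)] pi_sphere_sum[OF \<xi> k(1)] k(2) ..
    moreover have "sphere n y = {z. z \<in> ?B \<and> D y z = n}"
    proof -
      have "D x z \<le> m + n" if "D y z = n" for z using D_triangle[of x z y] y that by (simp add: sphere_def)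
      then show ?thesis by (auto simp: sphere_def)
    qed
    ultimately show ?thesis by simp
  qed
  have "(\<Sum>y\<in>sphere m x. translate x ?\<eta> y) =
      (1 / card (sphere n x)) *\<^sub>R (\<Sum>y\<in>sphere m x. \<Sum>z | z \<in> ?B \<and> D y z = n. translate x \<xi> z)"
    by (simp add: t\<eta> scaleR_sum_right)
  also have "(\<Sum>y\<in>sphere m x. \<Sum>z | z \<in> ?B \<and> D y z = n. translate x \<xi> z) =
      (\<Sum>z\<in>?B. \<Sum>y | y \<in> sphere m x \<and> D y z = n. translate x \<xi> z)"
    by (rule sum.swap_restrict[OF finite_sphere finite_ball])
  also have "\<dots> = (\<Sum>z\<in>?B. real (card {y. D x y = m \<and> D y z = n}) *\<^sub>R translate x \<xi> z)"
    by (simp add: sphere_def sum_constant_scaleR)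
  finally show ?thesis
    using hproj_pi_vertex[OF \<eta>f gh(1)] mn by simp
qed

lemma abelian_vertex: "abelian_projection vN (hproj (fixed {x}))"
proof (rule abelian_of_commuting[OF comm_invariant_fixed])
  fix g h w assume "g \<in> G" "h \<in> G" "w \<in> fixed {x}"
  then show "hproj (fixed {x}) (\<pi> g (hproj (fixed {x}) (\<pi> h w))) =
      hproj (fixed {x}) (\<pi> h (hproj (fixed {x}) (\<pi> g w)))"
    using hproj_pi_pi_vertex[of w x g h, OF _ _ _ refl refl] hproj_pi_pi_vertex[of w x h g, OF _ _ _ refl refl]
      count_symmetric[of x "D x (g x)" _ "D x (h x)"]
    by (simp add: add.commute mult.commute)
qed

section \<open>Vectors fixed by an edge stabilizer\<close>

text \<open>Let \<open>r\<close> be the endpoint of \<open>{x, y}\<close> farther from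
  \<open>b\<close>; then \<open>r \<noteq> b\<close>, and \<open>c\<close> is the neighbour of
  \<open>b\<close> towards \<open>r\<close>. Rotations about \<open>r\<close> permute the other
  neighbours of \<open>b\<close> transitively, and they fix the other endpoint \<open>s\<close> and
  \<open>b\<close>, which lie on the geodesics involved.\<close>

lemma far_edge:
  assumes xy: "E x y" and ab: "E a b" and far: "D x b < D x a" "D y b < D y a"
  obtains c where "E b c" "c \<noteq> a" "D x c + D y c < D x a + D y a"
    "\<And>w. E b w \<Longrightarrow> w \<noteq> c \<Longrightarrow> \<exists>h\<in>fixator G {x, y}. h b = b \<and> h a = w"
proof -
  note goal = that
  have *: thesis
    if rs: "{r, s} = {x, y}" "D r b = Suc (D s b)" and E: "E r s" and far: "D r b < D r a" "D s b < D s a" for r s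
  proof -
    have "r \<noteq> b" using rs(2) by auto
    then obtain c where c: "E b c" "D r b = Suc (D r c)" by (rule closer_neighbour_exists)
    have ra: "D r a = Suc (D r b)" "D s a = Suc (D s b)"
      using D_adjacent[OF ab, of r] D_adjacent[OF ab, of s] far by linarith+
    have "c \<noteq> a" using c(2) ra by auto
    moreover have "D r c + D s c < D r a + D s a" using ra c(2) D_adjacent[OF c(1), of s] by linarith
    then have "D x c + D y c < D x a + D y a" using rs(1) by (auto simp: doubleton_eq_iff)
    moreover have "\<exists>h\<in>fixator G {x, y}. h b = b \<and> h a = w" if w: "E b w" "w \<noteq> c" for w
    proof -
      have rw: "D r w = Suc (D r b)"
        using D_adjacent[OF w(1), of r] closer_neighbour_unique[OF w(1) c(1), of r] w(2) c(2) by auto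
      then have "D r a = D r w" using ra by simp
      then obtain h where h: "h \<in> G" "h r = r" "h a = w" by (rule sphere_transitive)
      have ba: "D b a = 1" "D b w = 1" "D r s = 1" using D_edge ab w(1) E E_sym by blast+
      have "D s w \<le> D s b + D b w" by (rule D_triangle)
      moreover have "D r w \<le> D r s + D s w" by (rule D_triangle)
      ultimately have sw: "D r w = D r s + D s w" using rw rs(2) ba by linarith
      have "h b = b" by (rule fixes_between[OF h]) (use ra rw ba in auto)
      moreover have "h s = s" by (rule fixes_between[OF h]) (use ra rs(2) ba sw in auto)
      ultimately show ?thesis using h rs(1) by (intro bexI[of _ h]) (auto simp: fixator_def doubleton_eq_iff)
    qed
    ultimately show ?thesis using goal[OF c(1)] by blast
  qed
  have "D x b = Suc (D y b) \<or> D y b = Suc (D x b)"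
    using D_adjacent[OF xy, of b] by (simp add: D_commute)
  then show ?thesis using *[of x y] *[of y x] xy E_sym[OF xy] far by (auto simp: insert_commute)
qed

text \<open>
  If no nonzero vector is fixed by a vertex stabilizer, the translates of an edge-fixed vector to the
  \<open>d\<close> edges at a vertex sum to zero. This moves the projection of a translate one step
  closer to the edge \<open>{x, y}\<close>, at the cost of a factor \<open>- 1 / (d - 1)\<close>.
\<close>

lemma hproj_pi_edge:
  assumes xy: "E x y" and none: "\<And>v. fixed {v} = {0}"
    and \<sigma>: "\<sigma> \<in> G" "\<sigma> x = y" "\<sigma> y = x" and g: "g \<in> G"
  shows "\<exists>c \<tau>. \<tau> \<in> {id, \<sigma>} \<and> (\<forall>\<xi>\<in>fixed {x, y}. hproj (fixed {x, y}) (\<pi> g \<xi>) = c *\<^sub>R \<pi> \<tau> \<xi>)"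
  using g
proof (induction "D x (g x) + D x (g y) + D y (g x) + D y (g y)" arbitrary: g rule: less_induct)
  case less
  let ?W = "fixed {x, y}"
  note W = closed_fixed csubspace_subspace[OF csubspace_fixed]
  interpret P: bounded_linear "hproj ?W" by (rule bounded_linear_hproj[OF W])
  have gE: "E (g x) (g y)" using G_E[OF less.prems] xy by simp
  show ?case
  proof (cases "{g x, g y} = {x, y}")
    case True
    then obtain \<tau> where \<tau>: "\<tau> \<in> {id, \<sigma>}" "g x = \<tau> x" "g y = \<tau> y"
      using \<sigma> that[of id] that[of \<sigma>] by (auto simp: doubleton_eq_iff)
    have \<tau>G: "\<tau> \<in> G" using \<tau>(1) \<sigma>(1) G_id by auto
    have "hproj ?W (\<pi> g \<xi>) = 1 *\<^sub>R \<pi> \<tau> \<xi>" if \<xi>: "\<xi> \<in> ?W" for \<xi>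
    proof -
      have "\<pi> g \<xi> \<in> fixed (g ` {x, y})" by (rule pi_fixed[OF \<xi> less.prems])
      then have "hproj ?W (\<pi> g \<xi>) = \<pi> g \<xi>" using True by (simp add: hproj_id[OF W])
      also have "\<pi> g \<xi> = \<pi> \<tau> \<xi>" by (rule pi_cong[OF \<xi> less.prems \<tau>G]) (use \<tau> in auto)
      finally show ?thesis by simp
    qed
    then show ?thesis using \<tau>(1) by blast
  next
    case False
    \<comment> \<open>If \<open>x\<close> and \<open>y\<close> disagreed about the nearer end of an
      edge, that edge would separate them and hence be \<open>{x, y}\<close>.\<close>
    have same: "D x a < D x b \<Longrightarrow> D y b < D y a \<Longrightarrow> {a, b} = {x, y}" if "E a b" for a b
    proof -
      assume "D x a < D x b" "D y b < D y a"
      then have "D x y = Suc (D x a + D b y)" by (rule D_across_edge[OF that])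
      then have "D x a = 0" "D b y = 0" using D_edge[OF xy] by linarith+
      then show ?thesis by simp
    qed
    obtain a b where ab: "(a = g x \<and> b = g y) \<or> (a = g y \<and> b = g x)" "D x b < D x a" "D y b < D y a"
      using same[OF gE] same[OF E_sym[OF gE]] False D_edge_neq[OF gE, of x] D_edge_neq[OF gE, of y]
      by (auto simp: insert_commute not_less_iff_gr_or_eq) (metis linorder_neqE_nat)+
    have Eab: "E a b" using ab(1) gE E_sym by blast
    obtain c where c: "E b c" "c \<noteq> a" "D x c + D y c < D x a + D y a"
      "\<And>w. E b w \<Longrightarrow> w \<noteq> c \<Longrightarrow> \<exists>h\<in>fixator G {x, y}. h b = b \<and> h a = w"
      using far_edge[OF xy Eab ab(2,3)] by blast
    let ?N = "{w. E b w}"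
    define k where "k w = (SOME h. h \<in> G \<and> h b = b \<and> h a = w)" for w
    have k: "k w \<in> G \<and> k w b = b \<and> k w a = w" if w: "w \<in> ?N" for w
    proof -
      have "D b a = D b w" using D_edge[OF E_sym[OF Eab]] D_edge[of b w] w by simp
      then obtain h where "h \<in> G" "h b = b" "h a = w" by (rule sphere_transitive)
      then show ?thesis unfolding k_def by (intro someI_ex[of "\<lambda>h. h \<in> G \<and> h b = b \<and> h a = w"]) blast
    qed
    have agree: "\<pi> h (\<pi> g \<xi>) = \<pi> h' (\<pi> g \<xi>)"
      if "h \<in> G" "h' \<in> G" "h a = h' a" "h b = h' b" "\<xi> \<in> ?W" for h h' \<xi>
    proof -
      have "\<pi> (h \<circ> g) \<xi> = \<pi> (h' \<circ> g) \<xi>"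
        by (rule pi_cong[OF that(5)]) (use that(1-4) ab(1) less.prems G_comp in auto)
      then show ?thesis using pi_comp that(1,2) less.prems by simp
    qed
    have kc: "k c \<in> G" "k c b = b" "k c a = c" using k[of c] c(1) by auto
    have "D x ((k c \<circ> g) x) + D x ((k c \<circ> g) y) + D y ((k c \<circ> g) x) + D y ((k c \<circ> g) y)
        < D x (g x) + D x (g y) + D y (g x) + D y (g y)"
      using ab(1) kc c(3) by auto
    from less.hyps[OF this G_comp[OF kc(1) less.prems]]
    obtain c' \<tau> where IH: "\<tau> \<in> {id, \<sigma>}" "\<And>\<xi>. \<xi> \<in> ?W \<Longrightarrow> hproj ?W (\<pi> (k c \<circ> g) \<xi>) = c' *\<^sub>R \<pi> \<tau> \<xi>" by blast
    have "hproj ?W (\<pi> g \<xi>) = (- (c' / (real d - 1))) *\<^sub>R \<pi> \<tau> \<xi>" if \<xi>: "\<xi> \<in> ?W" for \<xi>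
    proof -
      let ?v = "\<pi> g \<xi>"
      \<comment> \<open>The edge joining \<open>a\<close> to \<open>b\<close> is rotated about
        \<open>b\<close> into all \<open>d\<close> positions; the sum is invariant under the
        stabilizer of \<open>b\<close>, hence 0.\<close>
      define u where "u = (\<Sum>w\<in>?N. \<pi> (k w) ?v)"
      have "\<pi> h u = u" if h: "h \<in> fixator G {b}" for h
      proof -
        have hG: "h \<in> G" "h b = b" using h by (auto simp: fixator_def)
        have hk: "\<pi> h (\<pi> (k w) ?v) = \<pi> (k (h w)) ?v" if w: "w \<in> ?N" for w
        proof -
          have hw: "h w \<in> ?N" using G_E[OF hG(1), of b w] hG(2) w by simp
          have "\<pi> (h \<circ> k w) ?v = \<pi> (k (h w)) ?v"
            by (rule agree) (use hG k[OF w] k[OF hw] G_comp \<xi> in auto)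
          then show ?thesis using pi_comp[OF hG(1)] k[OF w] by simp
        qed
        have "bij_betw h ?N ?N"
        proof -
          obtain l where l: "l \<in> fixator G {b}" "\<And>z. h (l z) = z" "\<And>z. l (h z) = z"
            using fixator_inv[OF h] by blast
          then have lG: "l \<in> G" "l b = b" by (auto simp: fixator_def)
          show ?thesis
            by (rule bij_betw_byWitness[where f'=l])
              (use l hG lG G_E[OF hG(1), of b] G_E[OF lG(1), of b] in auto)
        qed
        then have "(\<Sum>w\<in>?N. \<pi> (k (h w)) ?v) = u" unfolding u_def by (rule sum.reindex_bij_betw)
        moreover have "\<pi> h u = (\<Sum>w\<in>?N. \<pi> (k (h w)) ?v)"
          unfolding u_def pi_sum[OF hG(1)] by (rule sum.cong[OF refl hk])
        ultimately show ?thesis by simp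
      qed
      moreover have "Z u = u"
        unfolding u_def Z_sum using Z_pi Z_pi_fixed[OF \<xi> less.prems] k by (intro sum.cong) auto
      ultimately have "u \<in> fixed {b}" by (simp add: fixed_def)
      then have "u = 0" using none by simp
      then have "0 = (\<Sum>w\<in>?N. hproj ?W (\<pi> (k w) ?v))"
        using P.sum[of "\<lambda>w. \<pi> (k w) ?v" ?N] P.zero by (simp add: u_def)
      also have "\<dots> = hproj ?W (\<pi> (k c) ?v) + (\<Sum>w\<in>?N - {c}. hproj ?W (\<pi> (k w) ?v))"
        by (rule sum.remove) (use c(1) finite_neighbours in auto)
      \<comment> \<open>The \<open>d - 1\<close> positions other than \<open>c\<close> are reached
        from \<open>a\<close> by elements fixing \<open>x\<close> and \<open>y\<close>, which the
        projection absorbs.\<close>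
      also have "(\<Sum>w\<in>?N - {c}. hproj ?W (\<pi> (k w) ?v)) = (\<Sum>w\<in>?N - {c}. hproj ?W ?v)"
      proof (rule sum.cong[OF refl])
        fix w assume w: "w \<in> ?N - {c}"
        then obtain h where h: "h \<in> fixator G {x, y}" "h b = b" "h a = w" using c(4)[of w] by blast
        have "\<pi> (k w) ?v = \<pi> h ?v"
          by (rule agree[OF _ fixator_G[OF h(1)] _ _ \<xi>]) (use k[of w] w h in auto)
        then show "hproj ?W (\<pi> (k w) ?v) = hproj ?W ?v" using hproj_pi_fixed[OF h(1)] by simp
      qed
      also have "\<dots> = (real d - 1) *\<^sub>R hproj ?W ?v"
        using c(1) d3 by (simp add: sum_constant_scaleR card_neighbours of_nat_diff)
      also have "hproj ?W (\<pi> (k c) ?v) = c' *\<^sub>R \<pi> \<tau> \<xi>"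
        using IH(2)[OF \<xi>] pi_comp[OF kc(1) less.prems] by simp
      finally have "(real d - 1) *\<^sub>R hproj ?W ?v = - (c' *\<^sub>R \<pi> \<tau> \<xi>)" by (simp add: eq_neg_iff_add_eq_0 add.commute)
      then have "(1 / (real d - 1)) *\<^sub>R ((real d - 1) *\<^sub>R hproj ?W ?v) = (1 / (real d - 1)) *\<^sub>R (- (c' *\<^sub>R \<pi> \<tau> \<xi>))"
        by simp
      then show ?thesis using d3 by simp
    qed
    then show ?thesis using IH(1) by blast
  qed
qed

lemma abelian_edge:
  assumes xy: "E x y" and none: "\<And>v. fixed {v} = {0}"
  shows "abelian_projection vN (hproj (fixed {x, y}))"
proof (rule abelian_of_commuting[OF comm_invariant_fixed])
  let ?W = "fixed {x, y}"
  obtain \<sigma> where \<sigma>: "\<sigma> \<in> G" "\<sigma> x = y" "\<sigma> y = x" using G_swap .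
  note main = hproj_pi_edge[OF xy none \<sigma>]
  note W = closed_fixed csubspace_subspace[OF csubspace_fixed]
  interpret P: bounded_linear "hproj ?W" by (rule bounded_linear_hproj[OF W])
  fix g h w assume gh: "g \<in> G" "h \<in> G" and w: "w \<in> ?W"
  obtain c \<tau> where c: "\<tau> \<in> {id, \<sigma>}" "\<And>\<xi>. \<xi> \<in> ?W \<Longrightarrow> hproj ?W (\<pi> g \<xi>) = c *\<^sub>R \<pi> \<tau> \<xi>"
    using main[OF gh(1)] by blast
  obtain c' \<tau>' where c': "\<tau>' \<in> {id, \<sigma>}" "\<And>\<xi>. \<xi> \<in> ?W \<Longrightarrow> hproj ?W (\<pi> h \<xi>) = c' *\<^sub>R \<pi> \<tau>' \<xi>"
    using main[OF gh(2)] by blast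
  have inW: "\<pi> \<tau> \<xi> \<in> ?W" if "\<tau> \<in> {id, \<sigma>}" "\<xi> \<in> ?W" for \<tau> \<xi>
    using pi_fixed[OF that(2), of \<tau>] that(1) \<sigma> G_id by (auto simp: insert_commute)
  have commute: "\<pi> \<tau> (\<pi> \<tau>' w) = \<pi> \<tau>' (\<pi> \<tau> w)" using c(1) c'(1) by (auto simp: pi_id)
  have "hproj ?W (\<pi> g (hproj ?W (\<pi> h w))) = (c * c') *\<^sub>R \<pi> \<tau> (\<pi> \<tau>' w)"
    using c(2)[OF inW[OF c'(1) w]] c'(2)[OF w] by (simp add: pi_scaleR[OF gh(1)] P.scaleR mult.commute)
  moreover have "hproj ?W (\<pi> h (hproj ?W (\<pi> g w))) = (c * c') *\<^sub>R \<pi> \<tau>' (\<pi> \<tau> w)"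
    using c'(2)[OF inW[OF c(1) w]] c(2)[OF w] by (simp add: pi_scaleR[OF gh(2)] P.scaleR)
  ultimately show "hproj ?W (\<pi> g (hproj ?W (\<pi> h w))) = hproj ?W (\<pi> h (hproj ?W (\<pi> g w)))"
    by (simp add: commute)
qed

end

lemma commutant_comp:
  assumes "A \<in> commutant S" "B \<in> commutant S"
  shows "(\<lambda>x. A (B x)) \<in> commutant S"
proof (rule commutantI)
  show "bounded_clinear (\<lambda>x. A (B x))"
    by (rule bounded_clinear_compose[OF commutant_bounded[OF assms(1)] commutant_bounded[OF assms(2)]])
  show "A (B (C x)) = C (A (B x))" if "C \<in> S" for C x
    using commutant_commute[OF assms(1) that] commutant_commute[OF assms(2) that] by simp
qed

lemma scaleC_Re_Im: "scaleC c x = Re c *\<^sub>R x + Im c *\<^sub>R scaleC \<i> (x::'h::chilbert_space)"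
proof -
  have "c = of_real (Re c) + of_real (Im c) * \<i>" by (simp add: complex_eq_iff)
  then have "scaleC c x = scaleC (of_real (Re c) + of_real (Im c) * \<i>) x" by simp
  also have "\<dots> = Re c *\<^sub>R x + Im c *\<^sub>R scaleC \<i> x"
    unfolding scaleC_add_left by (simp add: scaleR_eq_scaleC scaleC_scaleC)
  finally show ?thesis .
qed

lemma finite_image_factor:
  assumes "finite (r ` A)" "\<And>g h. g \<in> A \<Longrightarrow> h \<in> A \<Longrightarrow> r g = r h \<Longrightarrow> f g = f h"
  shows "finite (f ` A)"
proof (rule finite_surj[OF assms(1)])
  show "f ` A \<subseteq> (\<lambda>y. f (SOME g. g \<in> A \<and> r g = y)) ` r ` A"
  proof
    fix z assume "z \<in> f ` A"
    then obtain g where g: "g \<in> A" "z = f g" by blast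
    have "\<exists>h. h \<in> A \<and> r h = r g" using g by blast
    from someI_ex[OF this] have "f (SOME h. h \<in> A \<and> r h = r g) = z" using assms(2) g by blast
    then show "z \<in> (\<lambda>y. f (SOME g. g \<in> A \<and> r g = y)) ` r ` A" using g by blast
  qed
qed

context tree_group_rep_central
begin

section \<open>Vectors fixed by larger subtrees\<close>

lemma nbhd_image:
  assumes "g \<in> G"
  shows "g ` nbhd S = nbhd (g ` S)"
proof -
  obtain k where k: "k \<in> G" "\<And>z. g (k z) = z" "\<And>z. k (g z) = z" using G_inv_apply[OF assms] by blast
  have "z \<in> g ` nbhd S" if "s \<in> S" "E (g s) z" for s z
  proof (rule image_eqI)
    show "z = g (k z)" by (simp add: k)
    show "k z \<in> nbhd S" using that G_E[OF k(1), of "g s" z] k(3) by (auto simp: nbhd_def)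
  qed
  then show ?thesis using G_E[OF assms] by (auto simp: nbhd_def)
qed

context
  fixes S :: "'v set"
  assumes no_vertex: "\<And>v. fixed {v} = {0}"
    and no_edge: "\<And>x y. E x y \<Longrightarrow> fixed {x, y} = {0}"
    and S: "finite S" "tree_convex S" "S \<noteq> {}" "fixed (nbhd S) \<noteq> {0}"
    and minimal: "\<And>S'. finite S' \<Longrightarrow> tree_convex S' \<Longrightarrow> S' \<noteq> {} \<Longrightarrow> fixed (nbhd S') \<noteq> {0} \<Longrightarrow>
      card S \<le> card S'"
begin

lemma orthogonal_translate:
  assumes g: "g \<in> G" "g ` S \<noteq> S" and xy: "x \<in> fixed (nbhd S)" "y \<in> fixed (nbhd S)"
  shows "inner x (\<pi> g y) = 0"
proof -
  have "card (g ` S) = card S" using bij_is_inj[OF G_bij[OF g(1)]] by (intro card_image) (rule inj_on_subset, auto)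
  then have "\<not> S \<subseteq> g ` S" using g(2) S(1) card_subset_eq[of "g ` S" S] by auto
  from convex_separation[OF S(1,2) this tree_convex_image[OF g(1) S(2)]] S(3)
  obtain v u where vu: "v \<in> S" "E v u" "tree_convex (S - {v})"
    and fac: "\<And>R r. R = (if S = {v} then {u, v} else nbhd (S - {v})) \<Longrightarrow> r \<in> fixator G R \<Longrightarrow>
      \<exists>r1\<in>fixator G (nbhd (g ` S)). \<exists>r2\<in>fixator G (nbhd S). r = r1 \<circ> r2"
    by blast
  define R where "R = (if S = {v} then {u, v} else nbhd (S - {v}))"
  have "fixed R = {0}"
  proof (cases "S = {v}")
    case True
    then show ?thesis using no_edge[OF E_sym[OF vu(2)]] by (simp add: R_def)
  next
    case False
    have "card (S - {v}) < card S" using vu(1) S(1) by (rule card_Diff1_less[rotated])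
    moreover have "S - {v} \<noteq> {}" using False vu(1) by blast
    ultimately have "fixed (nbhd (S - {v})) = {0}"
      using minimal[of "S - {v}"] vu(3) S(1) by (metis finite_Diff not_less)
    then show ?thesis using False by (simp add: R_def)
  qed
  moreover have "\<pi> g y \<in> fixed (nbhd (g ` S))" using pi_fixed[OF xy(2) g(1)] by (simp add: nbhd_image[OF g(1)])
  ultimately show ?thesis by (rule inner_fixed_zero[OF _ xy(1)]) (rule fac[OF R_def])
qed

abbreviation stab :: "('v \<Rightarrow> 'v) set" where "stab \<equiv> {g \<in> G. g ` S = S}"

lemma pi_stab_fixed: "g \<in> stab \<Longrightarrow> x \<in> fixed (nbhd S) \<Longrightarrow> \<pi> g x \<in> fixed (nbhd S)"
  using pi_fixed[of x "nbhd S" g] nbhd_image[of g S] by simp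

lemma stab_comp: "g \<in> stab \<Longrightarrow> h \<in> stab \<Longrightarrow> g \<circ> h \<in> stab"
  using G_comp image_comp[of g h S] by (metis (mono_tags, lifting) mem_Collect_eq)

lemma stab_inv:
  assumes "g \<in> stab"
  shows "\<exists>k\<in>stab. (\<forall>x. g (k x) = x) \<and> (\<forall>x. k (g x) = x)"
proof -
  obtain k where k: "k \<in> G" "\<And>z. g (k z) = z" "\<And>z. k (g z) = z" using G_inv_apply assms by blast
  have "k ` S = k ` (g ` S)" using assms by simp
  also have "\<dots> = S" by (simp add: image_image k)
  finally show ?thesis using k by blast
qed

lemma finite_stab_orbit:
  assumes "x \<in> fixed (nbhd S)"
  shows "finite ((\<lambda>g. \<pi> g x) ` stab)"
proof (rule finite_image_factor)
  have "(\<lambda>g. restrict g (nbhd S)) ` stab \<subseteq> nbhd S \<rightarrow>\<^sub>E nbhd S"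
  proof (rule image_subsetI)
    fix g assume "g \<in> stab"
    then have "g ` nbhd S = nbhd S" using nbhd_image[of g S] by simp
    then show "restrict g (nbhd S) \<in> nbhd S \<rightarrow>\<^sub>E nbhd S" by auto
  qed
  then show "finite ((\<lambda>g. restrict g (nbhd S)) ` stab)"
    by (rule finite_subset) (intro finite_PiE finite_nbhd S(1))
  fix g h assume gh: "g \<in> stab" "h \<in> stab" "restrict g (nbhd S) = restrict h (nbhd S)"
  have "g s = h s" if "s \<in> nbhd S" for s using fun_cong[OF gh(3), of s] that by simp
  then show "\<pi> g x = \<pi> h x" using gh by (intro pi_cong[OF assms]) auto
qed

lemma irreducible_stab_subspace:
  obtains B where "finite B" "csubspace (span B)" "span B \<noteq> {0}" "span B \<subseteq> fixed (nbhd S)"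
    "\<And>g w. g \<in> stab \<Longrightarrow> w \<in> span B \<Longrightarrow> \<pi> g w \<in> span B"
    "\<And>V. csubspace V \<Longrightarrow> V \<noteq> {0} \<Longrightarrow> V \<subseteq> span B \<Longrightarrow> (\<And>g w. g \<in> stab \<Longrightarrow> w \<in> V \<Longrightarrow> \<pi> g w \<in> V) \<Longrightarrow>
       V = span B"
proof -
  let ?F = "fixed (nbhd S)"
  obtain x where x: "x \<in> ?F" "x \<noteq> 0"
    using S(4) subspace_0[OF csubspace_subspace[OF csubspace_fixed]] by blast
  have ix: "scaleC \<i> x \<in> ?F" by (rule csubspace_scaleC[OF csubspace_fixed x(1)])
  \<comment> \<open>The orbit of \<open>scaleC \<i> x\<close> is added because \<open>span\<close>
    is real; the union then spans a complex subspace.\<close>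
  define X where "X = (\<lambda>g. \<pi> g x) ` stab \<union> (\<lambda>g. \<pi> g (scaleC \<i> x)) ` stab"
  have fin: "finite X" unfolding X_def using finite_stab_orbit x(1) ix by blast
  have XF: "X \<subseteq> ?F" unfolding X_def using pi_stab_fixed x(1) ix by blast
  have id: "id \<in> stab" using G_id by simp
  have xX: "x \<in> X" using imageI[OF id, of "\<lambda>g. \<pi> g x"] pi_id by (simp add: X_def)
  have cs: "csubspace (span X)"
  proof (rule csubspace_span)
    fix c y assume "y \<in> X"
    then obtain g where g: "g \<in> stab" "y = \<pi> g x \<or> y = \<pi> g (scaleC \<i> x)" by (auto simp: X_def)
    have gi: "\<pi> g (scaleC \<i> z) = scaleC \<i> (\<pi> g z)" for z
      using bounded_clinear_scaleC[OF pi_bcl] g(1) by blast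
    have "\<pi> g x \<in> X" "\<pi> g (scaleC \<i> x) \<in> X" using g(1) unfolding X_def by blast+
    then have in1: "\<pi> g x \<in> span X" "scaleC \<i> (\<pi> g x) \<in> span X"
      unfolding gi by (auto intro: span_base)
    have "scaleC \<i> y \<in> span X"
      using g(2) in1 by (auto simp: gi scaleC_scaleC scaleC_minus_left intro: span_neg)
    moreover have "y \<in> span X" using g(2) in1 gi by auto
    ultimately show "scaleC c y \<in> span X" unfolding scaleC_Re_Im[of c y] by (intro span_add span_scale)
  qed
  have inv: "\<pi> g w \<in> span X" if g: "g \<in> stab" and w: "w \<in> span X" for g w
  proof -
    have gG: "g \<in> G" using g by simp
    have "\<pi> g ` X \<subseteq> X"
    proof
      fix y assume "y \<in> \<pi> g ` X"
      then obtain h z where h: "h \<in> stab" "z \<in> {x, scaleC \<i> x}" "y = \<pi> g (\<pi> h z)" by (auto simp: X_def)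
      then have "y = \<pi> (g \<circ> h) z" using pi_comp[OF gG] by simp
      then show "y \<in> X" using stab_comp[OF g h(1)] h(2) by (auto simp: X_def)
    qed
    then have "span (\<pi> g ` X) \<subseteq> span X" by (rule span_mono)
    then show ?thesis using linear_span_image[OF bounded_linear.linear[OF pi_bl[OF gG]], of X] w by blast
  qed
  have "x \<in> span X" using xX by (rule span_base)
  then have nz: "span X \<noteq> {0}" using x(2) by blast
  have sF: "span X \<subseteq> ?F" by (rule span_minimal[OF XF csubspace_subspace[OF csubspace_fixed]])
  show ?thesis
  proof (rule minimal_invariant_subspace[OF fin cs nz, of "\<pi> ` stab"])
    show "A w \<in> span X" if "A \<in> \<pi> ` stab" "w \<in> span X" for A w using that inv by blast
    fix B assume B: "finite B" "csubspace (span B)" "span B \<noteq> {0}" "span B \<subseteq> span X"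
      "\<And>A w. A \<in> \<pi> ` stab \<Longrightarrow> w \<in> span B \<Longrightarrow> A w \<in> span B"
      "\<And>V. csubspace V \<Longrightarrow> V \<noteq> {0} \<Longrightarrow> V \<subseteq> span B \<Longrightarrow>
         (\<And>A w. A \<in> \<pi> ` stab \<Longrightarrow> w \<in> V \<Longrightarrow> A w \<in> V) \<Longrightarrow> V = span B"
    show ?thesis
    proof (rule that[OF B(1-3)])
      show "span B \<subseteq> ?F" using B(4) sF by blast
      show "\<pi> g w \<in> span B" if "g \<in> stab" "w \<in> span B" for g w using B(5) that by blast
      show "V = span B" if "csubspace V" "V \<noteq> {0}" "V \<subseteq> span B" "\<And>g w. g \<in> stab \<Longrightarrow> w \<in> V \<Longrightarrow> \<pi> g w \<in> V"
        for V using B(6)[OF that(1-3)] that(4) by blast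
    qed
  qed
qed

text \<open>The operator \<open>a\<close> need not preserve \<open>span B\<close>, so Schur's
  argument is run on its compression. This still commutes with \<open>stab\<close>, and one of its
  eigenspaces is a nonzero invariant subspace, hence everything.\<close>

lemma schur_comm:
  assumes B: "finite B" "csubspace (span B)" "span B \<noteq> {0}"
    and inv: "\<And>g w. g \<in> stab \<Longrightarrow> w \<in> span B \<Longrightarrow> \<pi> g w \<in> span B"
    and irr: "\<And>V. csubspace V \<Longrightarrow> V \<noteq> {0} \<Longrightarrow> V \<subseteq> span B \<Longrightarrow>
       (\<And>g w. g \<in> stab \<Longrightarrow> w \<in> V \<Longrightarrow> \<pi> g w \<in> V) \<Longrightarrow> V = span B"
    and a: "a \<in> comm"
  shows "\<exists>c. \<forall>w\<in>span B. hproj (span B) (a w) = scaleC c w"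
proof -
  let ?V = "span B"
  note V = closed_span_finite[OF B(1)] csubspace_subspace[OF B(2)]
  let ?T = "\<lambda>w. hproj ?V (a w)"
  have T: "bounded_clinear ?T"
    by (rule bounded_clinear_compose[OF bounded_clinear_hproj[OF V(1) B(2)] commutant_bounded[OF a]])
  interpret T: bounded_linear ?T by (rule bounded_clinear_bl[OF T])
  obtain v where v: "v \<in> ?V" "v \<noteq> 0" using B(3) subspace_0[OF V(2)] by blast
  obtain c w where cw: "w \<in> ?V" "w \<noteq> 0" "?T w = scaleC c w"
    using eigenvector_exists[OF T B(2) order_refl B(1) v] hproj_in[OF V] by blast
  define V' where "V' = {w \<in> ?V. ?T w = scaleC c w}"
  have "csubspace V'"
    unfolding csubspace_def subspace_def V'_def
    using subspace_0[OF V(2)] subspace_add[OF V(2)] subspace_scale[OF V(2)] csubspace_scaleC[OF B(2)]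
      bounded_clinear_scaleC[OF T]
    by (auto simp: T.zero T.add T.scaleR scaleC_add_right scaleC_scaleR scaleC_scaleC mult.commute)
  moreover have "V' \<noteq> {0}" using cw by (auto simp: V'_def)
  moreover have "V' \<subseteq> ?V" by (auto simp: V'_def)
  moreover have "\<pi> g w \<in> V'" if g: "g \<in> stab" and w: "w \<in> V'" for g w
  proof -
    obtain k where k: "k \<in> stab" "\<And>x. g (k x) = x" using stab_inv[OF g] by blast
    have G: "g \<in> G" "k \<in> G" using g k(1) by auto
    interpret g: bounded_linear "\<pi> g" by (rule pi_bl[OF G(1)])
    have "hproj ?V (\<pi> g z) = \<pi> g (hproj ?V z)" for z
      by (rule hproj_commute[OF V, where T'="\<pi> k"])
        (use g.diff pi_adjoint(2)[OF G k(2)] inv g k(1) in auto)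
    then show ?thesis
      using w inv[OF g] comm_pi[OF a G(1)] bounded_clinear_scaleC[OF pi_bcl[OF G(1)]] by (simp add: V'_def)
  qed
  ultimately have "V' = ?V" by (rule irr)
  then show ?thesis by (auto simp: V'_def)
qed

text \<open>
  For \<open>\<eta>\<close> in an irreducible finite-dimensional representation of the setwise stabilizer of \<open>S\<close>, the
  projection \<open>q\<close> onto the closure of \<open>comm \<eta>\<close> is minimal: by Schur's lemma every \<open>q A q\<close> is a scalar
  multiple of \<open>q\<close>.
\<close>

lemma abelian_subtree:
  "\<exists>P. abelian_projection vN P \<and> P \<noteq> (\<lambda>x. 0) \<and> Z \<circ> P = P"
proof -
  let ?F = "fixed (nbhd S)"
  obtain B where B: "finite B" "csubspace (span B)" "span B \<noteq> {0}" "span B \<subseteq> ?F"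
    and inv: "\<And>g w. g \<in> stab \<Longrightarrow> w \<in> span B \<Longrightarrow> \<pi> g w \<in> span B"
    and irr: "\<And>V. csubspace V \<Longrightarrow> V \<noteq> {0} \<Longrightarrow> V \<subseteq> span B \<Longrightarrow>
       (\<And>g w. g \<in> stab \<Longrightarrow> w \<in> V \<Longrightarrow> \<pi> g w \<in> V) \<Longrightarrow> V = span B"
    by (rule irreducible_stab_subspace) blast
  note V = closed_span_finite[OF B(1)] csubspace_subspace[OF B(2)]
  obtain \<eta> where \<eta>: "\<eta> \<in> span B" "\<eta> \<noteq> 0" using B(3) subspace_0[OF V(2)] by blast
  have \<eta>F: "\<eta> \<in> ?F" using \<eta>(1) B(4) by blast
  define W0 where "W0 = (\<lambda>a. a \<eta>) ` comm"
  define W where "W = closure W0"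
  have W0F: "W0 \<subseteq> ?F" using comm_fixed[OF _ \<eta>F] by (auto simp: W0_def)
  have WF: "W \<subseteq> ?F" unfolding W_def by (rule closure_minimal[OF W0F closed_fixed])
  have cs0: "csubspace W0" unfolding W0_def by (rule csubspace_commutant_orbit) (auto simp: pi_bcl)
  have W: "closed W" "csubspace W" by (auto simp: W_def csubspace_closure[OF cs0])
  note Ws = csubspace_subspace[OF W(2)]
  have aW: "a w \<in> W" if a: "a \<in> comm" and w: "w \<in> W" for a w
  proof -
    have "a ` W \<subseteq> closure (a ` W0)"
      unfolding W_def by (rule closure_bounded_linear_image_subset[OF bounded_clinear_bl[OF commutant_bounded[OF a]]])
    also have "a ` W0 \<subseteq> W0" using commutant_comp[OF a] by (force simp: W0_def)
    then have "closure (a ` W0) \<subseteq> W" unfolding W_def by (rule closure_mono)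
    finally show ?thesis using w by blast
  qed
  have cinv: "comm_invariant W" using W WF fixed_Z aW by (auto simp: comm_invariant_def)
  have \<eta>W: "\<eta> \<in> W"
    using imageI[OF commutant_id, of "\<lambda>a. a \<eta>" "\<pi> ` G"] closure_subset[of W0] by (auto simp: W_def W0_def)
  let ?q = "hproj W"
  let ?L = "span {\<eta>, scaleC \<i> \<eta>}"
  have Lc: "csubspace ?L"
  proof (rule csubspace_span)
    fix c x assume x: "x \<in> {\<eta>, scaleC \<i> \<eta>}"
    have in1: "\<eta> \<in> ?L" "scaleC \<i> \<eta> \<in> ?L" by (auto intro: span_base)
    have "scaleC \<i> x \<in> ?L" using x in1 by (auto simp: scaleC_scaleC scaleC_minus_left intro: span_neg)
    moreover have "x \<in> ?L" using x in1 by auto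
    ultimately show "scaleC c x \<in> ?L" unfolding scaleC_Re_Im[of c x] by (intro span_add span_scale)
  qed
  have Lcl: "closed ?L" by (rule closed_span_finite) simp
  note Ls = csubspace_subspace[OF Lc]
  have L_scalar: "\<exists>c. x = scaleC c \<eta>" if "x \<in> ?L" for x
    using that
  proof (induction rule: span_induct_alt)
    case base
    show ?case by (intro exI[of _ 0]) simp
  next
    case (step c x y)
    then obtain e where e: "y = scaleC e \<eta>" by blast
    have "\<exists>e'. c *\<^sub>R x = scaleC e' \<eta>" using step(1) by (auto simp: scaleR_eq_scaleC scaleC_scaleC)
    then show ?case using e scaleC_add_left by metis
  qed
  have q_pi: "?q (\<pi> g \<eta>) \<in> ?L" if g: "g \<in> G" for g
  proof (cases "g ` S = S")
    case False
    have "?q (\<pi> g \<eta>) = 0"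
    proof (rule hproj_eqI[OF W(1) Ws subspace_0[OF Ws]])
      fix w assume "w \<in> W"
      then have "inner w (\<pi> g \<eta>) = 0" using orthogonal_translate[OF g False _ \<eta>F] WF by blast
      then show "inner (\<pi> g \<eta> - 0) w = 0" by (simp add: inner_commute)
    qed
    then show ?thesis by (simp add: span_zero)
  next
    case True
    then have gs: "g \<in> stab" using g by simp
    define x where "x = \<pi> g \<eta>"
    have x: "x \<in> span B" unfolding x_def by (rule inv[OF gs \<eta>(1)])
    \<comment> \<open>The coefficient of the complex projection of \<open>x\<close> onto \<eta>. The
      remainder must be orthogonal to all complex multiples of \<eta>, since up to vectors
      orthogonal to \<open>span B\<close> the vector \<open>a \<eta>\<close> is such a
      multiple.\<close>
    define e where "e = cinner x \<eta> / cinner \<eta> \<eta>"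
    have e0: "cinner (x - scaleC e \<eta>) \<eta> = 0"
      using \<eta>(2) by (simp add: cinner_diff_left cinner_scaleC_left e_def cinner_self_eq_0)
    have xe: "x - scaleC e \<eta> \<in> span B"
      by (intro span_diff x csubspace_scaleC[OF B(2)] \<eta>(1))
    have "inner (x - scaleC e \<eta>) (a \<eta>) = 0" if a: "a \<in> comm" for a
    proof -
      obtain c where c: "\<forall>w\<in>span B. hproj (span B) (a w) = scaleC c w"
        using schur_comm[OF B(1-3) inv irr a] by blast
      have "inner (a \<eta> - hproj (span B) (a \<eta>)) (x - scaleC e \<eta>) = 0" by (rule hproj_orth[OF V xe])
      then have "inner (a \<eta>) (x - scaleC e \<eta>) = inner (scaleC c \<eta>) (x - scaleC e \<eta>)"
        using c \<eta>(1) inner_diff_left[of "a \<eta>" "scaleC c \<eta>" "x - scaleC e \<eta>"] by simp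
      then have "inner (x - scaleC e \<eta>) (a \<eta>) = inner (x - scaleC e \<eta>) (scaleC c \<eta>)"
        by (simp only: inner_commute)
      also have "\<dots> = 0" by (simp add: inner_eq_Re_cinner cinner_scaleC_right e0)
      finally show ?thesis .
    qed
    then have "W0 \<subseteq> {w. inner (x - scaleC e \<eta>) w = 0}" by (auto simp: W0_def)
    then have orth: "W \<subseteq> {w. inner (x - scaleC e \<eta>) w = 0}"
      unfolding W_def by (rule closure_minimal) (rule closed_hyperplane)
    have "?q x = scaleC e \<eta>"
      by (rule hproj_eqI[OF W(1) Ws csubspace_scaleC[OF W(2) \<eta>W]]) (use orth in blast)
    then show ?thesis unfolding x_def using csubspace_scaleC[OF Lc span_base] by simp
  qed
  have q_vN: "\<exists>c. ?q (A \<eta>) = scaleC c \<eta>" if A: "A \<in> vN" for A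
  proof -
    \<comment> \<open>Membership in \<open>?L\<close> is written as a fixed-point equation to give
      it the form that \<open>vN_pair\<close> extends.\<close>
    have "?q (A \<eta>) = hproj ?L (?q (A \<eta>))"
    proof (rule vN_pair[OF bounded_clinear_hproj[OF W] bounded_clinear_compose[OF bounded_clinear_hproj[OF Lcl Lc]
          bounded_clinear_hproj[OF W]] _ A])
      fix g assume "g \<in> G"
      then show "?q (\<pi> g \<eta>) = hproj ?L (?q (\<pi> g \<eta>))" using hproj_id[OF Lcl Ls q_pi] by simp
    qed
    then have "?q (A \<eta>) \<in> ?L" using hproj_in[OF Lcl Ls] by metis
    then show ?thesis by (rule L_scalar)
  qed
  have qvN: "?q \<in> vN" by (rule hproj_vN[OF cinv])
  have scalar: "\<exists>c. \<forall>w\<in>W. ?q (A w) = scaleC c w" if A: "A \<in> vN" for A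
  proof -
    obtain c where c: "?q (A \<eta>) = scaleC c \<eta>" using q_vN[OF A] by blast
    interpret q: bounded_linear ?q by (rule bounded_linear_hproj[OF W(1) Ws])
    interpret A: bounded_linear A by (rule bounded_clinear_bl[OF commutant_bounded[OF A]])
    interpret C: bounded_linear "scaleC c :: 'h \<Rightarrow> 'h" by (rule bounded_linear_scaleC)
    \<comment> \<open>Both \<open>?q\<close> and \<open>A\<close> commute with the commutant, so the
      scalar found at \<eta> is the same on its whole orbit and, by continuity, on
      \<open>W\<close>.\<close>
    have "?q (A (a \<eta>)) = scaleC c (a \<eta>)" if a: "a \<in> comm" for a
      using commutant_commute[OF A a, of \<eta>] commutant_commute[OF qvN a, of "A \<eta>"] c
        bounded_clinear_scaleC[OF commutant_bounded[OF a]] by simp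
    then have "W0 \<subseteq> {w. ?q (A w) = scaleC c w}" by (auto simp: W0_def)
    moreover have "closed {w. ?q (A w) = scaleC c w}"
      by (intro closed_Collect_eq q.continuous_on A.continuous_on C.continuous_on continuous_intros)
    ultimately have "W \<subseteq> {w. ?q (A w) = scaleC c w}" unfolding W_def by (rule closure_minimal)
    then show ?thesis by blast
  qed
  have "abelian_projection vN ?q"
  proof (rule abelian_corner[OF cinv])
    fix A A' w assume A: "A \<in> vN" "A' \<in> vN" and w: "w \<in> W"
    obtain c where c: "\<And>w. w \<in> W \<Longrightarrow> ?q (A w) = scaleC c w" using scalar[OF A(1)] by blast
    obtain c' where c': "\<And>w. w \<in> W \<Longrightarrow> ?q (A' w) = scaleC c' w" using scalar[OF A(2)] by blast
    show "?q (A (?q (A' w))) = ?q (A' (?q (A w)))"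
      using c c' w csubspace_scaleC[OF W(2) w] by (simp add: scaleC_scaleC mult.commute)
  qed
  moreover have "?q \<noteq> (\<lambda>x. 0)" using proj_nonzero[OF cinv] \<eta>(2) \<eta>W by blast
  ultimately show ?thesis using proj_le[OF cinv] by blast
qed

end

lemma abelian_below_central:
  assumes "Z \<noteq> (\<lambda>x. 0)"
  shows "\<exists>P. abelian_projection vN P \<and> P \<noteq> (\<lambda>x. 0) \<and> Z \<circ> P = P"
proof -
  have from_fixed: ?thesis if "abelian_projection vN (hproj (fixed F))" "fixed F \<noteq> {0}" for F
    using that proj_nonzero[OF comm_invariant_fixed] proj_le[OF comm_invariant_fixed] by blast
  show ?thesis
  proof (cases "\<exists>v. fixed {v} \<noteq> {0}")
    case True
    then show ?thesis using from_fixed abelian_vertex by blast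
  next
    case False
    then have nv: "\<And>v. fixed {v} = {0}" by blast
    show ?thesis
    proof (cases "\<exists>x y. E x y \<and> fixed {x, y} \<noteq> {0}")
      case True
      then show ?thesis using from_fixed abelian_edge[OF _ nv] by blast
    next
      case False
      then have ne: "\<And>x y. E x y \<Longrightarrow> fixed {x, y} = {0}" by blast
      obtain x where "Z x \<noteq> 0" using assms by blast
      then obtain F where F: "finite F" "fixed F \<noteq> {0}" using fixed_nonzero_finite[of "Z x"] Z_Z by blast
      define Q where "Q S \<longleftrightarrow> finite S \<and> tree_convex S \<and> S \<noteq> {} \<and> fixed (nbhd S) \<noteq> {0}" for S
      have "\<exists>S. Q S"
      proof -
        fix v :: 'v
        \<comment> \<open>Inserting 0 keeps \<open>Max\<close> meaningful when \<open>F\<close> is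
          empty.\<close>
        define n where "n = Max (insert 0 (D v ` F))"
        have "D v s \<le> n" if "s \<in> F" for s unfolding n_def using F(1) that by (intro Max_ge) auto
        then have "F \<subseteq> nbhd {z. D v z \<le> n}" by (auto simp: nbhd_def)
        then have "fixed F \<subseteq> fixed (nbhd {z. D v z \<le> n})" by (rule fixed_mono)
        moreover have "0 \<in> fixed F" by (rule subspace_0[OF csubspace_subspace[OF csubspace_fixed]])
        ultimately have "fixed (nbhd {z. D v z \<le> n}) \<noteq> {0}" using F(2) by blast
        moreover have "v \<in> {z. D v z \<le> n}" by simp
        ultimately have "Q {z. D v z \<le> n}" unfolding Q_def using finite_ball tree_convex_ball by blast
        then show ?thesis by blast
      qed
      then obtain S where S: "Q S" "\<And>S'. Q S' \<Longrightarrow> card S \<le> card S'"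
        using ex_has_least_nat[of Q _ card] by blast
      show ?thesis by (rule abelian_subtree[of S]) (use nv ne S in \<open>auto simp: Q_def\<close>)
    qed
  qed
qed

end

lemma (in tree_group_rep) type_I_vN: "type_I_von_neumann_algebra vN"
  unfolding type_I_von_neumann_algebra_def
proof (intro conjI allI impI von_neumann_algebra_vN)
  fix Z assume Z: "central_projection vN Z \<and> Z \<noteq> (\<lambda>x. 0)"
  interpret tree_group_rep_central d E G \<pi> Z by unfold_locales (use Z in blast)
  show "\<exists>P. abelian_projection vN P \<and> P \<noteq> (\<lambda>x. 0) \<and> Z \<circ> P = P"
    by (rule abelian_below_central) (use Z in blast)
qed

theorem theorem3p5:
  fixes d :: nat
    and E :: "'v \<Rightarrow> 'v \<Rightarrow> bool"
    and G :: "('v \<Rightarrow> 'v) set"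
  assumes "d \<ge> 3"
    and "regular_tree d E"
    and "subgroup G (Aut E)"
    and "closedin (Aut_topology E) G"
    and "\<not> compactin (Aut_topology E) G"
    and "vertex_transitive G"
    and "boundary_transitive E G"
    and "tits_independence E G"
  shows "locally_compact_group (Aut E\<lparr>carrier := G\<rparr>) (subtopology (Aut_topology E) G) \<and>
    (\<forall>\<pi> :: ('v \<Rightarrow> 'v) \<Rightarrow> 'h::chilbert_space \<Rightarrow> 'h.
       unitary_representation (Aut E\<lparr>carrier := G\<rparr>) (subtopology (Aut_topology E) G) \<pi> \<longrightarrow>
       type_I_von_neumann_algebra (commutant (commutant (\<pi> ` G))))"
proof -
  interpret tree_group d E G by (rule tree_group.intro) fact+
  show ?thesis
  proof (intro conjI allI impI)
    show "locally_compact_group GG GT" by (rule locally_compact_group_G) fact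
    fix \<pi> :: "('v \<Rightarrow> 'v) \<Rightarrow> 'h::chilbert_space \<Rightarrow> 'h"
    assume "unitary_representation GG GT \<pi>"
    then interpret tree_group_rep d E G \<pi> by unfold_locales
    show "type_I_von_neumann_algebra (commutant (commutant (\<pi> ` G)))" by (rule type_I_vN)
  qed
qed

end
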